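(* Let $\Phi$ satisfy the standing assumption on the scattering factor (with constants $b_0\in(0,1)$, $\eta\in[0,1)$) given in the context, and let $(F_t)_{t\ge 0}$ be a conservative isotropic measure solution with particle number $N>0$ and energy $E>0$. Let $F_{\rm be}$ be the Bose--Einstein equilibrium with the same particle number $N$ and energy $E$. Suppose that $\overline T/\overline T_c<1$ (equivalently, $N_c:=F_{\rm be}(\{0\})>0$), and that $\|F_t-F_{\rm be}\|_1^\circ\to 0$ as $t\to\infty$. Write $N_c(t):=F_t(\{0\})$. Then there exists a finite time $T\ge 0$ such that $$N_c(T)=F_T(\{0\})>0.$$ Furthermore, $$N_c(t)\ge e^{-\sqrt{NE}\,(t-T)}N_c(T)>0\qquad\text{for all } t\ge T,$$ and, as $t\to\infty$, $N_c(t)\to N_c$ and $\|F_t-F_{\rm be}\|_1\to 0$.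
   Context: Scattering factor assumption: $\Phi\in C([0,\infty)^2)$ is nonnegative, symmetric, nondecreasing in each coordinate, and for some $b_0\in(0,1)$ and $\eta\in[0,1)$, $b_0\min\{1,(r^2+\rho^2)^\eta\}\le\Phi(r,\rho)\le 1$ for all $r,\rho\ge 0$. Reduced kernel $W$: for $x,y,z\ge0$ put $x_*=(y+z-x)_+$ (with $a_+=\max\{a,0\}$), $\sigma_-=\max\{|\sqrt x-\sqrt y|,|\sqrt{x_*}-\sqrt z|\}$, $\sigma_+=\min\{\sqrt x+\sqrt y,\sqrt{x_*}+\sqrt z\}$. For $\sigma\in[\sigma_-,\sigma_+]$, $\theta\in[0,2\pi]$ let $Y_*=\Big|\sqrt{\big(z-\tfrac{(x-y+\sigma^2)^2}{4\sigma^2}\big)_+}+e^{\mathrm i\theta}\sqrt{\big(x-\tfrac{(x-y+\sigma^2)^2}{4\sigma^2}\big)_+}\Big|$ if $\sigma>0$, and $Y_*=0$ if $\sigma=0$. If $x_*xyz>0$, $W(x,y,z)=\frac{1}{4\pi\sqrt{xyz}}\int_{\sigma_-}^{\sigma_+}\int_0^{2\pi}\Phi(\sqrt2\,\sigma,\sqrt2\,Y_* )\,d\theta\,d\sigma$. If $x_*xyz=0$: $W=\Phi(\sqrt{2y},\sqrt{2z})/\sqrt{yz}$ when $x=0,y>0,z>0$; $W=\Phi(\sqrt{2x},\sqrt{2(z-x)})/\sqrt{xz}$ when $y=0$, $0<x\le z$; $W=\Phi(\sqrt{2(y-x)},\sqrt{2x})/\sqrt{xy}$ when $z=0$, $0<x\le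 y$; $W=0$ otherwise. Collision forms: for a test function $\varphi$, $\Delta\varphi(x,y,z)=\varphi(x)+\varphi(x_* )-\varphi(y)-\varphi(z)$, $\mathcal K[\varphi]=W\,\Delta\varphi$, $\mathcal J[\varphi](y,z)=\frac12\int_0^{y+z}\mathcal K[\varphi](x,y,z)\sqrt x\,dx$. Measures: $\mathcal B_1^+([0,\infty))$ is the set of nonnegative Borel measures $F$ on $[0,\infty)$ with $\int(1+x)\,dF<\infty$; $N(F)=\int dF$ (particle number, or mass), $E(F)=\int x\,dF$ (energy). Conservative isotropic measure solution: a family $(F_t)_{t\ge0}\subset\mathcal B_1^+([0,\infty))$ with $N(F_t)=N$, $E(F_t)=E$ for all $t\ge0$ and such that for every $\varphi\in C_b^2([0,\infty))$ (that is, $\varphi\in C^2$ with $\varphi,\varphi',\varphi''$ bounded) the map $t\mapsto\int\varphi\,dF_t$ is $C^1$ on $[0,\infty)$ and for every $t\ge0$ $\frac{d}{dt}\int\varphi\,dF_t=\iint\mathcal J[\varphi](y,z)\,dF_t(y)dF_t(z)+\iiint\mathcal K[\varphi](x,y,z)\,dF_t(x)dF_t(y)dF_t(z)$, all integrals over $[0,\infty)$ in each variable. Temperature ratio: $\frac{\overline T}{\overline T_c}=\frac{(2\pi)^{1/3}[\zeta(3/2)]^{5/3}}{3\zeta(5/2)}\frac{E}{N^{5/3}}$, with $\zeta$ the Riemann zeta function. Bose--Einstein equilibrium with particle number $N>0$ and energy $E>0$: the measure $dF_{\rm be}(x)=\frac{1}{Ae^{x/\kappa}-1}\sqrt x\,dx+N_c\,\delta_0(dx)$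 where $N_c=F_{\rm be}(\{0\})=\big(1-(\overline T/\overline T_c)^{3/5}\big)_+N$, and $A\ge1$, $\kappa>0$ are determined by $N(F_{\rm be})=N$, $E(F_{\rm be})=E$ (with $A=1$ when $\overline T/\overline T_c\le 1$). Norms: for a signed Borel measure $\mu$ on $[0,\infty)$ with total variation $|\mu|$, $\|\mu\|_1^\circ=\int x\,d|\mu|(x)$ and $\|\mu\|_1=\int(1+x)\,d|\mu|(x)$. *)

theory Defs
  imports "HOL-Analysis.Analysis"
begin

text \<open>
  Functions on \<open>[0,\<infinity>)\<close> are represented by functions on \<^typ>\<open>real\<close> of which only the values at
  nonnegative arguments are used. Measures on \<open>[0,\<infinity>)\<close> have the following space and sets.
\<close>

definition halfline :: "real measure" where
  "halfline = restrict_space borel {0..}"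

lemma space_halfline [simp]: "space halfline = {0..}"
  by (simp add: halfline_def space_restrict_space)

text \<open>
  Since \<^term>\<open>0 powr \<eta> = (0::real)\<close> also for \<^term>\<open>\<eta> = (0::real)\<close>, the lower bound at the
  origin reads \<open>0 \<le> \<Phi> 0 0\<close>; for \<^term>\<open>\<eta> = (0::real)\<close> and the convention \<open>0\<^sup>0 = 1\<close>
  the bound \<open>b0 \<le> \<Phi> 0 0\<close> follows from the bound elsewhere and the continuity of \<open>\<Phi>\<close>.
\<close>

definition scattering_factor :: "real \<Rightarrow> real \<Rightarrow> (real \<Rightarrow> real \<Rightarrow> real) \<Rightarrow> bool" where
  "scattering_factor b0 \<eta> \<Phi> \<longleftrightarrow>
     0 < b0 \<and> b0 < 1 \<and> 0 \<le> \<eta> \<and> \<eta> < 1 \<and>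
     continuous_on ({0..} \<times> {0..}) (\<lambda>(r, \<rho>). \<Phi> r \<rho>) \<and>
     (\<forall>r\<ge>0. \<forall>\<rho>\<ge>0. 0 \<le> \<Phi> r \<rho>) \<and>
     (\<forall>r\<ge>0. \<forall>\<rho>\<ge>0. \<Phi> r \<rho> = \<Phi> \<rho> r) \<and>
     (\<forall>\<rho>\<ge>0. mono_on {0..} (\<lambda>r. \<Phi> r \<rho>)) \<and>
     (\<forall>r\<ge>0. mono_on {0..} (\<lambda>\<rho>. \<Phi> r \<rho>)) \<and>
     (\<forall>r\<ge>0. \<forall>\<rho>\<ge>0. b0 * min 1 ((r\<^sup>2 + \<rho>\<^sup>2) powr \<eta>) \<le> \<Phi> r \<rho> \<and> \<Phi> r \<rho> \<le> 1)"

definition xstar :: "real \<Rightarrow> real \<Rightarrow> real \<Rightarrow> real" where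
  "xstar x y z = max (y + z - x) 0"

definition sigma_minus :: "real \<Rightarrow> real \<Rightarrow> real \<Rightarrow> real" where
  "sigma_minus x y z = max \<bar>sqrt x - sqrt y\<bar> \<bar>sqrt (xstar x y z) - sqrt z\<bar>"

definition sigma_plus :: "real \<Rightarrow> real \<Rightarrow> real \<Rightarrow> real" where
  "sigma_plus x y z = min (sqrt x + sqrt y) (sqrt (xstar x y z) + sqrt z)"

definition Ystar :: "real \<Rightarrow> real \<Rightarrow> real \<Rightarrow> real \<Rightarrow> real \<Rightarrow> real" where
  "Ystar x y z \<sigma> \<theta> =
     (if \<sigma> > 0 then
        cmod (complex_of_real (sqrt (max (z - (x - y + \<sigma>\<^sup>2)\<^sup>2 / (4 * \<sigma>\<^sup>2)) 0)) +
              exp (\<i> * complex_of_real \<theta>) *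
              complex_of_real (sqrt (max (x - (x - y + \<sigma>\<^sup>2)\<^sup>2 / (4 * \<sigma>\<^sup>2)) 0)))
      else 0)"

definition kernel_W :: "(real \<Rightarrow> real \<Rightarrow> real) \<Rightarrow> real \<Rightarrow> real \<Rightarrow> real \<Rightarrow> real" where
  "kernel_W \<Phi> x y z =
     (if xstar x y z * x * y * z > 0 then
        1 / (4 * pi * sqrt (x * y * z)) *
        (LINT \<sigma>:{sigma_minus x y z..sigma_plus x y z}|lborel.
           (LINT \<theta>:{0..2*pi}|lborel. \<Phi> (sqrt 2 * \<sigma>) (sqrt 2 * Ystar x y z \<sigma> \<theta>)))
      else if x = 0 \<and> y > 0 \<and> z > 0 then \<Phi> (sqrt (2 * y)) (sqrt (2 * z)) / sqrt (y * z)
      else if y = 0 \<and> 0 < x \<and> x \<le> z then \<Phi> (sqrt (2 * x)) (sqrt (2 * (z - x))) / sqrt (x * z)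
      else if z = 0 \<and> 0 < x \<and> x \<le> y then \<Phi> (sqrt (2 * (y - x))) (sqrt (2 * x)) / sqrt (x * y)
      else 0)"

definition Delta :: "(real \<Rightarrow> real) \<Rightarrow> real \<Rightarrow> real \<Rightarrow> real \<Rightarrow> real" where
  "Delta \<phi> x y z = \<phi> x + \<phi> (xstar x y z) - \<phi> y - \<phi> z"

definition coll_K ::
  "(real \<Rightarrow> real \<Rightarrow> real) \<Rightarrow> (real \<Rightarrow> real) \<Rightarrow> real \<Rightarrow> real \<Rightarrow> real \<Rightarrow> real" where
  "coll_K \<Phi> \<phi> x y z = kernel_W \<Phi> x y z * Delta \<phi> x y z"

definition coll_J :: "(real \<Rightarrow> real \<Rightarrow> real) \<Rightarrow> (real \<Rightarrow> real) \<Rightarrow> real \<Rightarrow> real \<Rightarrow> real" where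
  "coll_J \<Phi> \<phi> y z = 1 / 2 * (LINT x:{0..y + z}|lborel. coll_K \<Phi> \<phi> x y z * sqrt x)"

definition B1_plus :: "real measure set" where
  "B1_plus = {M. sets M = sets halfline \<and> (\<integral>\<^sup>+x. ennreal (1 + x) \<partial>M) < \<infinity>}"

definition particle_number :: "real measure \<Rightarrow> real" where
  "particle_number M = (LINT x|M. 1)"

definition energy :: "real measure \<Rightarrow> real" where
  "energy M = (LINT x|M. x)"

text \<open>The derivatives at \<open>0\<close> are one-sided.\<close>

definition Cb2 :: "(real \<Rightarrow> real) set" where
  "Cb2 = {\<phi>. \<exists>\<phi>' \<phi>''.
     (\<forall>x\<ge>0. (\<phi> has_real_derivative \<phi>' x) (at x within {0..})) \<and>
     (\<forall>x\<ge>0. (\<phi>' has_real_derivative \<phi>'' x) (at x within {0..})) \<and>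
     continuous_on {0..} \<phi>'' \<and>
     bounded (\<phi> ` {0..}) \<and> bounded (\<phi>' ` {0..}) \<and> bounded (\<phi>'' ` {0..})}"

definition collision_rhs ::
  "(real \<Rightarrow> real \<Rightarrow> real) \<Rightarrow> (real \<Rightarrow> real) \<Rightarrow> real measure \<Rightarrow> real" where
  "collision_rhs \<Phi> \<phi> M =
     (LINT (y, z)|(M \<Otimes>\<^sub>M M). coll_J \<Phi> \<phi> y z) +
     (LINT (x, y, z)|(M \<Otimes>\<^sub>M (M \<Otimes>\<^sub>M M)). coll_K \<Phi> \<phi> x y z)"

definition conservative_solution ::
  "(real \<Rightarrow> real \<Rightarrow> real) \<Rightarrow> real \<Rightarrow> real \<Rightarrow> (real \<Rightarrow> real measure) \<Rightarrow> bool" where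
  "conservative_solution \<Phi> N E F \<longleftrightarrow>
     (\<forall>t\<ge>0. F t \<in> B1_plus \<and> particle_number (F t) = N \<and> energy (F t) = E) \<and>
     (\<forall>\<phi>\<in>Cb2.
        (\<forall>t\<ge>0. ((\<lambda>s. LINT x|F s. \<phi> x) has_real_derivative collision_rhs \<Phi> \<phi> (F t))
                 (at t within {0..})) \<and>
        continuous_on {0..} (\<lambda>t. collision_rhs \<Phi> \<phi> (F t)))"

text \<open>Dirichlet series of the Riemann zeta function; only used for \<open>s > 1\<close>.\<close>

definition zeta_real :: "real \<Rightarrow> real" where
  "zeta_real s = (\<Sum>n. 1 / real (Suc n) powr s)"

definition temperature_ratio :: "real \<Rightarrow> real \<Rightarrow> real" where
  "temperature_ratio N E =
     (2 * pi) powr (1/3) * zeta_real (3/2) powr (5/3) / (3 * zeta_real (5/2)) * (E / N powr (5/3))"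

definition condensate_mass :: "real \<Rightarrow> real \<Rightarrow> real" where
  "condensate_mass N E = max (1 - temperature_ratio N E powr (3/5)) 0 * N"

definition bose_einstein_equilibrium :: "real \<Rightarrow> real \<Rightarrow> real measure \<Rightarrow> bool" where
  "bose_einstein_equilibrium N E M \<longleftrightarrow>
     sets M = sets halfline \<and>
     (\<exists>A\<ge>1. \<exists>\<kappa>>0. (temperature_ratio N E \<le> 1 \<longrightarrow> A = 1) \<and>
        (\<forall>B\<in>sets halfline. emeasure M B =
           (\<integral>\<^sup>+x\<in>B. ennreal (1 / (A * exp (x / \<kappa>) - 1) * sqrt x) \<partial>lborel) +
           ennreal (condensate_mass N E) * indicator B 0)) \<and>
     M \<in> B1_plus \<and> particle_number M = N \<and> energy M = E"

definition signed_diff :: "real measure \<Rightarrow> real measure \<Rightarrow> real set \<Rightarrow> real" where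
  "signed_diff M N B = measure M B - measure N B"

text \<open>A signed Borel measure on \<open>[0,\<infinity>)\<close> is represented by its set function \<open>\<mu>\<close>.\<close>

definition measurable_partitions :: "real set \<Rightarrow> (nat \<Rightarrow> real set) set" where
  "measurable_partitions B =
     {P. range P \<subseteq> sets halfline \<and> disjoint_family P \<and> (\<Union>i. P i) = B}"

definition total_variation :: "(real set \<Rightarrow> real) \<Rightarrow> real measure" where
  "total_variation \<mu> = measure_of {0..} (sets halfline)
     (\<lambda>B. SUP P\<in>measurable_partitions B. \<Sum>i. ennreal \<bar>\<mu> (P i)\<bar>)"

definition norm1_circ :: "(real set \<Rightarrow> real) \<Rightarrow> ennreal" where
  "norm1_circ \<mu> = (\<integral>\<^sup>+x. ennreal x \<partial>total_variation \<mu>)"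

definition norm1 :: "(real set \<Rightarrow> real) \<Rightarrow> ennreal" where
  "norm1 \<mu> = (\<integral>\<^sup>+x. ennreal (1 + x) \<partial>total_variation \<mu>)"

text \<open>
  The set function in \<^const>\<open>total_variation\<close> is indeed a measure, so that
  \<^const>\<open>measure_of\<close> does not fall back to the null measure.
\<close>

lemma sets_total_variation [simp]: "sets (total_variation \<mu>) = sets halfline"
  unfolding total_variation_def
  using sets.sigma_sets_eq[of halfline] sets.space_closed[of halfline] by simp

lemma emeasure_total_variation_signed_diff:
  assumes M: "finite_measure M" "sets M = sets halfline"
    and N: "finite_measure N" "sets N = sets halfline"
    and B: "B \<in> sets halfline"
  shows "emeasure (total_variation (signed_diff M N)) B =
    (SUP P\<in>measurable_partitions B. \<Sum>i. ennreal \<bar>signed_diff M N (P i)\<bar>)"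
proof -
  interpret M: finite_measure M by fact
  interpret N: finite_measure N by fact
  let ?\<mu> = "signed_diff M N"
  let ?T = "\<lambda>B. SUP P\<in>measurable_partitions B. \<Sum>i. ennreal \<bar>?\<mu> (P i)\<bar>"
  have "\<exists>Y\<in>sets M. (\<forall>X\<in>sets M. X \<subseteq> Y \<longrightarrow> N X \<le> M X) \<and>
                    (\<forall>X\<in>sets M. X \<inter> Y = {} \<longrightarrow> M X \<le> N X)"
    using M.finite_measure_axioms N.finite_measure_axioms assms
    by (intro finite_unsigned_Hahn_decomposition) auto
  then obtain Y where Y: "Y \<in> sets halfline"
    and Ypos: "\<And>X. X \<in> sets halfline \<Longrightarrow> X \<subseteq> Y \<Longrightarrow> 0 \<le> ?\<mu> X"
    and Yneg: "\<And>X. X \<in> sets halfline \<Longrightarrow> X \<inter> Y = {} \<Longrightarrow> ?\<mu> X \<le> 0"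
    by (auto simp: assms signed_diff_def M.emeasure_eq_measure N.emeasure_eq_measure)
  have sums: "(\<lambda>i. ?\<mu> (P i)) sums ?\<mu> (\<Union>i. P i)"
    if "range P \<subseteq> sets halfline" "disjoint_family P" for P
    unfolding signed_diff_def using that assms
    by (intro sums_diff M.finite_measure_UNION N.finite_measure_UNION) auto
  define p where "p = (\<lambda>B. ?\<mu> (B \<inter> Y) - ?\<mu> (B - Y))"
  have p_nonneg: "0 \<le> p B" if "B \<in> sets halfline" for B
    unfolding p_def using Ypos[of "B \<inter> Y"] Yneg[of "B - Y"] that Y
    by (smt (verit) Diff_disjoint Int_commute Int_lower2 sets.Diff sets.Int)
  have p_sums: "(\<lambda>i. p (P i)) sums p (\<Union>i. P i)"
    if "range P \<subseteq> sets halfline" "disjoint_family P" for P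
  proof -
    have "(\<lambda>i. ?\<mu> (P i \<inter> Y)) sums ?\<mu> (\<Union>i. P i \<inter> Y)"
      using that Y by (intro sums) (auto simp: disjoint_family_on_def)
    moreover have "(\<lambda>i. ?\<mu> (P i - Y)) sums ?\<mu> (\<Union>i. P i - Y)"
      using that Y by (intro sums) (auto simp: disjoint_family_on_def)
    ultimately show ?thesis
      unfolding p_def by (simp add: sums_diff)
  qed
  have split: "?\<mu> B = ?\<mu> (B \<inter> Y) + ?\<mu> (B - Y)" if "B \<in> sets halfline" for B
  proof -
    have "measure M B = measure M (B \<inter> Y) + measure M (B - Y)"
      using that Y assms M.finite_measure_Union[of "B \<inter> Y" "B - Y"] by (simp add: Int_Diff_Un Int_Diff_disjoint)
    moreover have "measure N B = measure N (B \<inter> Y) + measure N (B - Y)"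
      using that Y assms N.finite_measure_Union[of "B \<inter> Y" "B - Y"] by (simp add: Int_Diff_Un Int_Diff_disjoint)
    ultimately show ?thesis by (simp add: signed_diff_def)
  qed
  have abs_le: "\<bar>?\<mu> B\<bar> \<le> p B" if "B \<in> sets halfline" for B
    using split[OF that] Ypos[of "B \<inter> Y"] Yneg[of "B - Y"] that Y
    unfolding p_def by (smt (verit) Diff_disjoint Int_commute Int_lower2 sets.Diff sets.Int)
  have p_suminf: "(\<Sum>i. ennreal (p (P i))) = ennreal (p (\<Union>i. P i))"
    if "range P \<subseteq> sets halfline" "disjoint_family P" for P
    using p_sums[OF that] that p_nonneg by (intro suminf_ennreal_eq) auto
  have T_eq: "?T B = ennreal (p B)" if "B \<in> sets halfline" for B
  proof (rule antisym)
    show "?T B \<le> ennreal (p B)"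
    proof (rule SUP_least)
      fix P assume P: "P \<in> measurable_partitions B"
      then have "(\<Sum>i. ennreal \<bar>?\<mu> (P i)\<bar>) \<le> (\<Sum>i. ennreal (p (P i)))"
        by (intro suminf_le ennreal_leI abs_le) (auto simp: measurable_partitions_def)
      also have "\<dots> = ennreal (p B)"
        using P p_suminf[of P] by (simp add: measurable_partitions_def)
      finally show "(\<Sum>i. ennreal \<bar>?\<mu> (P i)\<bar>) \<le> ennreal (p B)" .
    qed
    let ?P = "binaryset (B \<inter> Y) (B - Y)"
    have "?P \<in> measurable_partitions B"
      using that Y
      by (auto simp: measurable_partitions_def range_binaryset_eq UN_binaryset_eq
          disjoint_family_on_def binaryset_def)
    then have "(\<Sum>i. ennreal \<bar>?\<mu> (?P i)\<bar>) \<le> ?T B"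
      by (rule SUP_upper)
    moreover have "(\<Sum>i. ennreal \<bar>?\<mu> (?P i)\<bar>) = ennreal (p B)"
    proof -
      have "(\<Sum>i. ennreal \<bar>?\<mu> (?P i)\<bar>) = ennreal \<bar>?\<mu> (B \<inter> Y)\<bar> + ennreal \<bar>?\<mu> (B - Y)\<bar>"
        by (rule suminf_binaryset_eq[where f = "\<lambda>S. ennreal \<bar>?\<mu> S\<bar>"]) (simp add: signed_diff_def)
      also have "\<dots> = ennreal (p B)"
      proof -
        have "0 \<le> ?\<mu> (B \<inter> Y)" "?\<mu> (B - Y) \<le> 0"
          using Ypos[of "B \<inter> Y"] Yneg[of "B - Y"] that Y by blast+
        then show ?thesis
          unfolding p_def by (simp flip: ennreal_plus)
      qed
      finally show ?thesis .
    qed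
    ultimately show "ennreal (p B) \<le> ?T B"
      by (simp only:)
  qed
  show ?thesis
  proof (rule emeasure_measure_of[OF total_variation_def])
    show "sets halfline \<subseteq> Pow {0..}"
      using sets.space_closed[of halfline] by simp
    show "B \<in> sets (total_variation ?\<mu>)"
      using B by simp
    show "positive (sets (total_variation ?\<mu>)) ?T"
      unfolding positive_def by (subst T_eq) (simp_all add: p_def signed_diff_def)
    show "countably_additive (sets (total_variation ?\<mu>)) ?T"
    proof (rule countably_additiveI)
      fix P :: "nat \<Rightarrow> real set"
      assume P: "range P \<subseteq> sets (total_variation ?\<mu>)" "disjoint_family P"
        "(\<Union>i. P i) \<in> sets (total_variation ?\<mu>)"
      then have P': "range P \<subseteq> sets halfline" "(\<Union>i. P i) \<in> sets halfline"
        by (simp_all only: sets_total_variation)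
      have "(\<Sum>i. ?T (P i)) = (\<Sum>i. ennreal (p (P i)))"
        using P' by (intro suminf_cong T_eq) blast
      also have "\<dots> = ennreal (p (\<Union>i. P i))"
        using P' P(2) by (intro p_suminf)
      also have "\<dots> = ?T (\<Union>i. P i)"
        using P' by (intro T_eq[symmetric])
      finally show "(\<Sum>i. ?T (P i)) = ?T (\<Union>i. P i)" .
    qed
  qed
qed

end

(*
  Write m(t) for the integral of the convex test function max 0 (1 - x / eps) ^ k against F t.
  Symmetrizing the cubic collision term shows that it is nonnegative on convex test functions, and the
  quadratic term loses at most sqrt (N * E) * m. Letting eps tend to 0, the atom at 0 decays at most
  like exp (- sqrt (N * E) * t).

  For the existence of an atom, the collisions among the particles with energies in [1, 2], whose
  number converges to a positive limit, keep m(t) at least of order eps powr (3 / 2). On the other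
  hand, while the shell (2 * eps, 4 * eps] carries a mass of at least eps powr (2 / k), stimulated
  emission multiplies m(t) by e within a time that is a positive power of eps, if k is large. As m(t)
  is bounded by N, this can only happen during a short time. Summing over dyadic eps below R, every
  time interval contains a time at which all these shells are nearly empty, and then nearly all the
  mass in [0, 4 * R] sits at 0. By the semi-strong convergence this mass is at least nearly that of
  the equilibrium condensate.
*)
theory Submission
  imports Defs
begin

section \<open>Truncated powers as test functions\<close>

text \<open>The weak formulation only sees C^2 test functions, and the norm in the hypothesis has
  the weight x: neither excludes that the mass near 0 stays spread over some (0, R] without an atom.
  Two costs are balanced. Particles of a shell whose energies differ by \<delta> \<epsilon> feed the
  test function at a point shifted by at most \<delta> \<epsilon>; undoing the shift costs (2
  \<delta>)^k N, which must stay below the lower bound of order \<epsilon>^(3/2) for m. The choice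
  \<delta> = \<epsilon>^(2/k) makes it of order \<epsilon>^2. On the other hand, finding particles
  that close in a shell of mass \<delta> lowers the growth rate to the order \<epsilon>^(\<eta> - 1)
  \<delta>^4 = \<epsilon>^(\<eta> - 1 + 8/k), which still blows up for large k because \<eta> < 1.
  The lower bound for m enters the waiting times only through a logarithm, so they are summable over
  dyadic scales. The sign of the symmetrized cubic term rests on the monotonicity of \<Phi> and on
  the symmetry of W in y and z; the latter is hidden in the definition of W and is recovered by a
  change of variables.\<close>

lemma has_real_derivative_max_0_power:
  fixes x :: real
  assumes "n \<ge> 2"
  shows "((\<lambda>x. max 0 x ^ n) has_real_derivative (real n * max 0 x ^ (n - 1))) (at x)"
proof -
  consider "x > 0" | "x < 0" | "x = 0" by linarith
  then show ?thesis
  proof cases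
    case 1
    have "((\<lambda>x::real. x ^ n) has_real_derivative (real n * x ^ (n - 1))) (at x)"
      by (auto intro!: derivative_eq_intros)
    then have "((\<lambda>x. max 0 x ^ n) has_real_derivative (real n * x ^ (n - 1))) (at x)"
      by (rule DERIV_cong_ev[THEN iffD1, rotated -1])
        (use 1 in \<open>auto simp: eventually_nhds_metric dist_real_def intro!: exI[of _ x]\<close>)
    then show ?thesis using 1 by simp
  next
    case 2
    have "((\<lambda>x::real. 0) has_real_derivative 0) (at x)"
      by simp
    then have "((\<lambda>x. max 0 x ^ n) has_real_derivative 0) (at x)"
      by (rule DERIV_cong_ev[THEN iffD1, rotated -1])
        (use 2 assms in \<open>auto simp: eventually_nhds_metric dist_real_def zero_power intro!: exI[of _ "-x"]\<close>)
    then show ?thesis using 2 assms by (simp add: zero_power)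
  next
    case 3
    have "((\<lambda>h::real. max 0 h ^ n / h) \<longlongrightarrow> 0) (at 0)"
    proof (rule Lim_null_comparison)
      show "\<forall>\<^sub>F h in at 0. norm (max 0 h ^ n / h) \<le> \<bar>h :: real\<bar> ^ (n - 1)"
      proof (rule eventuallyI)
        fix h :: real
        have "\<bar>h\<bar> ^ n = \<bar>h\<bar> * \<bar>h\<bar> ^ (n - 1)"
          using assms by (metis Suc_1 Suc_le_D diff_Suc_1 power_Suc)
        then show "norm (max 0 h ^ n / h) \<le> \<bar>h\<bar> ^ (n - 1)"
          using assms by (auto simp: max_def zero_power power_abs abs_mult power_mult_distrib)
      qed
      have "((\<lambda>h. \<bar>h :: real\<bar> ^ (n - 1)) \<longlongrightarrow> \<bar>0\<bar> ^ (n - 1)) (at 0)"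
        by (intro tendsto_intros)
      then show "((\<lambda>h. \<bar>h :: real\<bar> ^ (n - 1)) \<longlongrightarrow> 0) (at 0)"
        using assms by (simp add: zero_power)
    qed
    then show ?thesis
      using 3 assms by (simp add: DERIV_def zero_power)
  qed
qed

text \<open>For k \<ge> 3 a C^2 substitute for the indicator of {0}: the value at 0 is 1 at every
  scale, and it vanishes from \<epsilon> on. Being convex and nonincreasing on the whole real line,
  it suits the sign arguments for both collision terms.\<close>

definition tent :: "nat \<Rightarrow> real \<Rightarrow> real \<Rightarrow> real" where
  "tent k \<epsilon> x = max 0 (1 - x / \<epsilon>) ^ k"

lemma tent_nonneg [simp]: "0 \<le> tent k \<epsilon> x"
  by (simp add: tent_def)

lemma tent_eq_0: "\<epsilon> > 0 \<Longrightarrow> k > 0 \<Longrightarrow> \<epsilon> \<le> x \<Longrightarrow> tent k \<epsilon> x = 0"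
  by (simp add: tent_def max_def zero_power)

lemma tent_0 [simp]: "tent k \<epsilon> 0 = 1"
  by (simp add: tent_def)

lemma tent_antimono: "\<epsilon> > 0 \<Longrightarrow> x \<le> y \<Longrightarrow> tent k \<epsilon> y \<le> tent k \<epsilon> x"
  unfolding tent_def by (intro power_mono) (auto simp: divide_right_mono max.coboundedI2)

lemma tent_le_1: "\<epsilon> > 0 \<Longrightarrow> 0 \<le> x \<Longrightarrow> tent k \<epsilon> x \<le> 1"
  using tent_antimono[of \<epsilon> 0 x k] by simp

lemma tent_ge: "\<epsilon> > 0 \<Longrightarrow> x \<le> h \<Longrightarrow> h \<le> \<epsilon> \<Longrightarrow> (1 - h / \<epsilon>) ^ k \<le> tent k \<epsilon> x"
  unfolding tent_def by (intro power_mono) (auto simp: divide_right_mono max.coboundedI2)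

lemma tent_deriv:
  assumes "\<epsilon> > 0" "k \<ge> 2"
  shows "(tent k \<epsilon> has_real_derivative - (k / \<epsilon>) * tent (k - 1) \<epsilon> x) (at x within S)"
proof -
  have "((\<lambda>x. 1 - x / \<epsilon>) has_real_derivative - (1 / \<epsilon>)) (at x within S)"
    using assms by (auto intro!: derivative_eq_intros)
  from DERIV_chain2[OF has_real_derivative_max_0_power[OF assms(2)] this]
  show ?thesis by (simp add: tent_def[abs_def])
qed

lemma continuous_on_tent [continuous_intros]: "\<epsilon> > 0 \<Longrightarrow> continuous_on S (tent k \<epsilon>)"
  unfolding tent_def by (intro continuous_intros) auto

lemma borel_measurable_tent [measurable]: "tent k \<epsilon> \<in> borel_measurable borel"
  unfolding tent_def by measurable

text \<open>Each derivative lowers the exponent by one; k \<ge> 3 leaves \<open>tent (k - 2)\<close>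
  with a positive exponent, hence a continuous second derivative.\<close>

lemma tent_in_Cb2:
  assumes "\<epsilon> > 0" "k \<ge> 3"
  shows "tent k \<epsilon> \<in> Cb2"
proof -
  have bdd: "bounded ((\<lambda>x. c * tent j \<epsilon> x) ` {0..})" for j c
  proof (rule boundedI)
    fix y assume "y \<in> (\<lambda>x. c * tent j \<epsilon> x) ` {0..}"
    then show "norm y \<le> \<bar>c\<bar>"
      using assms tent_le_1[of \<epsilon> _ j] by (auto simp: abs_mult intro!: mult_left_le)
  qed
  have 1: "((\<lambda>x. - (k / \<epsilon>) * tent (k - 1) \<epsilon> x) has_real_derivative
      (k / \<epsilon>) * ((k - 1) / \<epsilon>) * tent (k - 2) \<epsilon> x) (at x within {0..})" for x
    using DERIV_cmult[OF tent_deriv[of \<epsilon> "k - 1"], of "- (k / \<epsilon>)"] assms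
    by (auto simp: numeral_2_eq_2 of_nat_diff mult.assoc)
  show ?thesis
    unfolding Cb2_def mem_Collect_eq
    apply (rule exI[of _ "\<lambda>x. - (k / \<epsilon>) * tent (k - 1) \<epsilon> x"])
    apply (rule exI[of _ "\<lambda>x. (k / \<epsilon>) * ((k - 1) / \<epsilon>) * tent (k - 2) \<epsilon> x"])
    using assms bdd[of 1 k] bdd[of "- (k / \<epsilon>)" "k-1"] bdd[of "(k / \<epsilon>) * ((k - 1) / \<epsilon>)" "k-2"]
    by (intro conjI allI impI tent_deriv 1 continuous_intros) simp_all
qed

lemma tent_lipschitz:
  assumes "\<epsilon> > 0" "k \<ge> 2" "0 \<le> x" "0 \<le> y"
  shows "\<bar>tent k \<epsilon> x - tent k \<epsilon> y\<bar> \<le> k / \<epsilon> * \<bar>x - y\<bar>"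
proof -
  have "norm (tent k \<epsilon> x - tent k \<epsilon> y) \<le> k / \<epsilon> * norm (x - y)"
  proof (rule field_differentiable_bound[of "{0..}"])
    show "(tent k \<epsilon> has_field_derivative - (k / \<epsilon>) * tent (k - 1) \<epsilon> z) (at z within {0..})" for z
      by (rule tent_deriv) fact+
    show "norm (- (k / \<epsilon>) * tent (k - 1) \<epsilon> z) \<le> k / \<epsilon>" if "z \<in> {0..}" for z
      using that assms tent_le_1[of \<epsilon> z "k-1"] by (simp add: abs_mult divide_right_mono mult_left_le)
  qed (use assms in auto)
  then show ?thesis by simp
qed

lemma convex_on_tent:
  assumes "\<epsilon> > 0" "k \<ge> 2"
  shows "convex_on UNIV (tent k \<epsilon>)"
proof (rule convex_on_realI)
  show "connected (UNIV :: real set)" by simp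
  show "(tent k \<epsilon> has_real_derivative - (k / \<epsilon>) * tent (k - 1) \<epsilon> x) (at x)" for x
    by (rule tent_deriv) fact+
  show "- (k / \<epsilon>) * tent (k - 1) \<epsilon> x \<le> - (k / \<epsilon>) * tent (k - 1) \<epsilon> y" if "x \<le> y" for x y
    using tent_antimono[OF assms(1) that, of "k-1"] assms
    by (simp add: divide_right_mono mult_left_mono)
qed

text \<open>This is how energy conservation enters: of two pairs with the same sum, the more spread
  one has the larger sum of convex values.\<close>

lemma convex_on_sum_le:
  fixes f :: "real \<Rightarrow> real"
  assumes "convex_on UNIV f" "a \<le> c" "c \<le> b" "a + b = c + d"
  shows "f c + f d \<le> f a + f b"
proof (cases "a = b")
  case False
  \<comment> \<open>The weight with \<open>c = u * a + (1 - u) * b\<close>; since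
    \<open>a + b = c + d\<close>, the point d has the mirrored weights.\<close>
  define u where "u = (b - c) / (b - a)"
  have u: "0 \<le> u" "0 \<le> 1 - u" 
    using assms False by (auto simp: u_def divide_simps)
  have "u * (b - a) = b - c" using False by (simp add: u_def)
  then have c: "c = u * a + (1 - u) * b" by (simp add: algebra_simps)
  then have d: "d = (1 - u) * a + u * b" using assms by (simp add: algebra_simps)
  have "f c \<le> u * f a + (1 - u) * f b" "f d \<le> (1 - u) * f a + u * f b"
    unfolding c d using convex_onD[OF assms(1), of "1 - u" a b] convex_onD[OF assms(1), of u a b] u
    by (auto simp: algebra_simps)
  then show ?thesis by (simp add: algebra_simps)
qed (use assms in auto)

text \<open>With u = 1 - x/\<epsilon>: if u \<ge> 2 \<delta>, then u - \<delta> \<ge> u/2, which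
  costs the factor 2^k; otherwise the lower bound is not positive. A large exponent k makes the
  error (2 \<delta>)^k small.\<close>

lemma tent_shift:
  assumes "\<epsilon> > 0" "\<delta> \<ge> 0"
  shows "tent k \<epsilon> (x + \<delta> * \<epsilon>) \<ge> (tent k \<epsilon> x - (2 * \<delta>) ^ k) / 2 ^ k"
proof -
  define u where "u = 1 - x / \<epsilon>"
  have eq: "tent k \<epsilon> (x + \<delta> * \<epsilon>) = max 0 (u - \<delta>) ^ k" "tent k \<epsilon> x = max 0 u ^ k"
    using assms by (simp_all add: tent_def u_def field_simps)
  show ?thesis
  proof (cases "u \<ge> 2 * \<delta>")
    case True
    have "(max 0 u) ^ k / 2 ^ k \<le> max 0 (u - \<delta>) ^ k"
      unfolding power_divide[symmetric] using True assms by (intro power_mono) auto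
    moreover have "(tent k \<epsilon> x - (2 * \<delta>) ^ k) / 2 ^ k \<le> (max 0 u) ^ k / 2 ^ k"
      using assms by (simp add: eq divide_right_mono)
    ultimately show ?thesis unfolding eq by linarith
  next
    case False
    have "max 0 u ^ k \<le> (2 * \<delta>) ^ k"
      using False assms by (intro power_mono) auto
    then have "(tent k \<epsilon> x - (2 * \<delta>) ^ k) / 2 ^ k \<le> 0"
      unfolding eq by (simp add: divide_le_0_iff)
    then show ?thesis using tent_nonneg order_trans by blast
  qed
qed

section \<open>The collision kernel\<close>

lemma set_integrable_bounded_Icc:
  fixes f :: "real \<Rightarrow> real"
  assumes [measurable]: "f \<in> borel_measurable borel" and "\<And>x. a \<le> x \<Longrightarrow> x \<le> b \<Longrightarrow> \<bar>f x\<bar> \<le> B"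
  shows "set_integrable lborel {a..b} f"
proof -
  have "set_integrable lborel {a..b} (\<lambda>x. B)"
    by (intro borel_integrable_atLeastAtMost' continuous_intros)
  then show ?thesis
    by (rule set_integrable_bound)
      (use assms in \<open>auto simp: set_borel_measurable_def intro!: AE_I2 order_trans[OF _ abs_ge_self]\<close>)
qed

lemma ennreal_set_integral_Icc:
  fixes f :: "real \<Rightarrow> real"
  assumes "f \<in> borel_measurable borel" "\<And>x. 0 \<le> f x" "\<And>x. f x \<le> B"
  shows "ennreal (LINT x:{a..b}|lborel. f x) = (\<integral>\<^sup>+x\<in>{a..b}. ennreal (f x) \<partial>lborel)"
proof -
  have "set_integrable lborel {a..b} f"
    using assms by (intro set_integrable_bounded_Icc[where B = B]) (auto simp: abs_le_iff intro: order_trans[of _ 0])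
  then show ?thesis
    unfolding set_lebesgue_integral_def set_integrable_def
    using assms by (subst nn_integral_eq_integral[symmetric])
      (auto simp: indicator_def intro!: nn_integral_cong)
qed

lemma set_integral_Icc_le:
  fixes f :: "real \<Rightarrow> real"
  assumes "f \<in> borel_measurable borel" "\<And>x. \<bar>f x\<bar> \<le> B" "a \<le> b"
  shows "(LINT x:{a..b}|lborel. f x) \<le> B * (b - a)"
proof -
  have "(LINT x:{a..b}|lborel. f x) \<le> (LINT x:{a..b}|lborel. B)"
    using assms by (intro set_integral_mono set_integrable_bounded_Icc[where B = B] borel_integrable_atLeastAtMost')
      (auto intro: order_trans[OF abs_ge_self])
  also have "\<dots> = B * (b - a)"
    using assms by (simp add: set_lebesgue_integral_def)
  finally show ?thesis .
qed

text \<open>No integrability of f is assumed: the Bochner integral of a non-integrable function is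
  0, which lies above the nonpositive integral of g.\<close>

lemma set_integral_ge_of_integrable:
  fixes f g :: "real \<Rightarrow> real"
  assumes "set_integrable lborel A g" "\<And>x. x \<in> A \<Longrightarrow> g x \<le> f x" "(LINT x:A|lborel. g x) \<le> 0"
  shows "(LINT x:A|lborel. g x) \<le> (LINT x:A|lborel. f x)"
proof (cases "set_integrable lborel A f")
  case True
  then show ?thesis using assms by (intro set_integral_mono)
next
  case False
  then show ?thesis using assms unfolding set_lebesgue_integral_def set_integrable_def
    by (simp add: not_integrable_integral_eq)
qed

lemma set_integral_Icc_indicator:
  fixes a b c d :: real
  assumes "a \<le> c" "c \<le> d" "d \<le> b"
  shows "(LINT x:{a..b}|lborel. C * indicator {c..d} x) = C * (d - c)"
    and "set_integrable lborel {a..b} (\<lambda>x. C * indicator {c..d} x :: real)"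
proof -
  have *: "(\<lambda>x. indicator {a..b} x *\<^sub>R (C * indicator {c..d} x)) = (\<lambda>x. C * indicator {c..d} x)"
    using assms by (auto simp: indicator_def fun_eq_iff)
  show "(LINT x:{a..b}|lborel. C * indicator {c..d} x) = C * (d - c)"
    "set_integrable lborel {a..b} (\<lambda>x. C * indicator {c..d} x :: real)"
    unfolding set_lebesgue_integral_def set_integrable_def * using assms by auto
qed

lemma cmod_add_exp_mult:
  "cmod (complex_of_real a + exp (\<i> * complex_of_real t) * complex_of_real b) =
   sqrt (a\<^sup>2 + b\<^sup>2 + 2 * a * b * cos t)"
proof -
  have "a\<^sup>2 + 2 * a * b * cos t + (b\<^sup>2 * (cos t)\<^sup>2 + b\<^sup>2 * (sin t)\<^sup>2) = a\<^sup>2 + 2 * a * b * cos t + b\<^sup>2"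
    by (simp add: distrib_left[symmetric])
  then show ?thesis
    unfolding cis_conv_exp[symmetric] cmod_def
    by (simp add: power2_eq_square algebra_simps)
qed

text \<open>u = c + d cos \<theta> sweeps [c - d, c + d] twice, once on each half of the circle.
  Nonnegative integrals make the endpoint singularities of the arcsine density harmless.\<close>

lemma nn_integral_cos_substitution:
  fixes h :: "real \<Rightarrow> ennreal"
  assumes [measurable]: "h \<in> borel_measurable borel" and d: "d > 0"
  shows "(\<integral>\<^sup>+\<theta>\<in>{0..2*pi}. h (c + d * cos \<theta>) \<partial>lborel) =
    2 * (\<integral>\<^sup>+u\<in>{c - d..c + d}. h u * ennreal (1 / sqrt (d\<^sup>2 - (u - c)\<^sup>2)) \<partial>lborel)"
proof -
  let ?I = "\<integral>\<^sup>+t\<in>{0..pi}. h (c - d * cos t) \<partial>lborel"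
  have "(\<integral>\<^sup>+\<theta>\<in>{0..2*pi}. h (c + d * cos \<theta>) \<partial>lborel) =
      (\<integral>\<^sup>+\<theta>. h (c + d * cos \<theta>) * indicator {0..pi} \<theta> +
              h (c + d * cos \<theta>) * indicator {pi..2*pi} \<theta> \<partial>lborel)"
    by (rule nn_integral_cong_AE, rule AE_mp[OF AE_lborel_singleton[of pi]])
      (auto simp: indicator_def)
  also have "\<dots> = (\<integral>\<^sup>+\<theta>\<in>{0..pi}. h (c + d * cos \<theta>) \<partial>lborel) + (\<integral>\<^sup>+\<theta>\<in>{pi..2*pi}. h (c + d * cos \<theta>) \<partial>lborel)"
    by (rule nn_integral_add) auto
  also have "(\<integral>\<^sup>+\<theta>\<in>{0..pi}. h (c + d * cos \<theta>) \<partial>lborel) = ?I"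
    by (subst nn_integral_real_affine[where c = "-1" and t = pi])
      (auto simp: cos_diff indicator_def intro!: nn_integral_cong)
  also have "(\<integral>\<^sup>+\<theta>\<in>{pi..2*pi}. h (c + d * cos \<theta>) \<partial>lborel) = ?I"
    by (subst nn_integral_real_affine[where c = "1" and t = pi])
      (auto simp: cos_add indicator_def intro!: nn_integral_cong)
  also have "?I + ?I = 2 * ?I" by (simp add: mult_2)
  \<comment> \<open>The Jacobian d sin t is inserted next to its reciprocal. Their product is 1
    except at t = 0 and t = \<pi>, where 1/0 = 0; these points form a null set.\<close>
  also have "?I = (\<integral>\<^sup>+t. h (c - d * cos t) * ennreal (1 / sqrt (d\<^sup>2 - ((c - d * cos t) - c)\<^sup>2)) *
      ennreal (d * sin t) * indicator {0..pi} t \<partial>lborel)"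
  proof (rule nn_integral_cong_AE, rule AE_mp[OF AE_lborel_singleton[of 0]], rule AE_mp[OF AE_lborel_singleton[of pi]],
      intro AE_I2 impI)
    fix t :: real assume t: "t \<noteq> 0" "t \<noteq> pi"
    show "h (c - d * cos t) * indicator {0..pi} t =
         h (c - d * cos t) * ennreal (1 / sqrt (d\<^sup>2 - ((c - d * cos t) - c)\<^sup>2)) *
      ennreal (d * sin t) * indicator {0..pi} t"
    proof (cases "t \<in> {0..pi}")
      case True
      then have "sin t > 0" using t by (intro sin_gt_zero) auto
      have "d\<^sup>2 - ((c - d * cos t) - c)\<^sup>2 = (d * sin t)\<^sup>2"
        by (simp add: power_mult_distrib sin_squared_eq algebra_simps)
      then have "sqrt (d\<^sup>2 - ((c - d * cos t) - c)\<^sup>2) = d * sin t"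
        using d \<open>sin t > 0\<close> by simp
      then have "ennreal (1 / sqrt (d\<^sup>2 - ((c - d * cos t) - c)\<^sup>2)) * ennreal (d * sin t) = 1"
        using d \<open>sin t > 0\<close> by (simp add: ennreal_mult[symmetric])
      then show ?thesis by (simp add: mult.assoc)
    qed auto
  qed
  also have "\<dots> = (\<integral>\<^sup>+u. h u * ennreal (1 / sqrt (d\<^sup>2 - (u - c)\<^sup>2)) *
      indicator {c - d * cos 0..c - d * cos pi} u \<partial>lborel)"
    by (rule nn_integral_substitution_aux[symmetric, where g' = "\<lambda>t. d * sin t"])
      (use d in \<open>auto intro!: derivative_eq_intros continuous_intros simp: sin_ge_zero\<close>)
  finally show ?thesis by simp
qed

text \<open>By the law of cosines the quotient is the squared projection of a side of length sqrt x
  onto a side of length \<sigma> in a triangle with third side sqrt y. It is smaller than x exactly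
  when the triangle exists and is nondegenerate.\<close>

lemma projection_less_iff:
  fixes x y \<sigma> :: real
  assumes "\<sigma> > 0" "x \<ge> 0" "y \<ge> 0"
  shows "(x - y + \<sigma>\<^sup>2)\<^sup>2 / (4 * \<sigma>\<^sup>2) < x \<longleftrightarrow> \<bar>sqrt x - sqrt y\<bar> < \<sigma> \<and> \<sigma> < sqrt x + sqrt y"
proof -
  have abs_less_square_iff: "u\<^sup>2 < w\<^sup>2 \<longleftrightarrow> \<bar>u\<bar> < \<bar>w\<bar>" for u w :: real
    using abs_le_square_iff[of w u] by linarith
  define a b where "a = sqrt x" "b = sqrt y"
  have ab: "a \<ge> 0" "b \<ge> 0" "x = a\<^sup>2" "y = b\<^sup>2" using assms by (auto simp: a_b_def)
  have "(x - y + \<sigma>\<^sup>2)\<^sup>2 / (4 * \<sigma>\<^sup>2) < x \<longleftrightarrow> (x - y + \<sigma>\<^sup>2)\<^sup>2 < (2 * \<sigma> * a)\<^sup>2"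
    using assms by (simp add: pos_divide_less_eq ab power_mult_distrib mult.commute mult.left_commute)
  also have "\<dots> \<longleftrightarrow> \<bar>x - y + \<sigma>\<^sup>2\<bar> < 2 * \<sigma> * a"
    using abs_less_square_iff[of "x - y + \<sigma>\<^sup>2" "2 * \<sigma> * a"] assms ab by (simp add: abs_mult)
  also have "\<dots> \<longleftrightarrow> (\<sigma> - a)\<^sup>2 < b\<^sup>2 \<and> b\<^sup>2 < (\<sigma> + a)\<^sup>2"
    unfolding ab abs_less_iff by (auto simp: power2_eq_square algebra_simps)
  also have "\<dots> \<longleftrightarrow> \<bar>\<sigma> - a\<bar> < b \<and> b < \<sigma> + a"
    using abs_less_square_iff[of "\<sigma> - a" b] abs_less_square_iff[of b "\<sigma> + a"] assms ab by simp
  also have "\<dots> \<longleftrightarrow> \<bar>a - b\<bar> < \<sigma> \<and> \<sigma> < a + b" by auto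
  finally show ?thesis by (simp add: a_b_def)
qed

lemma projection_le:
  fixes x y \<sigma> :: real
  assumes "x \<ge> 0" "y \<ge> 0" "\<bar>sqrt x - sqrt y\<bar> \<le> \<sigma>" "\<sigma> \<le> sqrt x + sqrt y"
  shows "(x - y + \<sigma>\<^sup>2)\<^sup>2 / (4 * \<sigma>\<^sup>2) \<le> x"
proof (cases "\<sigma> = 0")
  case False
  define a b where "a = sqrt x" "b = sqrt y"
  have ab: "a \<ge> 0" "b \<ge> 0" "x = a\<^sup>2" "y = b\<^sup>2" using assms by (auto simp: a_b_def)
  have "\<bar>a - b\<bar> \<le> \<sigma>" "\<sigma> \<le> a + b" using assms(3,4) by (simp_all add: a_b_def)
  then have "\<bar>\<sigma> - a\<bar> \<le> \<bar>b\<bar>" "\<bar>b\<bar> \<le> \<bar>\<sigma> + a\<bar>"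
    using ab(1,2) by linarith+
  then have "(\<sigma> - a)\<^sup>2 \<le> b\<^sup>2" "b\<^sup>2 \<le> (\<sigma> + a)\<^sup>2" by (simp_all only: abs_le_square_iff)
  \<comment> \<open>Heron's formula: the product is 16 times the squared area of the triangle with
    sides a, b, \<sigma>.\<close>
  then have "0 \<le> (b\<^sup>2 - (\<sigma> - a)\<^sup>2) * ((\<sigma> + a)\<^sup>2 - b\<^sup>2)"
    by simp
  also have "\<dots> = x * (4 * \<sigma>\<^sup>2) - (x - y + \<sigma>\<^sup>2)\<^sup>2"
    unfolding ab by (simp add: power2_eq_square algebra_simps)
  finally show ?thesis using False by (simp add: pos_divide_le_eq)
qed (use assms in simp)

lemma borel_measurable_Ystar [measurable (raw)]:
  assumes [measurable]: "a \<in> borel_measurable M" "b \<in> borel_measurable M" "c \<in> borel_measurable M"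
    "s \<in> borel_measurable M" "t \<in> borel_measurable M"
  shows "(\<lambda>x. Ystar (a x) (b x) (c x) (s x) (t x)) \<in> borel_measurable M"
  unfolding Ystar_def by measurable

lemma borel_measurable_xstar [measurable (raw)]:
  assumes [measurable]: "a \<in> borel_measurable M" "b \<in> borel_measurable M" "c \<in> borel_measurable M"
  shows "(\<lambda>x. xstar (a x) (b x) (c x)) \<in> borel_measurable M"
  unfolding xstar_def by measurable

lemma Ystar_nonneg: "0 \<le> Ystar x y z \<sigma> \<theta>"
  by (simp add: Ystar_def)

lemma sigma_minus_nonneg: "0 \<le> sigma_minus x y z"
  by (simp add: sigma_minus_def)

lemma Ystar_eq:
  assumes "\<sigma> > 0" and A: "A = (x - y + \<sigma>\<^sup>2)\<^sup>2 / (4 * \<sigma>\<^sup>2)" and "A \<le> x" "A \<le> z"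
  shows "Ystar x y z \<sigma> \<theta> = sqrt ((z + x - 2 * A) + sqrt (4 * ((z - A) * (x - A))) * cos \<theta>)"
proof -
  have "sqrt (4 * ((z - A) * (x - A))) = 2 * sqrt (z - A) * sqrt (x - A)"
    by (simp add: real_sqrt_mult)
  then show ?thesis
    using assms(1,3,4) unfolding Ystar_def A[symmetric] cmod_add_exp_mult by simp
qed

lemma xstar_commute: "xstar x y z = xstar x z y"
  by (simp add: xstar_def add.commute)

lemma sigma_width:
  shows "sigma_plus x y z - sigma_minus x y z \<le> 2 * sqrt x"
    and "sigma_plus x y z - sigma_minus x y z \<le> 2 * sqrt y"
    and "sigma_plus x y z - sigma_minus x y z \<le> 2 * sqrt z"
proof -
  have "sigma_plus x y z \<le> sqrt x + sqrt y" "sigma_plus x y z \<le> sqrt (xstar x y z) + sqrt z"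
    by (simp_all add: sigma_plus_def)
  moreover have "\<bar>sqrt x - sqrt y\<bar> \<le> sigma_minus x y z" "\<bar>sqrt (xstar x y z) - sqrt z\<bar> \<le> sigma_minus x y z"
    by (simp_all add: sigma_minus_def)
  ultimately show "sigma_plus x y z - sigma_minus x y z \<le> 2 * sqrt x"
    "sigma_plus x y z - sigma_minus x y z \<le> 2 * sqrt y"
    "sigma_plus x y z - sigma_minus x y z \<le> 2 * sqrt z"
    by linarith+
qed

text \<open>In both orders of p and q the constraint from the pair \<open>xstar\<close>, r is the
  weaker one, because increments of sqrt shrink along the axis. The two kernels thus integrate over
  the same window and can be compared pointwise.\<close>

lemma sigma_range:
  assumes "0 < p" "p \<le> q" "q \<le> r"
  shows "sigma_minus p q r = sqrt q - sqrt p" "sigma_plus p q r = sqrt q + sqrt p"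
    and "sigma_minus q p r = sqrt q - sqrt p" "sigma_plus q p r = sqrt q + sqrt p"
proof -
  have concave: "sqrt (s + h) - sqrt s \<le> sqrt (p + h) - sqrt p" if "h \<ge> 0" "s \<ge> p" for s h
  proof -
    have "(sqrt (s + h) + sqrt p)\<^sup>2 \<le> (sqrt (p + h) + sqrt s)\<^sup>2"
    proof -
      have "(s + h) * p \<le> (p + h) * s" using mult_left_mono[OF that(2,1)] by (simp add: algebra_simps)
      then have "sqrt (s + h) * sqrt p \<le> sqrt (p + h) * sqrt s" unfolding real_sqrt_mult[symmetric] by simp
      then show ?thesis using that assms by (simp add: power2_sum)
    qed
    then have "sqrt (s + h) + sqrt p \<le> sqrt (p + h) + sqrt s"
      by (rule power2_le_imp_le) (use that assms in auto)
    then show ?thesis by linarith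
  qed
  have x: "xstar p q r = q + r - p" "xstar q p r = p + r - q" using assms by (auto simp: xstar_def)
  have le: "sqrt r \<le> sqrt (q + r - p)" "sqrt (p + r - q) \<le> sqrt r" "sqrt p \<le> sqrt (p + r - q)" "sqrt p \<le> sqrt q"
    "sqrt q \<le> sqrt r"
    using assms by auto
  have "sqrt (q + r - p) - sqrt r \<le> sqrt q - sqrt p" "sqrt r - sqrt (p + r - q) \<le> sqrt q - sqrt p"
    using concave[of "q - p" r] concave[of "q - p" "p + r - q"] assms by (auto simp: algebra_simps)
  then show "sigma_minus p q r = sqrt q - sqrt p" "sigma_plus p q r = sqrt q + sqrt p"
    "sigma_minus q p r = sqrt q - sqrt p" "sigma_plus q p r = sqrt q + sqrt p"
    using le unfolding sigma_minus_def sigma_plus_def x by (auto simp: max_def min_def abs_if simp del: real_sqrt_le_iff real_sqrt_less_iff)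
qed

text \<open>Exchanging p and q changes the projection by exactly q - p. So the radical containing
  the first argument keeps its value b, and only the other one grows, from a to a'. The modulus of
  \<open>a + exp (\<i> * \<theta>) * b\<close> is nondecreasing in a for a \<ge> b.\<close>

lemma Ystar_mono:
  assumes "0 < p" "p \<le> q" "q \<le> r" "sqrt q - sqrt p \<le> \<sigma>" "\<sigma> \<le> sqrt q + sqrt p"
  shows "Ystar q p r \<sigma> \<theta> \<le> Ystar p q r \<sigma> \<theta>"
proof (cases "\<sigma> > 0")
  case True
  define A A' where "A = (q - p + \<sigma>\<^sup>2)\<^sup>2 / (4 * \<sigma>\<^sup>2)" "A' = (p - q + \<sigma>\<^sup>2)\<^sup>2 / (4 * \<sigma>\<^sup>2)"
  have "A - A' = ((q - p + \<sigma>\<^sup>2)\<^sup>2 - (p - q + \<sigma>\<^sup>2)\<^sup>2) / (4 * \<sigma>\<^sup>2)"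
    by (simp add: A_A'_def diff_divide_distrib)
  also have "(q - p + \<sigma>\<^sup>2)\<^sup>2 - (p - q + \<sigma>\<^sup>2)\<^sup>2 = (q - p) * (4 * \<sigma>\<^sup>2)"
    by (simp add: power2_eq_square algebra_simps)
  finally have AA': "A' = A - (q - p)" using True by simp
  have "A \<le> q" using projection_le[of q p \<sigma>] assms by (simp add: A_A'_def)
  define a a' b where "a = sqrt (r - A)" and "a' = sqrt (r - A')" and "b = sqrt (q - A)"
  have ab: "b \<le> a" "a \<le> a'" "0 \<le> b" using \<open>A \<le> q\<close> assms AA' by (auto simp: a_def a'_def b_def)
  have Y: "Ystar q p r \<sigma> \<theta> = sqrt (a\<^sup>2 + b\<^sup>2 + 2 * a * b * cos \<theta>)"
    unfolding Ystar_def cmod_add_exp_mult A_A'_def[symmetric] a_def b_def using True \<open>A \<le> q\<close> assms by simp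
  have Y': "Ystar p q r \<sigma> \<theta> = sqrt (a'\<^sup>2 + b\<^sup>2 + 2 * a' * b * cos \<theta>)"
    unfolding Ystar_def cmod_add_exp_mult A_A'_def[symmetric] a'_def b_def using True \<open>A \<le> q\<close> assms AA' by simp
  have "- b \<le> b * cos \<theta>" using mult_left_mono[OF cos_ge_minus_one[of \<theta>] ab(3)] by simp
  then have "0 \<le> (a' - a) * (a' + a + 2 * (b * cos \<theta>))"
    using ab by (intro mult_nonneg_nonneg) auto
  then show ?thesis unfolding Y Y' by (simp add: power2_eq_square algebra_simps)
qed (simp add: Ystar_def)

lemma kernel_W_eq_0: "y \<ge> 0 \<Longrightarrow> z \<ge> 0 \<Longrightarrow> y + z < x \<Longrightarrow> kernel_W \<Phi> x y z = 0"
  by (auto simp: kernel_W_def xstar_def max_def)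

text \<open>
  With \<open>v = \<sigma>\<^sup>2\<close> and \<open>u = Y\<^sub>*\<^sup>2\<close> as integration variables the two-fold integral
  in \<^const>\<open>kernel_W\<close> has the density \<open>\<Phi>(\<surd>(2v), \<surd>(2u)) / \<surd>P\<close> for the following polynomial \<open>P\<close>,
  which is invariant under exchanging \<open>(v, y)\<close> with \<open>(u, z)\<close>.
\<close>

definition transfer_poly :: "real \<Rightarrow> real \<Rightarrow> real \<Rightarrow> real \<Rightarrow> real \<Rightarrow> real" where
  "transfer_poly x y z v u =
     2 * u * v * (y + z) - u * v * (u + v) - v * (z - x)\<^sup>2 - u * (y - x)\<^sup>2"

text \<open>Completing the square in u. If the square of \<open>Ystar\<close> is written as c + d
  cos \<theta> (see \<open>Ystar_eq\<close>), the bracket is d^2 - (u - c)^2, whose root is the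
  denominator of the arcsine density.\<close>

lemma transfer_poly_square:
  assumes "\<sigma> > 0" and A: "A = (x - y + \<sigma>\<^sup>2)\<^sup>2 / (4 * \<sigma>\<^sup>2)"
  shows "transfer_poly x y z (\<sigma>\<^sup>2) u = \<sigma>\<^sup>2 * (4 * ((z - A) * (x - A)) - (u - (z + x - 2 * A))\<^sup>2)"
proof -
  have "\<sigma>\<^sup>2 * A = (x - y + \<sigma>\<^sup>2)\<^sup>2 / 4" using assms by simp
  then have "4 * u * (\<sigma>\<^sup>2 * A) = u * (x - y + \<sigma>\<^sup>2)\<^sup>2" by simp
  moreover have "\<sigma>\<^sup>2 * (4 * ((z - A) * (x - A)) - (u - (z + x - 2 * A))\<^sup>2) =
      \<sigma>\<^sup>2 * (2 * u * (z + x) - (z - x)\<^sup>2 - u\<^sup>2) - 4 * u * (\<sigma>\<^sup>2 * A)"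
    by (simp add: power2_eq_square algebra_simps)
  ultimately show ?thesis
    by (simp add: transfer_poly_def power2_eq_square algebra_simps)
qed

section \<open>The reduced kernel: measurability, symmetry and two-sided bounds\<close>

locale scattering =
  fixes b0 \<eta> :: real and \<Phi> :: "real \<Rightarrow> real \<Rightarrow> real"
  assumes scattering_factor: "scattering_factor b0 \<eta> \<Phi>"
begin

lemma b0: "0 < b0" "b0 < 1" and \<eta>: "0 \<le> \<eta>" "\<eta> < 1"
  using scattering_factor by (auto simp: scattering_factor_def)

lemma \<Phi>_nonneg: "r \<ge> 0 \<Longrightarrow> \<rho> \<ge> 0 \<Longrightarrow> 0 \<le> \<Phi> r \<rho>"
  and \<Phi>_le_1: "r \<ge> 0 \<Longrightarrow> \<rho> \<ge> 0 \<Longrightarrow> \<Phi> r \<rho> \<le> 1"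
  and \<Phi>_commute: "r \<ge> 0 \<Longrightarrow> \<rho> \<ge> 0 \<Longrightarrow> \<Phi> r \<rho> = \<Phi> \<rho> r"
  and \<Phi>_lower: "r \<ge> 0 \<Longrightarrow> \<rho> \<ge> 0 \<Longrightarrow> b0 * min 1 ((r\<^sup>2 + \<rho>\<^sup>2) powr \<eta>) \<le> \<Phi> r \<rho>"
  using scattering_factor by (auto simp: scattering_factor_def)

lemma \<Phi>_mono:
  assumes "0 \<le> r" "r \<le> r'" "0 \<le> \<rho>" "\<rho> \<le> \<rho>'"
  shows "\<Phi> r \<rho> \<le> \<Phi> r' \<rho>'"
proof -
  have "\<Phi> r \<rho> \<le> \<Phi> r' \<rho>"
    using scattering_factor assms by (auto simp: scattering_factor_def mono_on_def)
  also have "\<dots> \<le> \<Phi> r' \<rho>'"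
    using scattering_factor assms by (auto simp: scattering_factor_def mono_on_def)
  finally show ?thesis .
qed

text \<open>\<open>\<Phi>\<close> is only known to be continuous on the quadrant; the following extension is Borel on the plane.\<close>

definition \<Phi>' :: "real \<Rightarrow> real \<Rightarrow> real" where
  "\<Phi>' r \<rho> = \<Phi> (max r 0) (max \<rho> 0)"

lemma \<Phi>'_nonneg [simp]: "0 \<le> \<Phi>' r \<rho>" and \<Phi>'_le_1 [simp]: "\<Phi>' r \<rho> \<le> 1"
  and \<Phi>'_commute: "\<Phi>' r \<rho> = \<Phi>' \<rho> r"
  using \<Phi>_commute[of "max r 0" "max \<rho> 0"] by (auto simp: \<Phi>'_def \<Phi>_nonneg \<Phi>_le_1)

lemma \<Phi>'_mono: "r \<le> r' \<Longrightarrow> \<rho> \<le> \<rho>' \<Longrightarrow> \<Phi>' r \<rho> \<le> \<Phi>' r' \<rho>'"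
  unfolding \<Phi>'_def by (intro \<Phi>_mono) auto

lemma \<Phi>'_abs_le_1 [simp]: "\<bar>\<Phi>' r \<rho>\<bar> \<le> 1"
  by (simp add: abs_le_iff order_trans[OF _ \<Phi>'_nonneg])

lemma \<Phi>'_eq [simp]: "0 \<le> r \<Longrightarrow> 0 \<le> \<rho> \<Longrightarrow> \<Phi>' r \<rho> = \<Phi> r \<rho>"
  by (simp add: \<Phi>'_def)

lemma borel_measurable_\<Phi>' [measurable (raw)]:
  assumes [measurable]: "f \<in> borel_measurable M" "g \<in> borel_measurable M"
  shows "(\<lambda>x. \<Phi>' (f x) (g x)) \<in> borel_measurable M"
proof -
  have "continuous_on UNIV ((\<lambda>(r, \<rho>). \<Phi> r \<rho>) \<circ> (\<lambda>(r, \<rho>). (max r 0, max \<rho> 0)))"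
  proof (rule continuous_on_compose)
    show "continuous_on UNIV (\<lambda>(r :: real, \<rho> :: real). (max r 0, max \<rho> 0))"
      unfolding case_prod_beta by (intro continuous_intros)
    show "continuous_on (range (\<lambda>(r :: real, \<rho> :: real). (max r 0, max \<rho> 0))) (\<lambda>(r, \<rho>). \<Phi> r \<rho>)"
      using scattering_factor unfolding scattering_factor_def
      by (elim conjE, elim continuous_on_subset) auto
  qed
  then have "(\<lambda>(r, \<rho>). \<Phi>' r \<rho>) \<in> borel_measurable (borel \<Otimes>\<^sub>M borel)"
    unfolding borel_prod by (intro borel_measurable_continuous_onI)
      (simp add: o_def case_prod_beta \<Phi>'_def)
  from measurable_compose[OF _ this, of "\<lambda>x. (f x, g x)" M] show ?thesis by simp
qed

definition angular :: "real \<Rightarrow> real \<Rightarrow> real \<Rightarrow> real \<Rightarrow> real" where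
  "angular x y z \<sigma> = (LINT \<theta>:{0..2*pi}|lborel. \<Phi>' (sqrt 2 * \<sigma>) (sqrt 2 * Ystar x y z \<sigma> \<theta>))"

definition transfer :: "real \<Rightarrow> real \<Rightarrow> real \<Rightarrow> real" where
  "transfer x y z = (LINT \<sigma>:{sigma_minus x y z..sigma_plus x y z}|lborel. angular x y z \<sigma>)"

lemma kernel_W_generic:
  assumes "xstar x y z * x * y * z > 0"
  shows "kernel_W \<Phi> x y z = transfer x y z / (4 * pi * sqrt (x * y * z))"
proof -
  have "(LINT \<sigma>:{sigma_minus x y z..sigma_plus x y z}|lborel.
      LINT \<theta>:{0..2 * pi}|lborel. \<Phi> (sqrt 2 * \<sigma>) (sqrt 2 * Ystar x y z \<sigma> \<theta>)) = transfer x y z"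
    unfolding transfer_def angular_def
    by (rule set_lebesgue_integral_cong)
      (auto intro!: order_trans[OF sigma_minus_nonneg] simp: Ystar_nonneg
        order_trans[OF sigma_minus_nonneg, of _ _ _])
  then show ?thesis using assms by (simp add: kernel_W_def)
qed

lemma borel_measurable_transfer [measurable (raw)]:
  assumes [measurable]: "a \<in> borel_measurable M" "b \<in> borel_measurable M" "c \<in> borel_measurable M"
  shows "(\<lambda>w. transfer (a w) (b w) (c w)) \<in> borel_measurable M"
  unfolding transfer_def angular_def set_lebesgue_integral_def indicator_def atLeastAtMost_iff
    sigma_minus_def sigma_plus_def
  by measurable

lemma borel_measurable_kernel_W [measurable (raw)]:
  assumes [measurable]: "a \<in> borel_measurable M" "b \<in> borel_measurable M" "c \<in> borel_measurable M"
  shows "(\<lambda>w. kernel_W \<Phi> (a w) (b w) (c w)) \<in> borel_measurable M"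
proof -
  have "kernel_W \<Phi> x y z =
     (if xstar x y z * x * y * z > 0 then transfer x y z / (4 * pi * sqrt (x * y * z))
      else if x = 0 \<and> y > 0 \<and> z > 0 then \<Phi>' (sqrt (2 * y)) (sqrt (2 * z)) / sqrt (y * z)
      else if y = 0 \<and> 0 < x \<and> x \<le> z then \<Phi>' (sqrt (2 * x)) (sqrt (2 * (z - x))) / sqrt (x * z)
      else if z = 0 \<and> 0 < x \<and> x \<le> y then \<Phi>' (sqrt (2 * (y - x))) (sqrt (2 * x)) / sqrt (x * y)
      else 0)" for x y z
    using kernel_W_generic[of x y z] by (simp add: kernel_W_def)
  then show ?thesis by simp
qed

lemma borel_measurable_angular [measurable (raw)]:
  assumes [measurable]: "a \<in> borel_measurable M" "b \<in> borel_measurable M" "c \<in> borel_measurable M"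
    "s \<in> borel_measurable M"
  shows "(\<lambda>w. angular (a w) (b w) (c w) (s w)) \<in> borel_measurable M"
  unfolding angular_def set_lebesgue_integral_def by measurable

lemma angular_nonneg: "0 \<le> angular x y z \<sigma>"
  unfolding angular_def set_lebesgue_integral_def by (intro Bochner_Integration.integral_nonneg) simp

lemma angular_le: "angular x y z \<sigma> \<le> 2 * pi"
  unfolding angular_def
  using set_integral_Icc_le[of "\<lambda>\<theta>. \<Phi>' (sqrt 2 * \<sigma>) (sqrt 2 * Ystar x y z \<sigma> \<theta>)" 1 0 "2 * pi"]
  by simp

text \<open>The sign conditions on u and v matter: for y, z > 0 the polynomial is also positive when
  both are negative.\<close>

definition transfer_density :: "real \<Rightarrow> real \<Rightarrow> real \<Rightarrow> real \<Rightarrow> real \<Rightarrow> ennreal" where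
  "transfer_density x y z v u =
     (if v > 0 \<and> u > 0 \<and> transfer_poly x y z v u > 0
      then ennreal (\<Phi>' (sqrt 2 * sqrt v) (sqrt 2 * sqrt u) / sqrt (transfer_poly x y z v u)) else 0)"

lemma transfer_density_commute: "transfer_density x y z v u = transfer_density x z y u v"
proof -
  have "transfer_poly x y z v u = transfer_poly x z y u v"
    by (simp add: transfer_poly_def algebra_simps)
  then show ?thesis
    by (simp add: transfer_density_def \<Phi>'_commute[of "sqrt 2 * sqrt v"])
qed

lemma borel_measurable_transfer_density [measurable (raw)]:
  assumes [measurable]: "f \<in> borel_measurable M" "g \<in> borel_measurable M"
  shows "(\<lambda>w. transfer_density x y z (f w) (g w)) \<in> borel_measurable M"
  unfolding transfer_density_def transfer_poly_def by measurable

text \<open>The inner substitution sets u to the square of \<open>Ystar\<close>, and the double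
  covering gives a factor 2; the outer one is v = \<sigma>^2, whose Jacobian 2 \<sigma> absorbs this
  factor and the \<sigma> from the root of the polynomial.\<close>

lemma transfer_eq_density:
  assumes pos: "x > 0" "y > 0" "z > 0" and s: "y + z - x > 0"
  shows "ennreal (transfer x y z) = (\<integral>\<^sup>+v. \<integral>\<^sup>+u. transfer_density x y z v u \<partial>lborel \<partial>lborel)"
proof -
  define w where "w = y + z - x"
  have w: "w > 0" "xstar x y z = w" "x - y = z - w" using s by (auto simp: w_def xstar_def)
  let ?A = "\<lambda>\<sigma>. (x - y + \<sigma>\<^sup>2)\<^sup>2 / (4 * \<sigma>\<^sup>2)"
  let ?f = "\<lambda>v. \<integral>\<^sup>+u. transfer_density x y z v u \<partial>lborel"
  define a b where "a = sigma_minus x y z" and "b = sigma_plus x y z"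
  have a0: "a \<ge> 0" using sigma_minus_nonneg by (simp add: a_def)
  have less: "sqrt p < sqrt q + sqrt r" if "p < q + r" "q > 0" "r > 0" for p q r :: real
    using sqrt_add_le_add_sqrt[of q r] real_sqrt_less_mono[OF that(1)] that by linarith
  have "sqrt x < sqrt y + sqrt z" "sqrt w < sqrt y + sqrt z" "sqrt y < sqrt x + sqrt w"
    "sqrt z < sqrt x + sqrt w" "0 < sqrt x" "0 < sqrt y" "0 < sqrt z" "0 < sqrt w"
    using less[of x y z] less[of w y z] less[of y x w] less[of z x w] pos w by auto
  then have ab: "a < b"
    unfolding a_def b_def sigma_minus_def sigma_plus_def w(2) max_less_iff_conj min_less_iff_conj abs_less_iff
    by (auto simp del: real_sqrt_gt_0_iff)
  \<comment> \<open>The open window consists of the \<sigma> for which two triangles, with sides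
    sqrt x, sqrt y, \<sigma> and sqrt z, sqrt w, \<sigma>, are nondegenerate. They share one
    projection because x - y = z - w.\<close>
  have iff: "?A \<sigma> < x \<and> ?A \<sigma> < z \<longleftrightarrow> a < \<sigma> \<and> \<sigma> < b" if "\<sigma> > 0" for \<sigma>
    using projection_less_iff[OF that, of x y] projection_less_iff[OF that, of z w] pos w
    by (auto simp: a_def b_def sigma_minus_def sigma_plus_def abs_minus_commute)
  have density: "(\<integral>\<^sup>+\<theta>\<in>{0..2*pi}. ennreal (\<Phi>' (sqrt 2 * \<sigma>) (sqrt 2 * Ystar x y z \<sigma> \<theta>)) \<partial>lborel) =
      ?f (\<sigma>\<^sup>2) * ennreal (2 * \<sigma>)" if "a < \<sigma>" "\<sigma> < b" for \<sigma>
  proof -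
    have \<sigma>: "\<sigma> > 0" using that a0 by simp
    define A where "A = ?A \<sigma>"
    have A: "A < x" "A < z" using iff[OF \<sigma>] that by (auto simp: A_def)
    define c d where "c = z + x - 2 * A" and "d = sqrt (4 * ((z - A) * (x - A)))"
    have "d > 0" using A by (simp add: d_def)
    have d2: "d\<^sup>2 = 4 * ((z - A) * (x - A))" using A by (simp add: d_def)
    have "d\<^sup>2 \<le> c\<^sup>2"
      using zero_le_power2[of "z - x"] unfolding d2 c_def by (simp add: power2_eq_square algebra_simps)
    moreover have "0 \<le> c" using A by (simp add: c_def)
    ultimately have dc: "d \<le> c" by (rule power2_le_imp_le)
    have Ystar: "Ystar x y z \<sigma> \<theta> = sqrt (c + d * cos \<theta>)" for \<theta>
      unfolding c_def d_def by (rule Ystar_eq[OF \<sigma> A_def]) (use A in auto)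
    have "(\<integral>\<^sup>+\<theta>\<in>{0..2*pi}. ennreal (\<Phi>' (sqrt 2 * \<sigma>) (sqrt 2 * Ystar x y z \<sigma> \<theta>)) \<partial>lborel) =
        (\<integral>\<^sup>+\<theta>\<in>{0..2*pi}. ennreal (\<Phi>' (sqrt 2 * \<sigma>) (sqrt 2 * sqrt (c + d * cos \<theta>))) \<partial>lborel)"
      unfolding Ystar by (rule refl)
    also have "\<dots> = 2 * (\<integral>\<^sup>+u\<in>{c - d..c + d}. ennreal (\<Phi>' (sqrt 2 * \<sigma>) (sqrt 2 * sqrt u)) *
        ennreal (1 / sqrt (d\<^sup>2 - (u - c)\<^sup>2)) \<partial>lborel)"
      by (rule nn_integral_cos_substitution) (use \<open>d > 0\<close> in auto)
    also have "\<dots> = 2 * (\<integral>\<^sup>+u. ennreal \<sigma> * transfer_density x y z (\<sigma>\<^sup>2) u \<partial>lborel)"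
    proof (intro arg_cong[where f = "\<lambda>r. 2 * r"] nn_integral_cong)
      fix u
      have P: "transfer_poly x y z (\<sigma>\<^sup>2) u = \<sigma>\<^sup>2 * (d\<^sup>2 - (u - c)\<^sup>2)"
        unfolding d2 c_def by (rule transfer_poly_square[OF \<sigma> A_def])
      have iff': "d\<^sup>2 - (u - c)\<^sup>2 > 0 \<longleftrightarrow> c - d < u \<and> u < c + d"
      proof -
        have "d\<^sup>2 - (u - c)\<^sup>2 > 0 \<longleftrightarrow> \<not> \<bar>d\<bar> \<le> \<bar>u - c\<bar>"
          unfolding abs_le_square_iff by linarith
        then show ?thesis using \<open>d > 0\<close> by linarith
      qed
      have eq0: "d\<^sup>2 - (u - c)\<^sup>2 = 0" if "u = c - d \<or> u = c + d"
        using that by auto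
      show "ennreal (\<Phi>' (sqrt 2 * \<sigma>) (sqrt 2 * sqrt u)) *
          ennreal (1 / sqrt (d\<^sup>2 - (u - c)\<^sup>2)) * indicator {c - d..c + d} u =
          ennreal \<sigma> * transfer_density x y z (\<sigma>\<^sup>2) u"
      proof (cases "c - d < u \<and> u < c + d")
        case True
        then have "u > 0" using dc by simp
        have q: "d\<^sup>2 - (u - c)\<^sup>2 > 0" using True iff' by simp
        then have P0: "transfer_poly x y z (\<sigma>\<^sup>2) u > 0" unfolding P using \<sigma> by simp
        have "\<sigma> * (\<Phi>' (sqrt 2 * \<sigma>) (sqrt 2 * sqrt u) / sqrt (transfer_poly x y z (\<sigma>\<^sup>2) u)) =
          \<Phi>' (sqrt 2 * \<sigma>) (sqrt 2 * sqrt u) * (1 / sqrt (d\<^sup>2 - (u - c)\<^sup>2))"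
          using \<sigma> unfolding P by (simp add: real_sqrt_mult)
        then have "ennreal (\<Phi>' (sqrt 2 * \<sigma>) (sqrt 2 * sqrt u)) * ennreal (1 / sqrt (d\<^sup>2 - (u - c)\<^sup>2)) =
          ennreal \<sigma> * ennreal (\<Phi>' (sqrt 2 * \<sigma>) (sqrt 2 * sqrt u) / sqrt (transfer_poly x y z (\<sigma>\<^sup>2) u))"
          using \<sigma> q P0 by (simp only: ennreal_mult[symmetric] \<Phi>'_nonneg divide_nonneg_nonneg
            real_sqrt_ge_zero less_imp_le zero_le_one)
        then show ?thesis
          using True \<sigma> \<open>u > 0\<close> P0 unfolding transfer_density_def by simp
      next
        case False
        then have "transfer_density x y z (\<sigma>\<^sup>2) u = 0"
          using iff' \<sigma> unfolding transfer_density_def P by (auto simp: zero_less_mult_iff)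
        moreover have "ennreal (1 / sqrt (d\<^sup>2 - (u - c)\<^sup>2)) * indicator {c - d..c + d} u = 0"
          using False eq0 by (auto simp: indicator_def)
        ultimately show ?thesis by (simp add: mult.assoc)
      qed
    qed
    also have "\<dots> = ?f (\<sigma>\<^sup>2) * ennreal (2 * \<sigma>)"
      using \<sigma> by (simp add: nn_integral_cmult ennreal_mult ac_simps)
    finally show ?thesis .
  qed
  have "ennreal (transfer x y z) = (\<integral>\<^sup>+\<sigma>\<in>{a..b}. ennreal (angular x y z \<sigma>) \<partial>lborel)"
    unfolding transfer_def a_def b_def
    by (rule ennreal_set_integral_Icc[where B = "2 * pi"]) (auto simp: angular_nonneg angular_le)
  also have "\<dots> = (\<integral>\<^sup>+\<sigma>. ?f (\<sigma>\<^sup>2) * ennreal (2 * \<sigma>) * indicator {a..b} \<sigma> \<partial>lborel)"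
  proof (rule nn_integral_cong_AE, rule AE_mp[OF AE_lborel_singleton[of a]], rule AE_mp[OF AE_lborel_singleton[of b]],
      intro AE_I2 impI)
    fix \<sigma> assume "\<sigma> \<noteq> a" "\<sigma> \<noteq> b"
    show "ennreal (angular x y z \<sigma>) * indicator {a..b} \<sigma> = ?f (\<sigma>\<^sup>2) * ennreal (2 * \<sigma>) * indicator {a..b} \<sigma>"
    proof (cases "\<sigma> \<in> {a..b}")
      case True
      then have "a < \<sigma>" "\<sigma> < b" using \<open>\<sigma> \<noteq> a\<close> \<open>\<sigma> \<noteq> b\<close> by auto
      have "ennreal (angular x y z \<sigma>) =
        (\<integral>\<^sup>+\<theta>\<in>{0..2*pi}. ennreal (\<Phi>' (sqrt 2 * \<sigma>) (sqrt 2 * Ystar x y z \<sigma> \<theta>)) \<partial>lborel)"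
        unfolding angular_def by (rule ennreal_set_integral_Icc[where B = 1]) auto
      then show ?thesis using density[OF \<open>a < \<sigma>\<close> \<open>\<sigma> < b\<close>] by simp
    qed auto
  qed
  also have "\<dots> = (\<integral>\<^sup>+v. ?f v * indicator {a\<^sup>2..b\<^sup>2} v \<partial>lborel)"
    by (rule nn_integral_substitution_aux[symmetric])
      (use ab a0 in \<open>auto intro!: derivative_eq_intros continuous_intros\<close>)
  also have "\<dots> = (\<integral>\<^sup>+v. ?f v \<partial>lborel)"
  proof (rule nn_integral_cong)
    fix v
    have "transfer_density x y z v u = 0" if v: "v \<notin> {a\<^sup>2..b\<^sup>2}" for u
    proof (rule ccontr)
      assume "transfer_density x y z v u \<noteq> 0"
      then have uv: "v > 0" "u > 0" "transfer_poly x y z v u > 0"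
        by (auto simp: transfer_density_def split: if_splits)
      define \<sigma> where "\<sigma> = sqrt v"
      have \<sigma>: "\<sigma> > 0" "v = \<sigma>\<^sup>2" using uv by (auto simp: \<sigma>_def)
      define A where "A = ?A \<sigma>"
      have "\<sigma>\<^sup>2 * (4 * ((z - A) * (x - A)) - (u - (z + x - 2 * A))\<^sup>2) > 0"
        using uv unfolding \<sigma>(2) transfer_poly_square[OF \<sigma>(1) A_def] by simp
      then have less: "(u - (z + x - 2 * A))\<^sup>2 < 4 * ((z - A) * (x - A))"
        using \<sigma> by (simp add: zero_less_mult_iff)
      then have prod: "(z - A) * (x - A) > 0"
        using zero_le_power2[of "u - (z + x - 2 * A)"] by linarith
      \<comment> \<open>If both factors were negative, the centre z + x - 2A would be negative, and
        a positive u would be farther from it than the centre is from 0. By the inequality of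
        arithmetic and geometric means that is too far.\<close>
      have "A < x \<and> A < z"
      proof (rule ccontr)
        assume "\<not> (A < x \<and> A < z)"
        with prod have neg: "z - A < 0" "x - A < 0" by (auto simp: zero_less_mult_iff)
        have "4 * ((z - A) * (x - A)) \<le> (z + x - 2 * A)\<^sup>2"
          using zero_le_power2[of "z - x"] by (simp add: power2_eq_square algebra_simps)
        also have "\<dots> \<le> (u - (z + x - 2 * A))\<^sup>2"
          using neg uv by (subst abs_le_square_iff[symmetric]) auto
        finally show False using less by simp
      qed
      then have "a < \<sigma>" "\<sigma> < b" using iff[OF \<sigma>(1)] by (auto simp: A_def)
      then have "v \<in> {a\<^sup>2..b\<^sup>2}" using a0 \<sigma> by (auto intro!: power_mono)
      with v show False by simp
    qed
    then show "?f v * indicator {a\<^sup>2..b\<^sup>2} v = ?f v"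
      by (cases "v \<in> {a\<^sup>2..b\<^sup>2}") auto
  qed
  finally show ?thesis .
qed

lemma transfer_nonneg: "0 \<le> transfer x y z"
  unfolding transfer_def set_lebesgue_integral_def
  by (intro Bochner_Integration.integral_nonneg) (simp add: angular_nonneg)

text \<open>In the original variables \<sigma> and \<open>Ystar\<close> play different roles. Their
  squares v and u are interchangeable, so the symmetry is Fubini for the density.\<close>

lemma transfer_commute:
  assumes "x > 0" "y > 0" "z > 0" "y + z - x > 0"
  shows "transfer x y z = transfer x z y"
proof -
  have "ennreal (transfer x y z) = (\<integral>\<^sup>+v. \<integral>\<^sup>+u. transfer_density x y z v u \<partial>lborel \<partial>lborel)"
    by (rule transfer_eq_density) fact+
  also have "\<dots> = (\<integral>\<^sup>+u. \<integral>\<^sup>+v. transfer_density x y z v u \<partial>lborel \<partial>lborel)"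
    by (rule lborel_pair.Fubini') simp
  also have "\<dots> = ennreal (transfer x z y)"
    using transfer_eq_density[of x z y] assms by (simp add: transfer_density_commute[of x y z])
  finally show ?thesis by (simp add: transfer_nonneg)
qed

lemma kernel_W_commute:
  assumes "x \<ge> 0" "y \<ge> 0" "z \<ge> 0"
  shows "kernel_W \<Phi> x y z = kernel_W \<Phi> x z y"
proof (cases "xstar x y z * x * y * z > 0")
  case True
  then have *: "x > 0" "y > 0" "z > 0" "y + z - x > 0"
    using assms by (auto simp: zero_less_mult_iff xstar_def max_def split: if_splits)
  from True have "xstar x z y * x * z * y > 0" by (simp add: xstar_commute[of x z] ac_simps)
  from kernel_W_generic[OF True] kernel_W_generic[OF this] transfer_commute[OF *] show ?thesis
    by (simp add: ac_simps)
next
  case False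
  moreover from False have "\<not> (xstar x z y * x * z * y > 0)" by (simp add: xstar_commute[of x z] ac_simps)
  ultimately show ?thesis using assms
    unfolding kernel_W_def by (auto simp: ac_simps \<Phi>_commute)
qed

lemma transfer_le:
  assumes "sigma_plus x y z - sigma_minus x y z \<le> c" "c \<ge> 0"
  shows "transfer x y z \<le> 2 * pi * c"
proof (cases "sigma_minus x y z \<le> sigma_plus x y z")
  case True
  have "transfer x y z \<le> 2 * pi * (sigma_plus x y z - sigma_minus x y z)"
    unfolding transfer_def using True angular_nonneg angular_le
    by (intro set_integral_Icc_le) (auto simp: abs_le_iff order_trans[OF _ angular_nonneg])
  also have "\<dots> \<le> 2 * pi * c" using assms by (intro mult_left_mono) auto
  finally show ?thesis .
next
  case False
  then have "transfer x y z = 0" by (simp add: transfer_def set_lebesgue_integral_def)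
  then show ?thesis using assms by simp
qed

lemma kernel_W_nonneg:
  assumes "x \<ge> 0" "y \<ge> 0" "z \<ge> 0"
  shows "kernel_W \<Phi> x y z \<ge> 0"
proof (cases "xstar x y z * x * y * z > 0")
  case True
  then show ?thesis using assms by (simp add: kernel_W_generic transfer_nonneg)
next
  case False
  then show ?thesis using assms by (auto simp: kernel_W_def \<Phi>_nonneg)
qed

text \<open>The window is at most twice as wide as the root of any of x, y, z, and the angular
  integral is at most 2 \<pi>. This cancels one of the three roots in the prefactor, with constant
  exactly 1.\<close>

lemma kernel_W_upper:
  assumes "x \<ge> 0" "y \<ge> 0" "z \<ge> 0"
  shows "kernel_W \<Phi> x y z * sqrt (y * z) \<le> 1"
    and "kernel_W \<Phi> x y z * sqrt (x * y) \<le> 1"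
    and "kernel_W \<Phi> x y z * sqrt (x * z) \<le> 1"
proof -
  have "kernel_W \<Phi> x y z * sqrt (y * z) \<le> 1 \<and> kernel_W \<Phi> x y z * sqrt (x * y) \<le> 1 \<and>
    kernel_W \<Phi> x y z * sqrt (x * z) \<le> 1"
  proof (cases "xstar x y z * x * y * z > 0")
    case True
    then have "x > 0" "y > 0" "z > 0" using assms by (auto simp: zero_less_mult_iff)
    moreover have "transfer x y z \<le> 4 * pi * sqrt x" "transfer x y z \<le> 4 * pi * sqrt y"
      "transfer x y z \<le> 4 * pi * sqrt z"
      using transfer_le[OF sigma_width(1)] transfer_le[OF sigma_width(2)] transfer_le[OF sigma_width(3)] assms
      by (auto simp: ac_simps)
    ultimately show ?thesis
      unfolding kernel_W_generic[OF True] by (simp add: real_sqrt_mult divide_simps)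
  next
    case False
    then show ?thesis using assms by (auto simp: kernel_W_def \<Phi>_le_1)
  qed
  then show "kernel_W \<Phi> x y z * sqrt (y * z) \<le> 1" "kernel_W \<Phi> x y z * sqrt (x * y) \<le> 1"
    "kernel_W \<Phi> x y z * sqrt (x * z) \<le> 1" by auto
qed

text \<open>For p > 0 both kernels average over the window of \<open>sigma_range\<close>, on which
  \<open>Ystar\<close> is larger for the order p, q, r; monotonicity of \<Phi> does the
  rest.\<close>

lemma kernel_W_swap_le:
  assumes "0 \<le> p" "p \<le> q" "q \<le> r"
  shows "kernel_W \<Phi> q p r \<le> kernel_W \<Phi> p q r"
proof -
  consider "p = 0" "q = 0" | "p = 0" "q > 0" | "p > 0" using assms by force
  then show ?thesis
  proof cases
    case 2
    have "\<Phi> (sqrt (2 * q)) (sqrt (2 * (r - q))) \<le> \<Phi> (sqrt (2 * q)) (sqrt (2 * r))"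
      by (rule \<Phi>_mono) (use assms in auto)
    with 2 assms show ?thesis by (simp add: kernel_W_def divide_right_mono)
  next
    case 3
    have 1: "xstar q p r * q * p * r > 0" and 2: "xstar p q r * p * q * r > 0"
      using 3 assms by (auto simp: xstar_def max_def)
    have "angular q p r \<sigma> \<le> angular p q r \<sigma>" if "\<sigma> \<in> {sqrt q - sqrt p..sqrt q + sqrt p}" for \<sigma>
      unfolding angular_def using that 3 assms
      by (intro set_integral_mono set_integrable_bounded_Icc[where B = 1])
        (auto intro!: \<Phi>'_mono mult_left_mono Ystar_mono)
    then have "transfer q p r \<le> transfer p q r"
      unfolding transfer_def sigma_range[OF 3 assms(2,3)]
      by (intro set_integral_mono set_integrable_bounded_Icc[where B = "2 * pi"])
        (auto simp: abs_le_iff angular_le order_trans[OF _ angular_nonneg])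
    then show ?thesis
      unfolding kernel_W_generic[OF 1] kernel_W_generic[OF 2] using 3 assms
      by (simp add: divide_right_mono ac_simps)
  qed auto
qed

text \<open>Only the upper half [sqrt q, sqrt q + sqrt p] of the window is used: there \<sigma>
  \<ge> sqrt q bounds \<Phi> below whatever \<open>Ystar\<close> is. Its length sqrt p cancels the
  root of p in the prefactor, so the bound is uniform down to p = 0.\<close>

lemma kernel_W_lower:
  assumes "0 \<le> p" "p \<le> q" "q \<le> r" "0 < q"
  shows "b0 / 2 * min 1 ((2 * q) powr \<eta>) / sqrt (q * r) \<le> kernel_W \<Phi> q p r"
proof -
  define B where "B = b0 * min 1 ((2 * q) powr \<eta>)"
  have B: "B \<ge> 0" "B \<le> 1" using b0 by (auto simp: B_def intro!: mult_le_one)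
  have \<Phi>: "B \<le> \<Phi> (sqrt 2 * s) t" if "sqrt q \<le> s" "t \<ge> 0" for s t
  proof -
    have "s > 0" using that assms by (meson less_le_trans real_sqrt_gt_zero)
    have "q \<le> s\<^sup>2" using that assms by (simp add: sqrt_le_D)
    then have "(2 * q) powr \<eta> \<le> ((sqrt 2 * s)\<^sup>2 + t\<^sup>2) powr \<eta>"
      using \<eta> assms by (intro powr_mono2) (auto simp: power_mult_distrib intro: add_increasing2)
    then have "B \<le> b0 * min 1 (((sqrt 2 * s)\<^sup>2 + t\<^sup>2) powr \<eta>)"
      unfolding B_def using b0 by (intro mult_left_mono min.mono) auto
    also have "\<dots> \<le> \<Phi> (sqrt 2 * s) t" using that \<open>s > 0\<close> by (intro \<Phi>_lower) auto
    finally show ?thesis .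
  qed
  have "B / 2 / sqrt (q * r) \<le> kernel_W \<Phi> q p r"
  proof (cases "p = 0")
    case True
    have "B / 2 \<le> \<Phi> (sqrt (2 * q)) (sqrt (2 * (r - q)))"
      using \<Phi>[of "sqrt q" "sqrt (2 * (r - q))"] assms B by (auto simp: real_sqrt_mult)
    then have "B / 2 / sqrt (q * r) \<le> \<Phi> (sqrt (2 * q)) (sqrt (2 * (r - q))) / sqrt (q * r)"
      using assms by (intro divide_right_mono) auto
    then show ?thesis using True assms by (simp add: kernel_W_def)
  next
    case False
    with assms have p: "p > 0" by simp
    have 1: "xstar q p r * q * p * r > 0" using p assms by (auto simp: xstar_def max_def)
    have ang: "2 * pi * (B * indicator {sqrt q..sqrt q + sqrt p} \<sigma>) \<le> angular q p r \<sigma>" for \<sigma>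
    proof (cases "\<sigma> \<in> {sqrt q..sqrt q + sqrt p}")
      case True
      have "0 \<le> \<sigma>" using True assms by (auto intro: order_trans[of _ "sqrt q"])
      have "2 * pi * B = (LINT \<theta>:{0..2*pi}|lborel. B)" by (simp add: set_lebesgue_integral_def)
      also have "\<dots> \<le> angular q p r \<sigma>"
        unfolding angular_def
      proof (intro set_integral_mono set_integrable_bounded_Icc[where B = 1] borel_integrable_atLeastAtMost')
        show "B \<le> \<Phi>' (sqrt 2 * \<sigma>) (sqrt 2 * Ystar q p r \<sigma> \<theta>)" for \<theta>
          using True \<Phi>[of \<sigma>] \<open>0 \<le> \<sigma>\<close> by (simp add: Ystar_nonneg)
      qed (use B in auto)
      finally show ?thesis using True by simp
    qed (simp add: angular_nonneg)
    have "2 * pi * B * sqrt p = 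
       (LINT \<sigma>:{sqrt q - sqrt p..sqrt q + sqrt p}|lborel. 2 * pi * (B * indicator {sqrt q..sqrt q + sqrt p} \<sigma>))"
    proof -
      have "(LINT \<sigma>:{sqrt q - sqrt p..sqrt q + sqrt p}|lborel. 2 * pi * (B * indicator {sqrt q..sqrt q + sqrt p} \<sigma>))
        = (LINT \<sigma>|lborel. 2 * pi * B * indicator {sqrt q..sqrt q + sqrt p} \<sigma>)"
        unfolding set_lebesgue_integral_def using p
        by (intro Bochner_Integration.integral_cong) (auto simp: indicator_def real_sqrt_ge_zero intro: order_trans[of _ "sqrt q"])
      also have "\<dots> = 2 * pi * B * sqrt p" using p by simp
      finally show ?thesis by (rule sym)
    qed
    also have "\<dots> \<le> transfer q p r"
      unfolding transfer_def sigma_range[OF p assms(2,3)]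
    proof (intro set_integral_mono)
      show "2 * pi * (B * indicator {sqrt q..sqrt q + sqrt p} \<sigma>) \<le> angular q p r \<sigma>" for \<sigma>
        by (rule ang)
      show "set_integrable lborel {sqrt q - sqrt p..sqrt q + sqrt p} (angular q p r)"
        by (rule set_integrable_bounded_Icc[where B = "2 * pi"])
          (auto simp: abs_le_iff angular_le order_trans[OF _ angular_nonneg])
      show "set_integrable lborel {sqrt q - sqrt p..sqrt q + sqrt p}
          (\<lambda>\<sigma>. 2 * pi * (B * indicator {sqrt q..sqrt q + sqrt p} \<sigma>))"
        using B by (intro set_integrable_bounded_Icc[where B = "2 * pi * B"]) (auto simp: indicator_def)
    qed
    finally have "2 * pi * B * sqrt p / (4 * pi * sqrt (q * p * r)) \<le> kernel_W \<Phi> q p r"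
      unfolding kernel_W_generic[OF 1] using p assms by (intro divide_right_mono) auto
    moreover have "2 * pi * B * sqrt p / (4 * pi * sqrt (q * p * r)) = B / 2 / sqrt (q * r)"
      using p assms by (simp add: real_sqrt_mult)
    ultimately show ?thesis by simp
  qed
  then show ?thesis by (simp add: B_def)
qed

end

section \<open>The collision forms on convex test functions\<close>

text \<open>\<open>xstar\<close> differs from z by as much as x from y, hence the factor 2.\<close>

lemma Delta_bound:
  assumes lip: "\<And>x y. 0 \<le> x \<Longrightarrow> 0 \<le> y \<Longrightarrow> \<bar>\<phi> x - \<phi> y\<bar> \<le> L * \<bar>x - y\<bar>" and "L \<ge> 0"
    and "0 \<le> x" "0 \<le> y" "0 \<le> z" "x \<le> y + z"
  shows "\<bar>Delta \<phi> x y z\<bar> \<le> 2 * L * \<bar>x - y\<bar>"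
proof -
  have x: "xstar x y z = y + z - x" using assms by (simp add: xstar_def)
  have "\<bar>\<phi> x - \<phi> y\<bar> \<le> L * \<bar>x - y\<bar>" "\<bar>\<phi> (y + z - x) - \<phi> z\<bar> \<le> L * \<bar>y + z - x - z\<bar>"
    using lip[of x y] lip[of "y + z - x" z] assms by auto
  moreover have "\<bar>y + z - x - z\<bar> = \<bar>x - y\<bar>" by simp
  ultimately show ?thesis unfolding Delta_def x by (simp add: algebra_simps)
qed

lemma Delta_commute: "Delta \<phi> x y z = Delta \<phi> x z y"
  by (simp add: Delta_def xstar_def add.commute)

context scattering
begin

lemma coll_K_commute:
  assumes "x \<ge> 0" "y \<ge> 0" "z \<ge> 0"
  shows "coll_K \<Phi> \<phi> x y z = coll_K \<Phi> \<phi> x z y"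
  using assms unfolding coll_K_def by (simp add: kernel_W_commute[of x y z] Delta_commute[of _ x y])

lemma coll_J_commute:
  assumes "y \<ge> 0" "z \<ge> 0"
  shows "coll_J \<Phi> \<phi> y z = coll_J \<Phi> \<phi> z y"
proof -
  have "(LINT x:{0..y + z}|lborel. coll_K \<Phi> \<phi> x y z * sqrt x) = (LINT x:{0..y + z}|lborel. coll_K \<Phi> \<phi> x z y * sqrt x)"
    using assms by (intro set_lebesgue_integral_cong) (auto simp: coll_K_commute)
  then show ?thesis by (simp add: coll_J_def add.commute)
qed

text \<open>The kernel is singular at 0, but \<open>Delta\<close> vanishes for x = y and for x = z.
  In every ordering the distance from x to one of them is at most a geometric mean that
  \<open>kernel_W_upper\<close> controls. Boundedness later permits splitting and permuting the
  cubic integral.\<close>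

lemma coll_K_bounded:
  assumes lip: "\<And>x y. 0 \<le> x \<Longrightarrow> 0 \<le> y \<Longrightarrow> \<bar>\<phi> x - \<phi> y\<bar> \<le> L * \<bar>x - y\<bar>" and "L \<ge> 0"
    and "0 \<le> x" "0 \<le> y" "0 \<le> z"
  shows "\<bar>coll_K \<Phi> \<phi> x y z\<bar> \<le> 2 * L"
proof -
  have *: "\<bar>coll_K \<Phi> \<phi> x y z\<bar> \<le> 2 * L" if "0 \<le> x" "0 \<le> y" "y \<le> z" for x y z
  proof (cases "x \<le> y + z")
    case False
    then show ?thesis using that assms by (simp add: coll_K_def kernel_W_eq_0)
  next
    case True
    define W where "W = kernel_W \<Phi> x y z"
    have W: "W \<ge> 0" using that by (simp add: W_def kernel_W_nonneg)
    have 1: "\<bar>Delta \<phi> x y z\<bar> \<le> 2 * L * \<bar>x - y\<bar>"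
      by (rule Delta_bound) (use lip \<open>L \<ge> 0\<close> that True in auto)
    have 2: "\<bar>Delta \<phi> x y z\<bar> \<le> 2 * L * \<bar>x - z\<bar>"
      using Delta_bound[of \<phi> L x z y] lip \<open>L \<ge> 0\<close> that True by (simp add: Delta_commute[of _ x y])
    have "\<exists>s. W * s \<le> 1 \<and> \<bar>Delta \<phi> x y z\<bar> \<le> 2 * L * s"
    proof -
      consider "x \<le> y" | "y \<le> x" "x \<le> z" | "z \<le> x" by linarith
      then show ?thesis
      proof cases
        case 1
        have "\<bar>x - y\<bar> \<le> sqrt (y * z)"
        proof (rule real_le_rsqrt)
          have "\<bar>x - y\<bar>\<^sup>2 \<le> y\<^sup>2" using 1 that by (intro power_mono) auto
          also have "\<dots> \<le> y * z" using that by (simp add: power2_eq_square mult_left_mono)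
          finally show "\<bar>x - y\<bar>\<^sup>2 \<le> y * z" .
        qed
        then have "2 * L * \<bar>x - y\<bar> \<le> 2 * L * sqrt (y * z)" using \<open>L \<ge> 0\<close> by (intro mult_left_mono) auto
        with \<open>\<bar>Delta \<phi> x y z\<bar> \<le> 2 * L * \<bar>x - y\<bar>\<close> show ?thesis
          using kernel_W_upper(1)[of x y z] that by (intro exI[of _ "sqrt (y * z)"]) (auto simp: W_def)
      next
        case 2
        have "\<bar>x - y\<bar> \<le> sqrt (x * z)"
        proof (rule real_le_rsqrt)
          have "\<bar>x - y\<bar>\<^sup>2 \<le> x\<^sup>2" using 2 that by (intro power_mono) auto
          also have "\<dots> \<le> x * z" using 2 that by (simp add: power2_eq_square mult_left_mono)
          finally show "\<bar>x - y\<bar>\<^sup>2 \<le> x * z" .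
        qed
        then have "2 * L * \<bar>x - y\<bar> \<le> 2 * L * sqrt (x * z)" using \<open>L \<ge> 0\<close> by (intro mult_left_mono) auto
        with \<open>\<bar>Delta \<phi> x y z\<bar> \<le> 2 * L * \<bar>x - y\<bar>\<close> show ?thesis
          using kernel_W_upper(3)[of x y z] that by (intro exI[of _ "sqrt (x * z)"]) (auto simp: W_def)
      next
        case 3
        have "\<bar>x - z\<bar> \<le> sqrt (x * z)"
        proof (rule real_le_rsqrt)
          have "\<bar>x - z\<bar>\<^sup>2 \<le> y\<^sup>2" using 3 that True by (intro power_mono) auto
          also have "\<dots> \<le> z\<^sup>2" using that by (intro power_mono) auto
          also have "\<dots> \<le> x * z" using 3 that by (simp add: power2_eq_square mult_right_mono)
          finally show "\<bar>x - z\<bar>\<^sup>2 \<le> x * z" .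
        qed
        then have "2 * L * \<bar>x - z\<bar> \<le> 2 * L * sqrt (x * z)" using \<open>L \<ge> 0\<close> by (intro mult_left_mono) auto
        with \<open>\<bar>Delta \<phi> x y z\<bar> \<le> 2 * L * \<bar>x - z\<bar>\<close> show ?thesis
          using kernel_W_upper(3)[of x y z] that by (intro exI[of _ "sqrt (x * z)"]) (auto simp: W_def)
      qed
    qed
    then obtain s where s: "W * s \<le> 1" "\<bar>Delta \<phi> x y z\<bar> \<le> 2 * L * s" by auto
    have "\<bar>coll_K \<Phi> \<phi> x y z\<bar> = W * \<bar>Delta \<phi> x y z\<bar>"
      using W by (simp add: coll_K_def W_def abs_mult)
    also have "\<dots> \<le> W * (2 * L * s)" using W s by (intro mult_left_mono)
    also have "\<dots> = 2 * L * (W * s)" by simp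
    also have "\<dots> \<le> 2 * L" using s \<open>L \<ge> 0\<close> by (intro mult_left_le) auto
    finally show ?thesis .
  qed
  show ?thesis
  proof (cases "y \<le> z")
    case False
    with *[of x z y] show ?thesis using assms by (simp add: coll_K_commute[of x y z])
  qed (use * assms in auto)
qed

section \<open>The symmetrized cubic form\<close>

definition coll_sym :: "(real \<Rightarrow> real) \<Rightarrow> real \<Rightarrow> real \<Rightarrow> real \<Rightarrow> real" where
  "coll_sym \<phi> x y z = coll_K \<Phi> \<phi> x y z + coll_K \<Phi> \<phi> x z y + coll_K \<Phi> \<phi> y x z +
     coll_K \<Phi> \<phi> y z x + coll_K \<Phi> \<phi> z x y + coll_K \<Phi> \<phi> z y x"

text \<open>
  The only negative contributions are those of \<open>W q p r\<close>. They are compensated by those of \<open>W p q r\<close>,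
  which is at least as large because \<open>\<Phi>\<close> is nondecreasing.
\<close>

lemma coll_sym_ge:
  assumes conv: "convex_on UNIV \<phi>" and "0 \<le> p" "p \<le> q" "q \<le> r"
  shows "coll_sym \<phi> p q r \<ge> 2 * (kernel_W \<Phi> q p r * (\<phi> (r + (q - p)) + \<phi> (r - (q - p)) - 2 * \<phi> r))"
proof -
  have x: "xstar p q r = r + (q - p)" "xstar q p r = r - (q - p)" using assms by (auto simp: xstar_def)
  have D1: "Delta \<phi> p q r \<ge> 0"
    using convex_on_sum_le[OF conv, of p q "r + (q - p)" r] assms by (simp add: Delta_def x)
  have W: "kernel_W \<Phi> q p r \<le> kernel_W \<Phi> p q r" using assms by (intro kernel_W_swap_le)
  have "coll_K \<Phi> \<phi> r p q \<ge> 0"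
  proof (cases "r \<le> p + q")
    case True
    then have "Delta \<phi> r p q \<ge> 0"
      using convex_on_sum_le[OF conv, of "p + q - r" p r q] assms by (simp add: Delta_def xstar_def)
    then show ?thesis using assms kernel_W_nonneg[of r p q] by (simp add: coll_K_def)
  qed (use assms in \<open>simp add: coll_K_def kernel_W_eq_0\<close>)
  moreover have "coll_K \<Phi> \<phi> p q r + coll_K \<Phi> \<phi> q p r \<ge> kernel_W \<Phi> q p r * (Delta \<phi> p q r + Delta \<phi> q p r)"
    using mult_right_mono[OF W D1] by (simp add: coll_K_def algebra_simps)
  \<comment> \<open>The values at p and q cancel; what remains is a second difference of \<phi> at r
    with step q - p.\<close>
  moreover have "Delta \<phi> p q r + Delta \<phi> q p r = \<phi> (r + (q - p)) + \<phi> (r - (q - p)) - 2 * \<phi> r"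
    by (simp add: Delta_def x)
  ultimately show ?thesis
    using assms unfolding coll_sym_def
    by (simp add: coll_K_commute[of p r q] coll_K_commute[of q r p] coll_K_commute[of r q p])
qed

lemma coll_sym_commute: "coll_sym \<phi> x y z = coll_sym \<phi> x z y"
  by (simp add: coll_sym_def)

lemma coll_sym_nonneg:
  assumes conv: "convex_on UNIV \<phi>" and "0 \<le> x" "0 \<le> y" "0 \<le> z"
  shows "coll_sym \<phi> x y z \<ge> 0"
proof -
  have *: "coll_sym \<phi> p q r \<ge> 0" if "0 \<le> p" "p \<le> q" "q \<le> r" for p q r
  proof -
    have "\<phi> (r + (q - p)) + \<phi> (r - (q - p)) - 2 * \<phi> r \<ge> 0"
      using convex_on_sum_le[OF conv, of "r - (q - p)" r "r + (q - p)" r] that by simp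
    then have "0 \<le> 2 * (kernel_W \<Phi> q p r * (\<phi> (r + (q - p)) + \<phi> (r - (q - p)) - 2 * \<phi> r))"
      using kernel_W_nonneg[of q p r] that by simp
    also have "\<dots> \<le> coll_sym \<phi> p q r" by (rule coll_sym_ge[OF conv that])
    finally show ?thesis .
  qed
  consider "x \<le> y" "y \<le> z" | "x \<le> z" "z \<le> y" | "y \<le> x" "x \<le> z" | "y \<le> z" "z \<le> x" | "z \<le> x" "x \<le> y" | "z \<le> y" "y \<le> x"
    by linarith
  then show ?thesis
    by cases (use *[of x y z] *[of x z y] *[of y x z] *[of y z x] *[of z x y] *[of z y x] assms
        in \<open>simp_all add: coll_sym_def add_ac\<close>)
qed

text \<open>Let q \<le> r be y and z in increasing order. In the second difference of
  \<open>coll_sym_ge\<close> only the value at r - (q - x) = x + (r - q) survives, since r and r +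
  (q - x) lie beyond \<epsilon>. This point is at most \<delta> \<epsilon> to the right of x, whence
  the shifted tent.\<close>

lemma coll_sym_tent_ge:
  assumes "k \<ge> 2" "0 < \<epsilon>" "8 * \<epsilon> \<le> 1" "0 \<le> \<delta>"
    and "0 \<le> x" "2 * \<epsilon> < y" "y \<le> 4 * \<epsilon>" "2 * \<epsilon> < z" "z \<le> 4 * \<epsilon>" "\<bar>y - z\<bar> \<le> \<delta> * \<epsilon>"
  shows "coll_sym (tent k \<epsilon>) x y z \<ge> b0 * (4 * \<epsilon>) powr (\<eta> - 1) * tent k \<epsilon> (x + \<delta> * \<epsilon>)"
proof -
  have conv: "convex_on UNIV (tent k \<epsilon>)" using assms by (intro convex_on_tent) auto
  have *: "coll_sym (tent k \<epsilon>) x q r \<ge> b0 * (4 * \<epsilon>) powr (\<eta> - 1) * tent k \<epsilon> (x + \<delta> * \<epsilon>)"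
    if "2 * \<epsilon> < q" "q \<le> r" "r \<le> 4 * \<epsilon>" "r - q \<le> \<delta> * \<epsilon>" for q r
  proof (cases "x + \<delta> * \<epsilon> \<ge> \<epsilon>")
    case True
    then show ?thesis using tent_eq_0[of \<epsilon> k] coll_sym_nonneg[OF conv, of x q r] assms that by simp
  next
    case False
    have "0 \<le> \<delta> * \<epsilon>" using assms by simp
    then have x: "x \<le> q" using False that assms by linarith
    have pos: "q > 0" "r > 0" using that assms by linarith+
    have "sqrt (q * r) \<le> 4 * \<epsilon>"
      using that assms pos mult_mono[of q "4 * \<epsilon>" r "4 * \<epsilon>"] by (intro real_le_lsqrt) (auto simp: power2_eq_square)
    have "b0 / 2 * (4 * \<epsilon>) powr (\<eta> - 1) = b0 / 2 * (4 * \<epsilon>) powr \<eta> / (4 * \<epsilon>)"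
      using assms by (simp add: powr_diff)
    also have "\<dots> \<le> b0 / 2 * min 1 ((2 * q) powr \<eta>) / (4 * \<epsilon>)"
    proof -
      \<comment> \<open>\<open>8 * \<epsilon> \<le> 1\<close> keeps 2q below 1, so that the minimum
        in the lower bound on \<Phi> is the power.\<close>
      have "(2 * q) powr \<eta> \<le> 1" using that assms \<eta> pos by (intro powr_le1) auto
      moreover have "(4 * \<epsilon>) powr \<eta> \<le> (2 * q) powr \<eta>" using that assms \<eta> by (intro powr_mono2) auto
      ultimately show ?thesis using b0 assms by (intro divide_right_mono mult_left_mono) auto
    qed
    also have "\<dots> \<le> b0 / 2 * min 1 ((2 * q) powr \<eta>) / sqrt (q * r)"
      using \<open>sqrt (q * r) \<le> 4 * \<epsilon>\<close> b0 pos assms(2) by (intro divide_left_mono) auto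
    also have "\<dots> \<le> kernel_W \<Phi> q x r"
      using kernel_W_lower[of x q r] assms that x pos by simp
    finally have W: "b0 / 2 * (4 * \<epsilon>) powr (\<eta> - 1) \<le> kernel_W \<Phi> q x r" .
    have "tent k \<epsilon> (x + \<delta> * \<epsilon>) \<le> tent k \<epsilon> (r - (q - x))"
      using assms that by (intro tent_antimono) auto
    moreover have "tent k \<epsilon> r = 0" "tent k \<epsilon> (r + (q - x)) = 0"
      using assms that x by (auto intro!: tent_eq_0)
    ultimately have D: "tent k \<epsilon> (x + \<delta> * \<epsilon>) \<le> tent k \<epsilon> (r + (q - x)) + tent k \<epsilon> (r - (q - x)) - 2 * tent k \<epsilon> r"
      by simp
    have "b0 * (4 * \<epsilon>) powr (\<eta> - 1) * tent k \<epsilon> (x + \<delta> * \<epsilon>)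
        = 2 * (b0 / 2 * (4 * \<epsilon>) powr (\<eta> - 1) * tent k \<epsilon> (x + \<delta> * \<epsilon>))" by simp
    also have "\<dots> \<le> 2 * (kernel_W \<Phi> q x r * (tent k \<epsilon> (r + (q - x)) + tent k \<epsilon> (r - (q - x)) - 2 * tent k \<epsilon> r))"
      using W D b0 assms kernel_W_nonneg[of q x r] pos by (intro mult_left_mono mult_mono) auto
    also have "\<dots> \<le> coll_sym (tent k \<epsilon>) x q r"
      using assms that x by (intro coll_sym_ge[OF conv]) auto
    finally show ?thesis .
  qed
  show ?thesis
  proof (cases "y \<le> z")
    case False
    then show ?thesis using *[of z y] assms by (simp add: coll_sym_commute[of _ x y])
  qed (use *[of y z] assms in auto)
qed

text \<open>For x outside [y, z] the pair x, y + z - x is more spread than y, z, and convexity makes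
  \<open>Delta\<close> nonnegative. Inside, \<phi> (y + z - x) is at least \<phi> z, so at most
  \<phi> y is lost.\<close>

lemma coll_K_sqrt_ge:
  assumes conv: "convex_on UNIV \<phi>" and anti: "\<And>x y. x \<le> y \<Longrightarrow> \<phi> y \<le> \<phi> x" and nn: "\<And>x. \<phi> x \<ge> 0"
    and "0 \<le> y" "y \<le> z" "0 < z" "0 \<le> x" "x \<le> y + z"
  shows "coll_K \<Phi> \<phi> x y z * sqrt x \<ge> - \<phi> y / sqrt z * indicator {y..z} x"
proof (cases "x \<in> {y..z}")
  case True
  have x: "xstar x y z = y + z - x" using assms by (simp add: xstar_def)
  have "\<phi> z \<le> \<phi> (y + z - x)" using True by (intro anti) auto
  then have D: "- \<phi> y \<le> Delta \<phi> x y z" using nn[of x] by (simp add: Delta_def x)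
  have W: "kernel_W \<Phi> x y z * sqrt x \<le> 1 / sqrt z"
    using kernel_W_upper(3)[of x y z] assms by (simp add: real_sqrt_mult pos_le_divide_eq mult.assoc)
  have "- \<phi> y * (1 / sqrt z) \<le> - \<phi> y * (kernel_W \<Phi> x y z * sqrt x)"
    using mult_left_mono[OF W nn[of y]] by simp
  also have "\<dots> \<le> Delta \<phi> x y z * (kernel_W \<Phi> x y z * sqrt x)"
    using D kernel_W_nonneg[of x y z] assms by (intro mult_right_mono) auto
  finally show ?thesis using True by (simp add: coll_K_def ac_simps)
next
  case False
  have x: "xstar x y z = y + z - x" using assms by (simp add: xstar_def)
  have "Delta \<phi> x y z \<ge> 0"
  proof (cases "x < y")
    case True
    then show ?thesis using convex_on_sum_le[OF conv, of x y "y + z - x" z] assms by (simp add: Delta_def x)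
  next
    case False
    then show ?thesis using convex_on_sum_le[OF conv, of "y + z - x" y x z] assms \<open>x \<notin> {y..z}\<close>
      by (simp add: Delta_def x)
  qed
  then show ?thesis using False kernel_W_nonneg[of x y z] assms by (simp add: coll_K_def)
qed

text \<open>For y \<le> z the loss is confined to [y, z]; its length, at most z, against the factor
  1 / sqrt z leaves sqrt z. Integrated against a measure of mass N and energy E, this root becomes
  the rate sqrt (N * E).\<close>

lemma coll_J_ge:
  assumes conv: "convex_on UNIV \<phi>" and anti: "\<And>x y. x \<le> y \<Longrightarrow> \<phi> y \<le> \<phi> x" and nn: "\<And>x. \<phi> x \<ge> 0"
    and "0 \<le> y" "0 \<le> z"
  shows "coll_J \<Phi> \<phi> y z \<ge> - (\<phi> y * sqrt z + \<phi> z * sqrt y) / 2"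
proof -
  have *: "coll_J \<Phi> \<phi> y z \<ge> - (\<phi> y * sqrt z) / 2" if "0 \<le> y" "y \<le> z" for y z
  proof (cases "z = 0")
    case True
    \<comment> \<open>For y = z = 0 the range of integration is the null set {0}.\<close>
    have "(LBINT x. indicat_real {0} x * (coll_K \<Phi> \<phi> x 0 0 * sqrt x)) = 0"
      by (rule integral_eq_zero_AE) (simp add: indicator_def)
    then show ?thesis using True that by (simp add: coll_J_def set_lebesgue_integral_def)
  next
    case False
    with that have "z > 0" by simp
    let ?g = "\<lambda>x. - \<phi> y / sqrt z * indicator {y..z} x :: real"
    note I = set_integral_Icc_indicator[of 0 y z "y + z" "- \<phi> y / sqrt z"]
    have "(LINT x:{0..y + z}|lborel. ?g x) \<le> (LINT x:{0..y + z}|lborel. coll_K \<Phi> \<phi> x y z * sqrt x)"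
    proof (rule set_integral_ge_of_integrable)
      show "?g x \<le> coll_K \<Phi> \<phi> x y z * sqrt x" if "x \<in> {0..y + z}" for x
        by (rule coll_K_sqrt_ge[OF conv anti nn]) (use \<open>0 \<le> y\<close> \<open>y \<le> z\<close> \<open>z > 0\<close> that in auto)
      show "(LINT x:{0..y + z}|lborel. ?g x) \<le> 0"
        unfolding I(1)[OF that(1,2) _] using that nn[of y] \<open>z > 0\<close>
        by (subst I(1)) (auto simp: mult_nonpos_nonneg divide_nonpos_nonneg)
    qed (use I(2) that in auto)
    moreover have "(LINT x:{0..y + z}|lborel. ?g x) = - \<phi> y / sqrt z * (z - y)"
      using I(1) that by simp
    moreover have "- \<phi> y / sqrt z * (z - y) \<ge> - \<phi> y * sqrt z"
    proof -
      have "\<phi> y / sqrt z * (z - y) \<le> \<phi> y / sqrt z * z"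
        using that nn[of y] by (intro mult_left_mono) auto
      also have "\<phi> y / sqrt z * z = \<phi> y * (z / sqrt z)" by simp
      also have "z / sqrt z = sqrt z" using \<open>z > 0\<close> by (intro real_div_sqrt) simp
      finally show ?thesis by simp
    qed
    ultimately show ?thesis by (simp add: coll_J_def)
  qed
  show ?thesis
  proof (cases "y \<le> z")
    case True
    then show ?thesis using *[of y z] nn[of z] assms by (smt (verit) divide_right_mono mult_nonneg_nonneg real_sqrt_ge_zero)
  next
    case False
    then show ?thesis using *[of z y] nn[of y] assms coll_J_commute[of y z \<phi>]
      by (smt (verit) divide_right_mono mult_nonneg_nonneg real_sqrt_ge_zero)
  qed
qed

section \<open>Measurability, size and gain of the quadratic form\<close>

lemma borel_measurable_coll_K [measurable (raw)]:
  assumes [measurable]: "\<phi> \<in> borel_measurable borel"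
    "a \<in> borel_measurable M" "b \<in> borel_measurable M" "c \<in> borel_measurable M"
  shows "(\<lambda>w. coll_K \<Phi> \<phi> (a w) (b w) (c w)) \<in> borel_measurable M"
  unfolding coll_K_def Delta_def by measurable

lemma borel_measurable_coll_J [measurable (raw)]:
  assumes [measurable]: "\<phi> \<in> borel_measurable borel"
    "b \<in> borel_measurable M" "c \<in> borel_measurable M"
  shows "(\<lambda>w. coll_J \<Phi> \<phi> (b w) (c w)) \<in> borel_measurable M"
  unfolding coll_J_def set_lebesgue_integral_def indicator_def atLeastAtMost_iff by measurable

lemma coll_K_sqrt_bounded:
  assumes \<phi>: "\<And>x. 0 \<le> x \<Longrightarrow> 0 \<le> \<phi> x \<and> \<phi> x \<le> 1" and "0 \<le> x" "0 \<le> y" "0 < z"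
  shows "\<bar>coll_K \<Phi> \<phi> x y z * sqrt x\<bar> \<le> 2 / sqrt z"
proof -
  have "kernel_W \<Phi> x y z * sqrt x \<le> 1 / sqrt z"
    using kernel_W_upper(3)[of x y z] assms by (simp add: real_sqrt_mult pos_le_divide_eq mult.assoc)
  moreover have "\<bar>Delta \<phi> x y z\<bar> \<le> 2"
  proof -
    have "0 \<le> xstar x y z" by (simp add: xstar_def)
    then show ?thesis
      using \<phi>[of x] \<phi>[of "xstar x y z"] \<phi>[of y] \<phi>[of z] assms unfolding Delta_def by linarith
  qed
  ultimately have "(kernel_W \<Phi> x y z * sqrt x) * \<bar>Delta \<phi> x y z\<bar> \<le> (1 / sqrt z) * 2"
    using kernel_W_nonneg[of x y z] assms by (intro mult_mono) auto
  then show ?thesis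
    using kernel_W_nonneg[of x y z] assms by (simp add: coll_K_def abs_mult mult_ac)
qed

text \<open>The value is at most 2 sqrt (max y z). The product bound is cruder, but integrable with
  respect to a product of measures with finite first moment.\<close>

lemma coll_J_bounded:
  assumes [measurable]: "\<phi> \<in> borel_measurable borel"
    and \<phi>: "\<And>x. 0 \<le> x \<Longrightarrow> 0 \<le> \<phi> x \<and> \<phi> x \<le> 1" and "0 \<le> y" "0 \<le> z"
  shows "\<bar>coll_J \<Phi> \<phi> y z\<bar> \<le> 2 * ((1 + y) * (1 + z))"
proof -
  have *: "\<bar>coll_J \<Phi> \<phi> y z\<bar> \<le> 2 * sqrt z" if "0 \<le> y" "y \<le> z" "0 < z" for y z
  proof -
    have bound: "\<bar>coll_K \<Phi> \<phi> x y z * sqrt x\<bar> \<le> 2 / sqrt z" if "0 \<le> x" for x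
      using that \<open>0 \<le> y\<close> \<open>0 < z\<close> by (intro coll_K_sqrt_bounded \<phi>)
    have int: "set_integrable lborel {0..y + z} (\<lambda>x. coll_K \<Phi> \<phi> x y z * sqrt x)"
      using bound by (intro set_integrable_bounded_Icc[where B = "2 / sqrt z"]) auto
    have "\<bar>LINT x:{0..y + z}|lborel. coll_K \<Phi> \<phi> x y z * sqrt x\<bar> \<le>
        (LINT x:{0..y + z}|lborel. norm (coll_K \<Phi> \<phi> x y z * sqrt x))"
      using set_integral_norm_bound[OF int] by simp
    also have "\<dots> \<le> (LINT x:{0..y + z}|lborel. 2 / sqrt z)"
      using bound by (intro set_integral_mono set_integrable_norm int
          borel_integrable_atLeastAtMost' continuous_intros) auto
    also have "\<dots> = 2 / sqrt z * (y + z)" using that by (simp add: set_lebesgue_integral_def)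
    also have "\<dots> \<le> 2 / sqrt z * (2 * z)" using that by (intro mult_left_mono) auto
    also have "\<dots> = 4 * (z / sqrt z)" by simp
    also have "z / sqrt z = sqrt z" using that by (intro real_div_sqrt) simp
    finally show ?thesis by (simp add: coll_J_def)
  qed
  have sq: "sqrt t \<le> 1 + t" if "t \<ge> 0" for t :: real
    using that by (intro real_le_lsqrt) (auto simp: power2_eq_square algebra_simps)
  have prod: "1 + y + z \<le> (1 + y) * (1 + z)" using assms by (simp add: algebra_simps)
  consider "y = 0" "z = 0" | "y \<le> z" "z > 0" | "z \<le> y" "y > 0" using assms by linarith
  then show ?thesis
  proof cases
    case 1
    have "(LBINT x. indicat_real {0} x * (coll_K \<Phi> \<phi> x 0 0 * sqrt x)) = 0"
      by (rule integral_eq_zero_AE) (simp add: indicator_def)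
    then show ?thesis using 1 by (simp add: coll_J_def set_lebesgue_integral_def)
  next
    case 2
    have "sqrt z \<le> (1 + y) * (1 + z)" using sq[of z] prod assms by linarith
    then show ?thesis using *[of y z] 2 assms by simp
  next
    case 3
    have "sqrt y \<le> (1 + y) * (1 + z)" using sq[of y] prod assms by linarith
    then show ?thesis using *[of z y] 3 assms coll_J_commute[of y z \<phi>] by simp
  qed
qed

text \<open>The tent vanishes at y and z, so nothing is lost, and x in [\<epsilon>/4, \<epsilon>/2]
  suffices. There W \<ge> b0/4, the tent is at least 2^-k and sqrt x \<ge> sqrt \<epsilon> / 2; the
  length \<epsilon>/4 and the prefactor 1/2 complete the constant 1/64 and the power 3/2.\<close>

lemma coll_J_tent_ge:
  assumes "k \<ge> 2" "0 < \<epsilon>" "\<epsilon> \<le> 1" "1 \<le> y" "y \<le> 2" "1 \<le> z" "z \<le> 2"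
  shows "coll_J \<Phi> (tent k \<epsilon>) y z \<ge> b0 / 2 ^ k / 64 * (\<epsilon> * sqrt \<epsilon>)"
proof -
  have *: "coll_J \<Phi> (tent k \<epsilon>) y z \<ge> b0 / 2 ^ k / 64 * (\<epsilon> * sqrt \<epsilon>)" if "1 \<le> y" "y \<le> z" "z \<le> 2" for y z
  proof -
    define C where "C = b0 / 2 ^ k / 8 * sqrt \<epsilon>"
    let ?g = "\<lambda>x. C * indicator {\<epsilon> / 4..\<epsilon> / 2} x :: real"
    note I = set_integral_Icc_indicator[of 0 "\<epsilon> / 4" "\<epsilon> / 2" "y + z" C]
    have "(LINT x:{0..y + z}|lborel. ?g x) \<le> (LINT x:{0..y + z}|lborel. coll_K \<Phi> (tent k \<epsilon>) x y z * sqrt x)"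
    proof (rule set_integral_mono)
      show "set_integrable lborel {0..y + z} (\<lambda>x. coll_K \<Phi> (tent k \<epsilon>) x y z * sqrt x)"
        using that assms by (intro set_integrable_bounded_Icc[where B = "2 / sqrt z"] coll_K_sqrt_bounded)
          (auto simp: tent_le_1)
      fix x assume x: "x \<in> {0..y + z}"
      have zero: "tent k \<epsilon> y = 0" "tent k \<epsilon> z = 0" using assms that by (auto intro!: tent_eq_0)
      have W0: "kernel_W \<Phi> x y z \<ge> 0" using x that by (intro kernel_W_nonneg) auto
      show "?g x \<le> coll_K \<Phi> (tent k \<epsilon>) x y z * sqrt x"
      proof (cases "x \<in> {\<epsilon> / 4..\<epsilon> / 2}")
        case False
        then show ?thesis using W0 x by (simp add: coll_K_def Delta_def zero)
      next
        case True
        have "b0 / 4 \<le> b0 / 2 * min 1 ((2 * y) powr \<eta>) / sqrt (y * z)"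
        proof -
          have "sqrt (y * z) \<le> 2"
            using that mult_mono[of y 2 z 2] by (intro real_le_lsqrt) (auto simp: power2_eq_square)
          moreover have "1 \<le> (2 * y) powr \<eta>" using that \<eta> by (intro ge_one_powr_ge_zero) auto
          ultimately have "b0 / 2 / 2 \<le> b0 / 2 / sqrt (y * z)"
            using b0 that by (intro divide_left_mono) auto
          with \<open>1 \<le> (2 * y) powr \<eta>\<close> show ?thesis by simp
        qed
        also have "\<dots> \<le> kernel_W \<Phi> y x z" using True assms that by (intro kernel_W_lower) auto
        also have "\<dots> \<le> kernel_W \<Phi> x y z" using True assms that by (intro kernel_W_swap_le) auto
        finally have W: "b0 / 4 \<le> kernel_W \<Phi> x y z" .
        have "(1 - (\<epsilon> / 2) / \<epsilon>) ^ k \<le> tent k \<epsilon> x" using True assms by (intro tent_ge) auto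
        then have "1 / 2 ^ k \<le> tent k \<epsilon> x" using assms by (simp add: power_divide)
        then have D: "1 / 2 ^ k \<le> Delta (tent k \<epsilon>) x y z" by (simp add: Delta_def zero add_increasing2)
        have S: "sqrt \<epsilon> / 2 \<le> sqrt x"
          using True assms by (intro real_le_rsqrt) (simp add: power_divide)
        have "0 \<le> Delta (tent k \<epsilon>) x y z" by (rule order_trans[OF _ D]) simp
        then have "b0 / 4 * (1 / 2 ^ k) * (sqrt \<epsilon> / 2) \<le> kernel_W \<Phi> x y z * Delta (tent k \<epsilon>) x y z * sqrt x"
          using W D S b0 W0 assms by (intro mult_mono) auto
        then show ?thesis using True by (simp add: coll_K_def C_def)
      qed
    qed (use I(2) assms that in auto)
    moreover have "(LINT x:{0..y + z}|lborel. ?g x) = C * (\<epsilon> / 4)"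
      using I(1) assms that by simp
    ultimately show ?thesis by (simp add: coll_J_def C_def mult_ac)
  qed
  show ?thesis
  proof (cases "y \<le> z")
    case False
    then show ?thesis using *[of z y] assms coll_J_commute[of y z "tent k \<epsilon>"] by simp
  qed (use * assms in auto)
qed

end

section \<open>Integrals against measures on the half-line\<close>

lemma sets_halfline: "S \<in> sets borel \<Longrightarrow> S \<subseteq> {0..} \<Longrightarrow> S \<in> sets halfline"
  by (auto simp: halfline_def sets_restrict_space Int_absorb1 intro!: image_eqI[of S _ S])

text \<open>A class closed under permutations of the arguments. Measurability on the whole space
  allows composition with coordinate maps; bounds are asked only where the measures live.\<close>

definition bounded3 :: "(real \<Rightarrow> real \<Rightarrow> real \<Rightarrow> real) \<Rightarrow> bool" where
  "bounded3 f \<longleftrightarrow> (\<lambda>(x, y, z). f x y z) \<in> borel_measurable (borel \<Otimes>\<^sub>M (borel \<Otimes>\<^sub>M borel)) \<and>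
     (\<exists>B. \<forall>x\<ge>0. \<forall>y\<ge>0. \<forall>z\<ge>0. \<bar>f x y z\<bar> \<le> B)"

locale halfline_measure =
  fixes M :: "real measure" and N E :: real
  assumes B1: "M \<in> B1_plus" and number: "particle_number M = N" and energy: "energy M = E"
begin

lemma sets_M: "sets M = sets halfline"
  using B1 by (simp add: B1_plus_def)

lemma in_sets_M: "S \<in> sets borel \<Longrightarrow> S \<subseteq> {0..} \<Longrightarrow> S \<in> sets M"
  by (simp add: sets_M sets_halfline)

lemma space_M [simp]: "space M = {0..}"
  using sets_eq_imp_space_eq[OF sets_M] by simp

lemma measurable_M: "f \<in> borel_measurable borel \<Longrightarrow> f \<in> borel_measurable M"
  using measurable_cong_sets[OF sets_M refl] by (auto simp: halfline_def intro: measurable_restrict_space1)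

lemma integrable_id: "integrable M (\<lambda>x. x)" and finite: "finite_measure M"
proof -
  have fin: "(\<integral>\<^sup>+x. ennreal (1 + x) \<partial>M) < \<infinity>" using B1 by (simp add: B1_plus_def)
  have "(\<integral>\<^sup>+x. ennreal (norm x) \<partial>M) \<le> (\<integral>\<^sup>+x. ennreal (1 + x) \<partial>M)"
    by (intro nn_integral_mono) (auto intro!: ennreal_leI)
  then show "integrable M (\<lambda>x. x)"
    using fin by (intro integrableI_bounded measurable_M) auto
  have "emeasure M (space M) = (\<integral>\<^sup>+x. 1 \<partial>M)" by simp
  also have "\<dots> \<le> (\<integral>\<^sup>+x. ennreal (1 + x) \<partial>M)"
    by (intro nn_integral_mono) (auto simp flip: ennreal_1 intro!: ennreal_leI)
  finally show "finite_measure M" using fin by (intro finite_measureI) auto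
qed

sublocale finite_measure M by (rule finite)

sublocale MM: finite_measure "M \<Otimes>\<^sub>M M"
  by (rule finite_measure_pair_measure) (rule finite_measure_axioms)+

sublocale MMM: finite_measure "M \<Otimes>\<^sub>M (M \<Otimes>\<^sub>M M)"
  by (rule finite_measure_pair_measure) (rule finite_measure_axioms MM.finite_measure_axioms)+

sublocale P2: pair_sigma_finite M M
  by (intro pair_sigma_finite.intro) (rule sigma_finite_measure_axioms)+

sublocale P3: pair_sigma_finite M "M \<Otimes>\<^sub>M M"
  by (intro pair_sigma_finite.intro) (rule sigma_finite_measure_axioms MM.sigma_finite_measure_axioms)+

lemma measurable_MM:
  assumes "(\<lambda>(x, y). f x y) \<in> borel_measurable (borel \<Otimes>\<^sub>M borel)"
  shows "(\<lambda>(x, y). f x y) \<in> borel_measurable (M \<Otimes>\<^sub>M M)"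
proof -
  have "(\<lambda>w. (fst w, snd w)) \<in> M \<Otimes>\<^sub>M M \<rightarrow>\<^sub>M borel \<Otimes>\<^sub>M borel"
    by (intro measurable_Pair measurable_compose[OF measurable_fst measurable_M]
        measurable_compose[OF measurable_snd measurable_M]) auto
  from measurable_compose[OF this assms] show ?thesis by (simp add: case_prod_beta)
qed

lemma measurable_MMM:
  assumes "(\<lambda>(x, y, z). f x y z) \<in> borel_measurable (borel \<Otimes>\<^sub>M (borel \<Otimes>\<^sub>M borel))"
  shows "(\<lambda>(x, y, z). f x y z) \<in> borel_measurable (M \<Otimes>\<^sub>M (M \<Otimes>\<^sub>M M))"
proof -
  have "(\<lambda>w. (fst w, fst (snd w), snd (snd w))) \<in> M \<Otimes>\<^sub>M (M \<Otimes>\<^sub>M M) \<rightarrow>\<^sub>M borel \<Otimes>\<^sub>M (borel \<Otimes>\<^sub>M borel)"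
    by (intro measurable_Pair measurable_compose[OF measurable_fst measurable_M]
        measurable_compose[OF measurable_snd measurable_compose[OF measurable_fst measurable_M]]
        measurable_compose[OF measurable_snd measurable_compose[OF measurable_snd measurable_M]]) auto
  from measurable_compose[OF this assms] show ?thesis by (simp add: case_prod_beta)
qed

lemma total_mass: "measure M {0..} = N"
  using number by (simp add: particle_number_def)

lemma integrable_bounded:
  fixes f :: "real \<Rightarrow> real"
  assumes "f \<in> borel_measurable borel" "\<And>x. 0 \<le> x \<Longrightarrow> \<bar>f x\<bar> \<le> B"
  shows "integrable M f"
  using assms by (intro integrable_const_bound[of _ B] measurable_M) auto

text \<open>Cauchy-Schwarz in the guise of a pointwise inequality, which yields integrability at the
  same time.\<close>

lemma integral_sqrt_le:
  assumes "N > 0" "E > 0"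
  shows "integrable M sqrt" "(LINT x|M. sqrt x) \<le> sqrt (N * E)"
proof -
  \<comment> \<open>The weight that equalizes s * E and N / s and thus minimizes their sum.\<close>
  define s where "s = sqrt (N / E)"
  have s: "s > 0" using assms by (simp add: s_def)
  have le: "sqrt x \<le> (s * x + 1 / s) / 2" if "x \<ge> 0" for x
  proof -
    have "0 \<le> (s * sqrt x - 1)\<^sup>2" by simp
    also have "\<dots> = s\<^sup>2 * x - 2 * s * sqrt x + 1" using that by (simp add: power2_diff power_mult_distrib)
    finally have "2 * s * sqrt x \<le> s\<^sup>2 * x + 1" by simp
    then show ?thesis using s by (simp add: field_simps power2_eq_square)
  qed
  have int: "integrable M (\<lambda>x. (s * x + 1 / s) / 2)"
    using integrable_id by simp
  then show 1: "integrable M sqrt"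
    by (rule Bochner_Integration.integrable_bound) (use le in \<open>auto intro!: measurable_M AE_I2 order_trans[OF _ abs_ge_self]\<close>)
  have "(LINT x|M. sqrt x) \<le> (LINT x|M. (s * x + 1 / s) / 2)"
    using le by (intro integral_mono 1 int) auto
  also have "\<dots> = (s * E + N / s) / 2"
    using integrable_id number energy by (simp add: particle_number_def energy_def)
  also have "\<dots> = sqrt (N * E)"
    using assms by (simp add: s_def real_sqrt_mult real_sqrt_divide field_simps)
  finally show "(LINT x|M. sqrt x) \<le> sqrt (N * E)" .
qed

lemma integral_product:
  assumes "integrable M f" "integrable M g"
  shows "integrable (M \<Otimes>\<^sub>M M) (\<lambda>(x, y). f x * g y)"
    and "(LINT (x, y)|(M \<Otimes>\<^sub>M M). f x * g y :: real) = (LINT x|M. f x) * (LINT x|M. g x)"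
proof -
  have [measurable]: "f \<in> borel_measurable M" "g \<in> borel_measurable M" using assms by auto
  show *: "integrable (M \<Otimes>\<^sub>M M) (\<lambda>(x, y). f x * g y)"
    using assms by (intro P2.Fubini_integrable) (auto simp: abs_mult)
  show "(LINT (x, y)|(M \<Otimes>\<^sub>M M). f x * g y) = (LINT x|M. f x) * (LINT x|M. g x)"
    using P2.integral_fst'[OF *] assms by simp
qed

lemma measurable3:
  "bounded3 f \<Longrightarrow> (\<lambda>(x, y, z). f x y z) \<in> borel_measurable (M \<Otimes>\<^sub>M (M \<Otimes>\<^sub>M M))"
  by (intro measurable_MMM) (simp add: bounded3_def)

lemma integrable3:
  assumes "bounded3 f"
  shows "integrable (M \<Otimes>\<^sub>M (M \<Otimes>\<^sub>M M)) (\<lambda>(x, y, z). f x y z)"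
proof -
  from assms obtain B where "\<forall>x\<ge>0. \<forall>y\<ge>0. \<forall>z\<ge>0. \<bar>f x y z\<bar> \<le> B"
    unfolding bounded3_def by blast
  then show ?thesis
    using assms by (intro MMM.integrable_const_bound[of _ B] measurable_MMM AE_I2)
      (auto simp: bounded3_def space_pair_measure)
qed

lemma integral3_swap23:
  assumes "bounded3 f"
  shows "(LINT (x, y, z)|(M \<Otimes>\<^sub>M (M \<Otimes>\<^sub>M M)). f x z y) = (LINT (x, y, z)|(M \<Otimes>\<^sub>M (M \<Otimes>\<^sub>M M)). f x y z)"
    and "bounded3 (\<lambda>x y z. f x z y)"
proof -
  from assms obtain B where B: "\<forall>x\<ge>0. \<forall>y\<ge>0. \<forall>z\<ge>0. \<bar>f x y z\<bar> \<le> B"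
    unfolding bounded3_def by blast
  have "(\<lambda>w. (fst w, snd (snd w), fst (snd w))) \<in> borel \<Otimes>\<^sub>M (borel \<Otimes>\<^sub>M borel) \<rightarrow>\<^sub>M borel \<Otimes>\<^sub>M (borel \<Otimes>\<^sub>M (borel :: real measure))"
    by measurable
  from measurable_compose[OF this, of "\<lambda>(x, y, z). f x y z"] assms
  show b: "bounded3 (\<lambda>x y z. f x z y)"
    using B unfolding bounded3_def by (auto simp: case_prod_beta intro!: exI[of _ B])
  have *: "(LINT w|(M \<Otimes>\<^sub>M M). f x (snd w) (fst w)) = (LINT w|(M \<Otimes>\<^sub>M M). f x (fst w) (snd w))" if "x \<in> space M" for x
  proof -
    have "(\<lambda>w. f x (fst w) (snd w)) \<in> borel_measurable (M \<Otimes>\<^sub>M M)"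
      using measurable_compose[OF measurable_Pair1'[OF that] measurable3[OF assms]]
      by (simp add: case_prod_beta)
    from P2.integral_product_swap[OF this] show ?thesis by (simp add: case_prod_beta')
  qed
  show "(LINT (x, y, z)|(M \<Otimes>\<^sub>M (M \<Otimes>\<^sub>M M)). f x z y) = (LINT (x, y, z)|(M \<Otimes>\<^sub>M (M \<Otimes>\<^sub>M M)). f x y z)"
    unfolding P3.integral_fst'[OF integrable3[OF b], symmetric] P3.integral_fst'[OF integrable3[OF assms], symmetric]
    by (rule Bochner_Integration.integral_cong[OF refl]) (use * in \<open>simp add: case_prod_beta'\<close>)
qed

lemma integral3_iterated:
  assumes "bounded3 f"
  shows "(LINT (x, y, z)|(M \<Otimes>\<^sub>M (M \<Otimes>\<^sub>M M)). f x y z) = (LINT x|M. LINT y|M. LINT z|M. f x y z)"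
proof -
  from assms obtain B where B: "\<forall>x\<ge>0. \<forall>y\<ge>0. \<forall>z\<ge>0. \<bar>f x y z\<bar> \<le> B"
    unfolding bounded3_def by blast
  have *: "(LINT w|(M \<Otimes>\<^sub>M M). f x (fst w) (snd w)) = (LINT y|M. LINT z|M. f x y z)" if "x \<in> space M" for x
  proof -
    have "(\<lambda>w. f x (fst w) (snd w)) \<in> borel_measurable (M \<Otimes>\<^sub>M M)"
      using measurable_compose[OF measurable_Pair1'[OF that] measurable3[OF assms]]
      by (simp add: case_prod_beta)
    then have "integrable (M \<Otimes>\<^sub>M M) (\<lambda>w. f x (fst w) (snd w))"
      using B that by (intro MM.integrable_const_bound[of _ B] AE_I2) (auto simp: space_pair_measure)
    from P2.integral_fst'[OF this] show ?thesis by simp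
  qed
  show ?thesis
    unfolding P3.integral_fst'[OF integrable3[OF assms], symmetric]
    by (rule Bochner_Integration.integral_cong[OF refl]) (use * in \<open>simp add: case_prod_beta'\<close>)
qed

text \<open>With the z-integral innermost this is Fubini for a function of two variables. Together
  with \<open>integral3_swap23\<close> it generates all six permutations.\<close>

lemma integral3_swap12:
  assumes "bounded3 f"
  shows "(LINT (x, y, z)|(M \<Otimes>\<^sub>M (M \<Otimes>\<^sub>M M)). f y x z) = (LINT (x, y, z)|(M \<Otimes>\<^sub>M (M \<Otimes>\<^sub>M M)). f x y z)"
    and "bounded3 (\<lambda>x y z. f y x z)"
proof -
  from assms obtain B where B: "\<forall>x\<ge>0. \<forall>y\<ge>0. \<forall>z\<ge>0. \<bar>f x y z\<bar> \<le> B"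
    unfolding bounded3_def by blast
  have "(\<lambda>w. (fst (snd w), fst w, snd (snd w))) \<in> borel \<Otimes>\<^sub>M (borel \<Otimes>\<^sub>M borel) \<rightarrow>\<^sub>M borel \<Otimes>\<^sub>M (borel \<Otimes>\<^sub>M (borel :: real measure))"
    by measurable
  from measurable_compose[OF this, of "\<lambda>(x, y, z). f x y z"] assms
  show b: "bounded3 (\<lambda>x y z. f y x z)"
    using B unfolding bounded3_def by (auto simp: case_prod_beta intro!: exI[of _ B])
  have [measurable]: "(\<lambda>(x, y, z). f x y z) \<in> borel_measurable (M \<Otimes>\<^sub>M (M \<Otimes>\<^sub>M M))"
    using assms by (intro measurable_MMM) (simp add: bounded3_def)
  have "(\<lambda>w. (fst (fst w), snd (fst w), snd w)) \<in> (M \<Otimes>\<^sub>M M) \<Otimes>\<^sub>M M \<rightarrow>\<^sub>M M \<Otimes>\<^sub>M (M \<Otimes>\<^sub>M M)"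
    by measurable
  from measurable_compose[OF this, of "\<lambda>(x, y, z). f x y z"]
  have "(\<lambda>(p, z). f (fst p) (snd p) z) \<in> borel_measurable ((M \<Otimes>\<^sub>M M) \<Otimes>\<^sub>M M)"
    by (simp add: case_prod_beta)
  from borel_measurable_lebesgue_integral[OF this]
  have meas: "(\<lambda>(x, y). LINT z|M. f x y z) \<in> borel_measurable (M \<Otimes>\<^sub>M M)"
    by (simp add: case_prod_beta)
  have "integrable (M \<Otimes>\<^sub>M M) (\<lambda>(x, y). LINT z|M. f x y z)"
  proof (rule MM.integrable_const_bound[OF AE_I2 meas])
    fix w assume "w \<in> space (M \<Otimes>\<^sub>M M)"
    then have w: "0 \<le> fst w" "0 \<le> snd w" by (auto simp: space_pair_measure)
    have "\<bar>LINT z|M. f (fst w) (snd w) z\<bar> \<le> (LINT z|M. \<bar>f (fst w) (snd w) z\<bar>)"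
      using integral_norm_bound[of M "f (fst w) (snd w)"] by simp
    also have "\<dots> \<le> (LINT z|M. \<bar>B\<bar>)"
      using B w by (intro integral_mono' integrable_const) (auto intro: order_trans[OF _ abs_ge_self])
    finally show "norm (case w of (x, y) \<Rightarrow> LINT z|M. f x y z) \<le> (LINT z|M. \<bar>B\<bar>)"
      by (simp add: case_prod_beta)
  qed
  from P2.Fubini_integral[OF this]
  show "(LINT (x, y, z)|(M \<Otimes>\<^sub>M (M \<Otimes>\<^sub>M M)). f y x z) = (LINT (x, y, z)|(M \<Otimes>\<^sub>M (M \<Otimes>\<^sub>M M)). f x y z)"
    unfolding integral3_iterated[OF b] integral3_iterated[OF assms] by simp
qed

end

section \<open>Lower bounds for the collision integral of a single measure\<close>

locale scattering_measure = scattering b0 \<eta> \<Phi> + halfline_measure M N E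
  for b0 \<eta> :: real and \<Phi> :: "real \<Rightarrow> real \<Rightarrow> real" and M :: "real measure" and N E :: real +
  assumes N_pos: "N > 0" and E_pos: "E > 0"
begin

lemma bounded3_coll_K_tent:
  assumes "k \<ge> 2" "0 < \<epsilon>"
  shows "bounded3 (coll_K \<Phi> (tent k \<epsilon>))"
  unfolding bounded3_def
proof (intro conjI exI[of _ "2 * (k / \<epsilon>)"] allI impI)
  show "(\<lambda>(x, y, z). coll_K \<Phi> (tent k \<epsilon>) x y z) \<in> borel_measurable (borel \<Otimes>\<^sub>M (borel \<Otimes>\<^sub>M borel))"
    unfolding case_prod_beta' by measurable
  fix x y z :: real assume "0 \<le> x" "0 \<le> y" "0 \<le> z"
  then show "\<bar>coll_K \<Phi> (tent k \<epsilon>) x y z\<bar> \<le> 2 * (k / \<epsilon>)"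
    using assms by (intro coll_K_bounded tent_lipschitz) auto
qed

lemma integral_coll_sym:
  assumes "k \<ge> 2" "0 < \<epsilon>"
  shows "integrable (M \<Otimes>\<^sub>M (M \<Otimes>\<^sub>M M)) (\<lambda>(x, y, z). coll_sym (tent k \<epsilon>) x y z)"
    and "(LINT (x, y, z)|(M \<Otimes>\<^sub>M (M \<Otimes>\<^sub>M M)). coll_sym (tent k \<epsilon>) x y z) =
      6 * (LINT (x, y, z)|(M \<Otimes>\<^sub>M (M \<Otimes>\<^sub>M M)). coll_K \<Phi> (tent k \<epsilon>) x y z)"
proof -
  let ?f = "coll_K \<Phi> (tent k \<epsilon>)"
  note b0 = bounded3_coll_K_tent[OF assms]
  note s1 = integral3_swap23[OF b0]
  note s2 = integral3_swap12[OF b0]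
  note s3 = integral3_swap12[OF s1(2)]
  note s4 = integral3_swap23[OF s2(2)]
  note s5 = integral3_swap23[OF s3(2)]
  note i = integrable3[OF b0] integrable3[OF s1(2)] integrable3[OF s2(2)] integrable3[OF s3(2)]
    integrable3[OF s4(2)] integrable3[OF s5(2)]
  have *: "(\<lambda>(x, y, z). coll_sym (tent k \<epsilon>) x y z) = (\<lambda>w.
    (\<lambda>(x, y, z). ?f x y z) w + (\<lambda>(x, y, z). ?f x z y) w + (\<lambda>(x, y, z). ?f y x z) w +
    (\<lambda>(x, y, z). ?f y z x) w + (\<lambda>(x, y, z). ?f z x y) w + (\<lambda>(x, y, z). ?f z y x) w)"
    by (auto simp: coll_sym_def fun_eq_iff)
  show "integrable (M \<Otimes>\<^sub>M (M \<Otimes>\<^sub>M M)) (\<lambda>(x, y, z). coll_sym (tent k \<epsilon>) x y z)"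
    unfolding * by (intro Bochner_Integration.integrable_add i)
  show "(LINT (x, y, z)|(M \<Otimes>\<^sub>M (M \<Otimes>\<^sub>M M)). coll_sym (tent k \<epsilon>) x y z) =
      6 * (LINT (x, y, z)|(M \<Otimes>\<^sub>M (M \<Otimes>\<^sub>M M)). ?f x y z)"
    unfolding *
    apply (subst Bochner_Integration.integral_add, (intro Bochner_Integration.integrable_add i)+)+
    using s1(1) s2(1) s3(1) s4(1) s5(1) by simp
qed

lemma integral_coll_K_tent_nonneg:
  assumes "k \<ge> 2" "0 < \<epsilon>"
  shows "(LINT (x, y, z)|(M \<Otimes>\<^sub>M (M \<Otimes>\<^sub>M M)). coll_K \<Phi> (tent k \<epsilon>) x y z) \<ge> 0"
proof -
  have "0 \<le> (LINT (x, y, z)|(M \<Otimes>\<^sub>M (M \<Otimes>\<^sub>M M)). coll_sym (tent k \<epsilon>) x y z)"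
    using assms by (intro Bochner_Integration.integral_nonneg)
      (auto simp: space_pair_measure intro!: coll_sym_nonneg convex_on_tent)
  then show ?thesis using integral_coll_sym[OF assms] by simp
qed

text \<open>Pigeonhole: n cells of width h cover (a, b], and one of them carries at least the
  average.\<close>

lemma exists_heavy_cell:
  assumes "a \<ge> 0" and h: "h > 0" and n: "n > 0" "b \<le> a + real n * h"
  obtains c where "measure M ({a<..b} \<inter> {c<..c + h}) \<ge> measure M {a<..b} / n"
proof -
  let ?C = "\<lambda>i. {a<..b} \<inter> {a + real i * h<..a + real i * h + h}"
  have sets: "?C i \<in> sets M" for i using \<open>a \<ge> 0\<close> by (intro in_sets_M) auto
  have cover: "{a<..b} \<subseteq> (\<Union>i<n. ?C i)"
  proof
    fix x assume x: "x \<in> {a<..b}"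
    \<comment> \<open>The cells are open on the left, so the index is the ceiling minus one: the
      point a + j h with j \<ge> 1 belongs to cell j - 1.\<close>
    define i where "i = nat (\<lceil>(x - a) / h\<rceil> - 1)"
    have "\<lceil>(x - a) / h\<rceil> > 0" using x h by simp
    then have i: "real i = of_int \<lceil>(x - a) / h\<rceil> - 1" by (simp add: i_def)
    have "real i < (x - a) / h" "(x - a) / h \<le> real i + 1"
      using i by linarith+
    then have ix: "a + real i * h < x" "x \<le> a + real i * h + h"
      using h by (auto simp: pos_less_divide_eq pos_divide_le_eq algebra_simps)
    have "real i * h < real n * h" using ix x n unfolding greaterThanAtMost_iff by linarith
    then have "i < n" using h by (simp only: mult_less_cancel_right_pos of_nat_less_iff)
    with ix x show "x \<in> (\<Union>i<n. ?C i)" by auto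
  qed
  have "\<exists>i<n. measure M (?C i) \<ge> measure M {a<..b} / n"
  proof (rule ccontr)
    assume *: "\<not> (\<exists>i<n. measure M (?C i) \<ge> measure M {a<..b} / n)"
    have "measure M {a<..b} \<le> measure M (\<Union>i<n. ?C i)"
      using cover sets by (intro finite_measure_mono) auto
    also have "\<dots> \<le> (\<Sum>i<n. measure M (?C i))"
      using sets by (intro finite_measure_subadditive_finite) auto
    also have "\<dots> < (\<Sum>i<n. measure M {a<..b} / n)"
      using * n by (intro sum_strict_mono) (auto simp: not_le)
    finally show False using n by simp
  qed
  with that show ?thesis by auto
qed

lemma integral_tent_shift_ge:
  assumes "0 < \<epsilon>" "0 \<le> \<delta>"
  shows "integrable M (\<lambda>x. tent k \<epsilon> (x + \<delta> * \<epsilon>))" "integrable M (tent k \<epsilon>)"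
    and "(LINT x|M. tent k \<epsilon> (x + \<delta> * \<epsilon>)) \<ge> ((LINT x|M. tent k \<epsilon> x) - (2 * \<delta>) ^ k * N) / 2 ^ k"
proof -
  show int: "integrable M (\<lambda>x. tent k \<epsilon> (x + \<delta> * \<epsilon>))" "integrable M (tent k \<epsilon>)"
    using assms by (intro integrable_bounded[of _ 1]; simp add: tent_le_1)+
  have "((LINT x|M. tent k \<epsilon> x) - (2 * \<delta>) ^ k * N) / 2 ^ k = (LINT x|M. (tent k \<epsilon> x - (2 * \<delta>) ^ k) / 2 ^ k)"
    using int total_mass by simp
  also have "\<dots> \<le> (LINT x|M. tent k \<epsilon> (x + \<delta> * \<epsilon>))"
    using int assms by (intro integral_mono tent_shift) auto
  finally show "(LINT x|M. tent k \<epsilon> (x + \<delta> * \<epsilon>)) \<ge> ((LINT x|M. tent k \<epsilon> x) - (2 * \<delta>) ^ k * N) / 2 ^ k" .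
qed

text \<open>
  Particles in \<open>(2\<epsilon>, 4\<epsilon>]\<close> whose energies differ by at most \<open>\<delta>\<epsilon>\<close> scatter into \<open>[0, \<epsilon>]\<close>, stimulated
  by the particles that are already there. Replacing \<open>tent k \<epsilon> x\<close> by its shift costs only a
  factor \<open>2\<^sup>k\<close> and the small term \<open>(2\<delta>)\<^sup>k N\<close>, so the gain is proportional to the mass in \<open>[0, \<epsilon>]\<close>.
\<close>

lemma integral_coll_K_tent_ge:
  assumes "k \<ge> 2" "0 < \<epsilon>" "8 * \<epsilon> \<le> 1" "0 < \<delta>" "n > 0" "2 \<le> real n * \<delta>" "0 \<le> \<mu>"
    and \<mu>: "\<mu> \<le> measure M {2 * \<epsilon><..4 * \<epsilon>}"
  shows "(LINT (x, y, z)|(M \<Otimes>\<^sub>M (M \<Otimes>\<^sub>M M)). coll_K \<Phi> (tent k \<epsilon>) x y z) \<ge>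
    b0 * (4 * \<epsilon>) powr (\<eta> - 1) * (\<mu> / n)\<^sup>2 / 6 * (((LINT x|M. tent k \<epsilon> x) - (2 * \<delta>) ^ k * N) / 2 ^ k)"
proof -
  have "2 * \<epsilon> \<le> real n * \<delta> * \<epsilon>" using assms by (intro mult_right_mono) auto
  then obtain c where c: "measure M {2 * \<epsilon><..4 * \<epsilon>} / n \<le> measure M ({2 * \<epsilon><..4 * \<epsilon>} \<inter> {c<..c + \<delta> * \<epsilon>})"
    using assms exists_heavy_cell[of "2 * \<epsilon>" "\<delta> * \<epsilon>" n "4 * \<epsilon>"] by (auto simp: mult.assoc)
  define A where "A = {2 * \<epsilon><..4 * \<epsilon>} \<inter> {c<..c + \<delta> * \<epsilon>}"
  have [measurable]: "A \<in> sets borel" by (simp add: A_def)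
  have [simp]: "A \<inter> {0..} = A" using assms by (auto simp: A_def)
  have A: "A \<in> sets M" using assms by (intro in_sets_M) (auto simp: A_def)
  define C where "C = b0 * (4 * \<epsilon>) powr (\<eta> - 1)"
  have "C \<ge> 0" using b0 by (simp add: C_def)
  define X where "X = ((LINT x|M. tent k \<epsilon> x) - (2 * \<delta>) ^ k * N) / 2 ^ k"
  define I where "I = (LINT x|M. tent k \<epsilon> (x + \<delta> * \<epsilon>))"
  have "I \<ge> 0" by (simp add: I_def)
  \<comment> \<open>Pairs with both members in the heavy cell A suffice, as the symmetrized form is
    nonnegative elsewhere. The product form of the minorant turns its integral into
    \<open>C * I * (measure M A)\<^sup>2\<close>.\<close>
  let ?g = "\<lambda>x y z. C * tent k \<epsilon> (x + \<delta> * \<epsilon>) * indicator A y * indicator A z :: real"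
  have bg: "bounded3 ?g"
    unfolding bounded3_def
  proof (intro conjI exI[of _ C] allI impI)
    show "(\<lambda>(x, y, z). ?g x y z) \<in> borel_measurable (borel \<Otimes>\<^sub>M (borel \<Otimes>\<^sub>M borel))"
      unfolding case_prod_beta' by measurable
    fix x y z :: real assume "0 \<le> x"
    then have "tent k \<epsilon> (x + \<delta> * \<epsilon>) \<le> 1" using assms by (intro tent_le_1) auto
    then show "\<bar>?g x y z\<bar> \<le> C" using \<open>C \<ge> 0\<close> by (auto simp: abs_mult indicator_def intro!: mult_left_le)
  qed
  have "C * I * (measure M A)\<^sup>2 = (LINT x|M. LINT y|M. LINT z|M. ?g x y z)"
  proof -
    have "(LINT z|M. ?g x y z) = C * tent k \<epsilon> (x + \<delta> * \<epsilon>) * indicator A y * measure M A" for x y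
      using A by simp
    moreover have "(LINT y|M. C * tent k \<epsilon> (x + \<delta> * \<epsilon>) * indicator A y * measure M A) =
      C * tent k \<epsilon> (x + \<delta> * \<epsilon>) * measure M A * measure M A" for x
      using A by simp
    ultimately show ?thesis by (simp add: I_def power2_eq_square)
  qed
  also have "\<dots> = (LINT (x, y, z)|(M \<Otimes>\<^sub>M (M \<Otimes>\<^sub>M M)). ?g x y z)"
    by (rule integral3_iterated[OF bg, symmetric])
  also have "\<dots> \<le> (LINT (x, y, z)|(M \<Otimes>\<^sub>M (M \<Otimes>\<^sub>M M)). coll_sym (tent k \<epsilon>) x y z)"
  proof (rule integral_mono[OF integrable3[OF bg] integral_coll_sym(1)])
    fix w assume "w \<in> space (M \<Otimes>\<^sub>M (M \<Otimes>\<^sub>M M))"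
    then obtain x y z where w: "w = (x, y, z)" "0 \<le> x" "0 \<le> y" "0 \<le> z"
      by (cases w) (auto simp: space_pair_measure)
    have "?g x y z \<le> coll_sym (tent k \<epsilon>) x y z"
    proof (cases "y \<in> A \<and> z \<in> A")
      case True
      then have "\<bar>y - z\<bar> \<le> \<delta> * \<epsilon>" by (auto simp: A_def)
      with True show ?thesis
        using coll_sym_tent_ge[of k \<epsilon> \<delta> x y z] assms w by (simp add: A_def C_def)
    next
      case False
      then show ?thesis using coll_sym_nonneg[OF convex_on_tent[of \<epsilon> k], of x y z] assms w by auto
    qed
    then show "(case w of (x, y, z) \<Rightarrow> ?g x y z) \<le> (case w of (x, y, z) \<Rightarrow> coll_sym (tent k \<epsilon>) x y z)"
      by (simp add: w)
  qed (use assms in auto)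
  finally have "C * I * (measure M A)\<^sup>2 \<le> 6 * (LINT (x, y, z)|(M \<Otimes>\<^sub>M (M \<Otimes>\<^sub>M M)). coll_K \<Phi> (tent k \<epsilon>) x y z)"
    using integral_coll_sym(2)[of k \<epsilon>] assms by simp
  moreover have "C * X * (\<mu> / n)\<^sup>2 \<le> C * I * (measure M A)\<^sup>2"
  proof -
    have "\<mu> / n \<le> measure M {2 * \<epsilon><..4 * \<epsilon>} / n" using \<mu> by (rule divide_right_mono) simp
    then have "\<mu> / n \<le> measure M A" using c by (simp add: A_def)
    then have "(\<mu> / n)\<^sup>2 \<le> (measure M A)\<^sup>2" using assms by (intro power_mono) auto
    moreover have "X \<le> I"
      unfolding I_def X_def using integral_tent_shift_ge(3)[of \<epsilon> \<delta> k] assms by simp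
    ultimately show ?thesis using \<open>C \<ge> 0\<close> \<open>I \<ge> 0\<close>
      by (intro mult_mono mult_left_mono mult_nonneg_nonneg) auto
  qed
  moreover have "C * (\<mu> / n)\<^sup>2 / 6 * X = C * X * (\<mu> / n)\<^sup>2 / 6" by simp
  ultimately show ?thesis unfolding C_def[symmetric] X_def[symmetric] by linarith
qed

text \<open>Loss and gain can be added pointwise because they live on different sets: for y and z in
  [1, 2] the tent, and with it the loss bound, vanishes.\<close>

lemma integral_coll_J_tent_ge:
  assumes "k \<ge> 2" "0 < \<epsilon>" "\<epsilon> \<le> 1"
  shows "(LINT (y, z)|(M \<Otimes>\<^sub>M M). coll_J \<Phi> (tent k \<epsilon>) y z) \<ge>
    - sqrt (N * E) * (LINT x|M. tent k \<epsilon> x) + b0 / 2 ^ k / 64 * (\<epsilon> * sqrt \<epsilon>) * (measure M {1..2})\<^sup>2"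
proof -
  let ?\<phi> = "tent k \<epsilon>"
  define a where "a = b0 / 2 ^ k / 64 * (\<epsilon> * sqrt \<epsilon>)"
  have int\<phi>: "integrable M ?\<phi>" using assms by (intro integral_tent_shift_ge(2)[of \<epsilon> 0]) auto
  note sq = integral_sqrt_le[OF N_pos E_pos]
  have S: "{1..2} \<in> sets M" by (intro in_sets_M) auto
  then have intS: "integrable M (indicator {1..2} :: real \<Rightarrow> real)"
    by (intro integrable_real_indicator) (auto simp: less_top[symmetric])
  have int1: "integrable M (\<lambda>x. 1 + x)" using integrable_id by simp
  have "- sqrt (N * E) * (LINT x|M. ?\<phi> x) + a * (measure M {1..2})\<^sup>2 \<le>
      - ((LINT x|M. ?\<phi> x) * (LINT x|M. sqrt x) + (LINT x|M. sqrt x) * (LINT x|M. ?\<phi> x)) / 2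
      + a * ((LINT x|M. indicator {1..2} x) * (LINT x|M. indicator {1..2} x))"
    using mult_right_mono[OF sq(2), of "LINT x|M. ?\<phi> x"] S by (simp add: power2_eq_square mult_ac)
  also have "\<dots> = (LINT w|(M \<Otimes>\<^sub>M M). - ((\<lambda>(x, y). ?\<phi> x * sqrt y) w + (\<lambda>(x, y). sqrt x * ?\<phi> y) w) / 2
      + a * (\<lambda>(x, y). indicator {1..2} x * indicator {1..2} y) w)"
    using integral_product[OF int\<phi> sq(1)] integral_product[OF sq(1) int\<phi>] integral_product[OF intS intS]
    by simp
  also have "\<dots> \<le> (LINT (y, z)|(M \<Otimes>\<^sub>M M). coll_J \<Phi> ?\<phi> y z)"
  proof (rule integral_mono)
    show "integrable (M \<Otimes>\<^sub>M M) (\<lambda>w. - ((\<lambda>(x, y). ?\<phi> x * sqrt y) w + (\<lambda>(x, y). sqrt x * ?\<phi> y) w) / 2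
      + a * (\<lambda>(x, y). indicator {1..2} x * indicator {1..2} y) w)"
      using integral_product(1)[OF int\<phi> sq(1)] integral_product(1)[OF sq(1) int\<phi>] integral_product(1)[OF intS intS]
      by (intro Bochner_Integration.integrable_add integrable_mult_right Bochner_Integration.integrable_minus
          integrable_divide)
    have "integrable (M \<Otimes>\<^sub>M M) (\<lambda>w. 2 * (\<lambda>(x, y). (1 + x) * (1 + y)) w)"
      by (intro integrable_mult_right integral_product(1) int1)
    then show "integrable (M \<Otimes>\<^sub>M M) (\<lambda>(y, z). coll_J \<Phi> ?\<phi> y z)"
    proof (rule Bochner_Integration.integrable_bound)
      show "(\<lambda>(y, z). coll_J \<Phi> ?\<phi> y z) \<in> borel_measurable (M \<Otimes>\<^sub>M M)"
        by (rule measurable_MM) (unfold case_prod_beta', measurable)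
      show "AE w in M \<Otimes>\<^sub>M M. norm (case w of (y, z) \<Rightarrow> coll_J \<Phi> ?\<phi> y z) \<le> norm (2 * (case w of (x, y) \<Rightarrow> (1 + x) * (1 + y)))"
      proof (rule AE_I2)
        fix w assume "w \<in> space (M \<Otimes>\<^sub>M M)"
        then obtain y z where w: "w = (y, z)" "0 \<le> y" "0 \<le> z" by (cases w) (auto simp: space_pair_measure)
        have "\<bar>coll_J \<Phi> ?\<phi> y z\<bar> \<le> 2 * ((1 + y) * (1 + z))"
          using assms w by (intro coll_J_bounded) (auto simp: tent_le_1)
        then show "norm (case w of (y, z) \<Rightarrow> coll_J \<Phi> ?\<phi> y z) \<le> norm (2 * (case w of (x, y) \<Rightarrow> (1 + x) * (1 + y)))"
          using w by simp
      qed
    qed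
    fix w assume "w \<in> space (M \<Otimes>\<^sub>M M)"
    then obtain y z where w: "w = (y, z)" "0 \<le> y" "0 \<le> z" by (cases w) (auto simp: space_pair_measure)
    have J: "- (?\<phi> y * sqrt z + ?\<phi> z * sqrt y) / 2 \<le> coll_J \<Phi> ?\<phi> y z"
      using assms w by (intro coll_J_ge convex_on_tent tent_antimono) auto
    show "- ((\<lambda>(x, y). ?\<phi> x * sqrt y) w + (\<lambda>(x, y). sqrt x * ?\<phi> y) w) / 2
      + a * (\<lambda>(x, y). indicator {1..2} x * indicator {1..2} y) w \<le> (case w of (y, z) \<Rightarrow> coll_J \<Phi> ?\<phi> y z)"
    proof (cases "y \<in> {1..2} \<and> z \<in> {1..2}")
      case True
      then have "?\<phi> y = 0" "?\<phi> z = 0" using assms by (auto intro!: tent_eq_0)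
      then show ?thesis using True coll_J_tent_ge[of k \<epsilon> y z] assms by (simp add: w a_def)
    next
      case False
      then have "indicator {1..2} y = (0 :: real) \<or> indicator {1..2} z = (0 :: real)" by auto
      then show ?thesis using J by (auto simp: w mult_ac)
    qed
  qed
  finally show ?thesis by (simp add: a_def)
qed

text \<open>The quadratic loss is always paid. The bounds keep, in turn, no gain (persistence of
  mass near 0), the emission from [1, 2] (a first small mass there) and the stimulated gain from the
  shell (exponential growth).\<close>

lemma collision_rhs_ge:
  assumes "k \<ge> 2" "0 < \<epsilon>" "\<epsilon> \<le> 1"
  shows "collision_rhs \<Phi> (tent k \<epsilon>) M \<ge> - sqrt (N * E) * (LINT x|M. tent k \<epsilon> x)"
    and "collision_rhs \<Phi> (tent k \<epsilon>) M \<ge> - sqrt (N * E) * (LINT x|M. tent k \<epsilon> x)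
      + b0 / 2 ^ k / 64 * (\<epsilon> * sqrt \<epsilon>) * (measure M {1..2})\<^sup>2"
    and "8 * \<epsilon> \<le> 1 \<Longrightarrow> 0 < \<delta> \<Longrightarrow> n > 0 \<Longrightarrow> 2 \<le> real n * \<delta> \<Longrightarrow> 0 \<le> \<mu> \<Longrightarrow> \<mu> \<le> measure M {2 * \<epsilon><..4 * \<epsilon>} \<Longrightarrow>
      collision_rhs \<Phi> (tent k \<epsilon>) M \<ge> - sqrt (N * E) * (LINT x|M. tent k \<epsilon> x) +
        b0 * (4 * \<epsilon>) powr (\<eta> - 1) * (\<mu> / n)\<^sup>2 / 6 * (((LINT x|M. tent k \<epsilon> x) - (2 * \<delta>) ^ k * N) / 2 ^ k)"
proof -
  have "0 \<le> b0 / 2 ^ k / 64 * (\<epsilon> * sqrt \<epsilon>) * (measure M {1..2})\<^sup>2" using assms b0 by simp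
  then show "collision_rhs \<Phi> (tent k \<epsilon>) M \<ge> - sqrt (N * E) * (LINT x|M. tent k \<epsilon> x)"
    and "collision_rhs \<Phi> (tent k \<epsilon>) M \<ge> - sqrt (N * E) * (LINT x|M. tent k \<epsilon> x)
      + b0 / 2 ^ k / 64 * (\<epsilon> * sqrt \<epsilon>) * (measure M {1..2})\<^sup>2"
    and "8 * \<epsilon> \<le> 1 \<Longrightarrow> 0 < \<delta> \<Longrightarrow> n > 0 \<Longrightarrow> 2 \<le> real n * \<delta> \<Longrightarrow> 0 \<le> \<mu> \<Longrightarrow> \<mu> \<le> measure M {2 * \<epsilon><..4 * \<epsilon>} \<Longrightarrow>
      collision_rhs \<Phi> (tent k \<epsilon>) M \<ge> - sqrt (N * E) * (LINT x|M. tent k \<epsilon> x) +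
        b0 * (4 * \<epsilon>) powr (\<eta> - 1) * (\<mu> / n)\<^sup>2 / 6 * (((LINT x|M. tent k \<epsilon> x) - (2 * \<delta>) ^ k * N) / 2 ^ k)"
    using integral_coll_J_tent_ge[OF assms] integral_coll_K_tent_nonneg[OF assms(1,2)] integral_coll_K_tent_ge[OF assms(1,2), of \<delta> n \<mu>]
    unfolding collision_rhs_def by linarith+
qed

end

section \<open>Total variation and convergence away from zero\<close>

lemma (in halfline_measure) tendsto_measure_singleton:
  "(\<lambda>n. measure M {0..1 / real (Suc n)}) \<longlonglongrightarrow> measure M {0}"
proof -
  have sets: "{0..1 / real (Suc n)} \<in> sets M" for n
    by (auto intro!: in_sets_M)
  have Int: "(\<Inter>n. {0..1 / real (Suc n)}) = {0}"
  proof (intro equalityI subsetI)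
    fix x assume x: "x \<in> (\<Inter>n. {0..1 / real (Suc n)})"
    then have "x \<ge> 0" by auto
    moreover have "x \<le> 0"
    proof (rule LIMSEQ_le_const[OF LIMSEQ_inverse_real_of_nat])
      show "\<exists>N. \<forall>n\<ge>N. x \<le> inverse (real (Suc n))" using x by (auto simp: inverse_eq_divide)
    qed
    ultimately show "x \<in> {0}" by simp
  qed auto
  have "decseq (\<lambda>n. {0..1 / real (Suc n)})"
    by (intro decseq_SucI) (auto intro: order_trans simp: frac_le)
  with sets show ?thesis
    using finite_Lim_measure_decseq[of "\<lambda>n. {0..1 / real (Suc n)}"] Int by auto
qed

locale two_measures = A: halfline_measure A N E + B: halfline_measure B N E
  for A B :: "real measure" and N E :: real
begin

abbreviation "TV \<equiv> total_variation (signed_diff A B)"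

lemma emeasure_TV:
  "S \<in> sets halfline \<Longrightarrow> emeasure TV S =
    (SUP P\<in>measurable_partitions S. \<Sum>i. ennreal \<bar>signed_diff A B (P i)\<bar>)"
  by (rule emeasure_total_variation_signed_diff) (rule A.finite B.finite A.sets_M B.sets_M | assumption)+

lemma TV_ge:
  assumes "S \<in> sets halfline"
  shows "ennreal \<bar>measure A S - measure B S\<bar> \<le> emeasure TV S"
proof -
  have "binaryset S {} \<in> measurable_partitions S"
    using assms by (auto simp: measurable_partitions_def range_binaryset_eq UN_binaryset_eq
        disjoint_family_on_def binaryset_def)
  then have "(\<Sum>i. ennreal \<bar>signed_diff A B (binaryset S {} i)\<bar>) \<le> emeasure TV S"
    unfolding emeasure_TV[OF assms] by (rule SUP_upper)
  moreover have "(\<Sum>i. ennreal \<bar>signed_diff A B (binaryset S {} i)\<bar>) =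
      ennreal \<bar>signed_diff A B S\<bar> + ennreal \<bar>signed_diff A B {}\<bar>"
    by (rule suminf_binaryset_eq[where f = "\<lambda>S. ennreal \<bar>signed_diff A B S\<bar>"]) (simp add: signed_diff_def)
  ultimately show ?thesis by (simp add: signed_diff_def)
qed

lemma TV_le:
  assumes "S \<in> sets halfline"
  shows "emeasure TV S \<le> ennreal (measure A S + measure B S)"
  unfolding emeasure_TV[OF assms]
proof (rule SUP_least)
  fix P assume "P \<in> measurable_partitions S"
  then have P: "range P \<subseteq> sets halfline" "disjoint_family P" "(\<Union>i. P i) = S"
    by (auto simp: measurable_partitions_def)
  have "\<bar>measure A T - measure B T\<bar> \<le> measure A T + measure B T" for T
    using measure_nonneg[of A T] measure_nonneg[of B T] by linarith
  then have "(\<Sum>i. ennreal \<bar>signed_diff A B (P i)\<bar>) \<le> (\<Sum>i. emeasure A (P i) + emeasure B (P i))"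
    by (intro suminf_le) (auto simp: signed_diff_def A.emeasure_eq_measure B.emeasure_eq_measure
        simp flip: ennreal_plus intro!: ennreal_leI)
  also have "\<dots> = (\<Sum>i. emeasure A (P i)) + (\<Sum>i. emeasure B (P i))"
    by (intro suminf_add[symmetric]) auto
  also have "\<dots> = emeasure A S + emeasure B S"
    using P suminf_emeasure[of P A] suminf_emeasure[of P B] by (simp add: A.sets_M B.sets_M)
  also have "\<dots> = ennreal (measure A S + measure B S)"
    by (simp add: A.emeasure_eq_measure B.emeasure_eq_measure)
  finally show "(\<Sum>i. ennreal \<bar>signed_diff A B (P i)\<bar>) \<le> ennreal (measure A S + measure B S)" .
qed

lemma TV_singleton:
  assumes "{x} \<in> sets halfline"
  shows "emeasure TV {x} \<le> ennreal \<bar>measure A {x} - measure B {x}\<bar>"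
  unfolding emeasure_TV[OF assms]
proof (rule SUP_least)
  fix P assume "P \<in> measurable_partitions {x}"
  then have P: "disjoint_family P" "(\<Union>i. P i) = {x}"
    by (auto simp: measurable_partitions_def)
  \<comment> \<open>Exactly one cell of a partition of {x} is {x} itself; all others are
    empty.\<close>
  have "ennreal \<bar>signed_diff A B (P i)\<bar> = ennreal \<bar>signed_diff A B {x}\<bar> * indicator (P i) x" for i
  proof -
    from P(2) have "P i \<subseteq> {x}" by auto
    then have "P i = {} \<or> P i = {x}" by blast
    then show ?thesis by (auto simp: signed_diff_def)
  qed
  then have "(\<Sum>i. ennreal \<bar>signed_diff A B (P i)\<bar>) = ennreal \<bar>signed_diff A B {x}\<bar> * (\<Sum>i. indicator (P i) x)"
    by simp
  also have "(\<Sum>i. indicator (P i) x :: ennreal) = 1"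
    using suminf_indicator[OF P(1), of x] P(2) by simp
  finally show "(\<Sum>i. ennreal \<bar>signed_diff A B (P i)\<bar>) \<le> ennreal \<bar>measure A {x} - measure B {x}\<bar>"
    by (simp add: signed_diff_def)
qed

text \<open>Chebyshev's inequality. The weight x vanishes at 0, so information is gained for r > 0
  only; convergence of the atom has to come from the dynamics.\<close>

lemma norm1_circ_ge:
  assumes "S \<in> sets halfline" "S \<subseteq> {r..}"
  shows "ennreal r * emeasure TV S \<le> norm1_circ (signed_diff A B)"
proof -
  have "ennreal r * emeasure TV S = (\<integral>\<^sup>+x. ennreal r * indicator S x \<partial>TV)"
    using assms by (simp add: nn_integral_cmult_indicator)
  also have "\<dots> \<le> (\<integral>\<^sup>+x. ennreal x \<partial>TV)"
    using assms by (intro nn_integral_mono) (auto simp: indicator_def intro!: ennreal_leI)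
  finally show ?thesis by (simp add: norm1_circ_def)
qed

text \<open>The weight 1 is split over {0}, (0, R] and (R, \<infinity>): the atoms are compared
  exactly, the middle part is bounded crudely by the sum of both masses, and the tail by Chebyshev's
  inequality.\<close>

lemma norm1_le:
  assumes "R > 0"
  shows "norm1 (signed_diff A B) \<le> ennreal \<bar>measure A {0} - measure B {0}\<bar> +
    ennreal (measure A {0<..R} + measure B {0<..R}) +
    ennreal (1 / R + 1) * norm1_circ (signed_diff A B)"
proof -
  have id: "(\<lambda>x. ennreal x) \<in> borel_measurable TV"
    by (subst measurable_cong_sets[OF sets_total_variation refl])
      (simp add: halfline_def measurable_restrict_space1)
  have s: "{0} \<in> sets halfline" "{0<..R} \<in> sets halfline" "{R<..} \<in> sets halfline" "{0..} \<in> sets halfline"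
    using assms by (auto intro!: sets_halfline)
  have spTV: "space TV = {0..}"
    using sets_eq_imp_space_eq[OF sets_total_variation] by simp
  have "norm1 (signed_diff A B) = (\<integral>\<^sup>+x. 1 + ennreal x \<partial>TV)"
    unfolding norm1_def by (intro nn_integral_cong) (simp add: spTV)
  also have "\<dots> = emeasure TV {0..} + norm1_circ (signed_diff A B)"
    using id by (simp add: nn_integral_add norm1_circ_def spTV)
  also have "emeasure TV {0..} \<le> emeasure TV {0} + emeasure TV {0<..R} + emeasure TV {R<..}"
  proof -
    have "{0..} = {0} \<union> {0<..R} \<union> {R<..}" using assms by auto
    then have "emeasure TV {0..} = emeasure TV ({0} \<union> {0<..R} \<union> {R<..})" by (rule arg_cong)
    also have "\<dots> \<le> emeasure TV ({0} \<union> {0<..R}) + emeasure TV {R<..}"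
      by (intro emeasure_subadditive sets.Un; simp only: sets_total_variation s)
    also have "\<dots> \<le> emeasure TV {0} + emeasure TV {0<..R} + emeasure TV {R<..}"
      by (intro add_right_mono emeasure_subadditive; simp only: sets_total_variation s)
    finally show ?thesis .
  qed
  also have "emeasure TV {R<..} \<le> ennreal (1 / R) * norm1_circ (signed_diff A B)"
  proof -
    have "emeasure TV {R<..} = ennreal (1 / R) * (ennreal R * emeasure TV {R<..})"
      using assms by (simp add: mult.assoc[symmetric] ennreal_mult[symmetric])
    also have "\<dots> \<le> ennreal (1 / R) * norm1_circ (signed_diff A B)"
      using s by (intro mult_left_mono norm1_circ_ge) auto
    finally show ?thesis .
  qed
  also have "emeasure TV {0<..R} \<le> ennreal (measure A {0<..R} + measure B {0<..R})" by (rule TV_le[OF s(2)])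
  also have "emeasure TV {0} \<le> ennreal \<bar>measure A {0} - measure B {0}\<bar>" by (rule TV_singleton[OF s(1)])
  finally show ?thesis
    using assms by (simp add: distrib_right add.assoc)
qed

end

lemma norm1_circ_tendsto_measure:
  assumes F: "\<And>t. t \<ge> 0 \<Longrightarrow> halfline_measure (F t) N E" and G: "halfline_measure G N E"
    and lim: "((\<lambda>t. norm1_circ (signed_diff (F t) G)) \<longlongrightarrow> 0) at_top"
    and S: "S \<in> sets borel" "S \<subseteq> {r..}" "r > 0"
  shows "((\<lambda>t :: real. measure (F t) S) \<longlongrightarrow> measure G S) at_top"
proof -
  have S': "S \<in> sets halfline"
    using S by (auto simp: halfline_def sets_restrict_space Int_absorb1 intro!: image_eqI[of S _ S])
  have "((\<lambda>t. ennreal (r * \<bar>measure (F t) S - measure G S\<bar>)) \<longlongrightarrow> 0) at_top"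
  proof (rule tendsto_sandwich[OF _ _ tendsto_const lim])
    show "\<forall>\<^sub>F t in at_top. ennreal (r * \<bar>measure (F t) S - measure G S\<bar>) \<le> norm1_circ (signed_diff (F t) G)"
      using eventually_ge_at_top[of 0]
    proof eventually_elim
      case (elim t)
      interpret two_measures "F t" G N E using F[OF elim] G by (simp add: two_measures_def)
      have "ennreal (r * \<bar>measure (F t) S - measure G S\<bar>) = ennreal r * ennreal \<bar>measure (F t) S - measure G S\<bar>"
        using S by (simp add: ennreal_mult)
      also have "\<dots> \<le> ennreal r * emeasure TV S" by (intro mult_left_mono TV_ge S') simp
      also have "\<dots> \<le> norm1_circ (signed_diff (F t) G)" by (rule norm1_circ_ge[OF S' S(2)])
      finally show ?case .
    qed
  qed simp
  then have "((\<lambda>t. r * \<bar>measure (F t) S - measure G S\<bar>) \<longlongrightarrow> 0) at_top"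
    using S tendsto_ennreal_iff[of "\<lambda>t. r * \<bar>measure (F t) S - measure G S\<bar>" at_top 0] by simp
  from tendsto_mult_left[OF this, of "1 / r"] S
  have "((\<lambda>t. \<bar>measure (F t) S - measure G S\<bar>) \<longlongrightarrow> 0) at_top" by simp
  then show ?thesis by (simp add: tendsto_rabs_zero_iff LIM_zero_iff)
qed

text \<open>All measures have the same mass N, so convergence on (R, \<infinity>) gives convergence
  on [0, R], although the weight degenerates there.\<close>

lemma norm1_circ_tendsto_measure_Icc:
  assumes F: "\<And>t. t \<ge> 0 \<Longrightarrow> halfline_measure (F t) N E" and G: "halfline_measure G N E"
    and lim: "((\<lambda>t. norm1_circ (signed_diff (F t) G)) \<longlongrightarrow> 0) at_top" and "R > 0"
  shows "((\<lambda>t :: real. measure (F t) {0..R}) \<longlongrightarrow> measure G {0..R}) at_top"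
proof -
  have split: "measure M {0..R} = N - measure M {R<..}" if "halfline_measure M N E" for M
  proof -
    interpret halfline_measure M N E by fact
    have "{R<..} \<in> sets M" using \<open>R > 0\<close>
      by (auto intro!: in_sets_M)
    moreover have "{0..} - {R<..} = {0..R}" by auto
    ultimately show ?thesis using finite_measure_compl[of "{R<..}"] total_mass by simp
  qed
  have "((\<lambda>t. N - measure (F t) {R<..}) \<longlongrightarrow> N - measure G {R<..}) at_top"
    using \<open>R > 0\<close> by (intro tendsto_intros norm1_circ_tendsto_measure[OF F G lim, where r = R]) auto
  then show ?thesis
    unfolding split[OF G]
    by (rule Lim_transform_eventually)
      (use eventually_ge_at_top[of 0] in \<open>eventually_elim, simp add: split[OF F]\<close>)
qed

text \<open>Once the atoms converge, so does the mass of (0, R]. The bound of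
  \<open>norm1_le\<close> then tends to twice the mass of (0, R] under G, which is small for small
  R.\<close>

lemma norm1_tendsto_0:
  assumes F: "\<And>t. t \<ge> 0 \<Longrightarrow> halfline_measure (F t) N E" and G: "halfline_measure G N E"
    and lim: "((\<lambda>t. norm1_circ (signed_diff (F t) G)) \<longlongrightarrow> 0) at_top"
    and atom: "((\<lambda>t. measure (F t) {0}) \<longlongrightarrow> measure G {0}) at_top"
  shows "((\<lambda>t :: real. norm1 (signed_diff (F t) G)) \<longlongrightarrow> 0) at_top"
proof (rule order_tendstoI)
  interpret G: halfline_measure G N E by (rule G)
  have Ioc: "measure M {0<..R} = measure M {0..R} - measure M {0}" if "halfline_measure M N E" "R > 0" for M R
  proof -
    interpret halfline_measure M N E by fact
    have "{0..R} \<in> sets M" "{0} \<in> sets M"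
      by (auto intro!: in_sets_M)
    moreover have "{0..R} - {0} = {0<..R}" by auto
    ultimately show ?thesis using finite_measure_Diff[of "{0..R}" "{0}"] \<open>R > 0\<close> by simp
  qed
  fix e :: ennreal assume "0 < e"
  \<comment> \<open>e may be infinite; the argument needs a positive real number below it.\<close>
  then obtain d where d: "0 < d" "d < e" using dense by blast
  then obtain e' where "d = ennreal e'" "0 \<le> e'" by (cases d) auto
  with d have e': "0 < e'" "ennreal e' < e" by auto
  have "\<forall>\<^sub>F n in sequentially. measure G {0..1 / real (Suc n)} < measure G {0} + e' / 2"
    using e' by (intro order_tendstoD(2)[OF G.tendsto_measure_singleton]) simp
  then obtain n where n: "measure G {0..1 / real (Suc n)} < measure G {0} + e' / 2"
    by (auto simp: eventually_sequentially)
  define R where "R = 1 / real (Suc n)"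
  have R: "R > 0" "measure G {0<..R} < e' / 2" using n Ioc[OF G, of R] by (auto simp: R_def)
  let ?U = "\<lambda>t. ennreal \<bar>measure (F t) {0} - measure G {0}\<bar> +
    ennreal ((measure (F t) {0..R} - measure (F t) {0}) + measure G {0<..R}) +
    ennreal (1 / R + 1) * norm1_circ (signed_diff (F t) G)"
  have "(?U \<longlongrightarrow> ennreal \<bar>measure G {0} - measure G {0}\<bar> +
    ennreal ((measure G {0..R} - measure G {0}) + measure G {0<..R}) + ennreal (1 / R + 1) * 0) at_top"
    by (intro tendsto_intros tendsto_ennrealI ennreal_tendsto_cmult atom lim
        norm1_circ_tendsto_measure_Icc[OF F G lim R(1)]) auto
  also have "ennreal \<bar>measure G {0} - measure G {0}\<bar> +
    ennreal ((measure G {0..R} - measure G {0}) + measure G {0<..R}) + ennreal (1 / R + 1) * 0 =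
    ennreal (2 * measure G {0<..R})"
    using Ioc[OF G R(1)] by simp
  finally have "(?U \<longlongrightarrow> ennreal (2 * measure G {0<..R})) at_top" .
  moreover have "ennreal (2 * measure G {0<..R}) < ennreal e'" using R e' by (intro ennreal_lessI) auto
  ultimately have "\<forall>\<^sub>F t in at_top. ?U t < ennreal e'" by (rule order_tendstoD(2))
  then show "\<forall>\<^sub>F t in at_top. norm1 (signed_diff (F t) G) < e"
    using eventually_ge_at_top[of 0]
  proof eventually_elim
    case (elim t)
    interpret two_measures "F t" G N E using F[OF elim(2)] G by (simp add: two_measures_def)
    have "norm1 (signed_diff (F t) G) \<le> ?U t"
      using norm1_le[OF R(1)] Ioc[OF F[OF elim(2)] R(1)] by simp
    with elim(1) e' show ?case by (meson le_less_trans less_trans)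
  qed
qed simp

section \<open>The Bose--Einstein equilibrium\<close>

lemma zeta_real_nonneg: "s > 1 \<Longrightarrow> 0 \<le> zeta_real s"
proof -
  assume "s > 1"
  then have "summable (\<lambda>n. 1 / real (Suc n) powr s)"
    using summable_Suc_iff[of "\<lambda>n. real n powr (- s)"] summable_real_powr_iff[of "- s"]
    by (simp only: powr_minus_divide)
  then show ?thesis unfolding zeta_real_def by (intro suminf_nonneg) auto
qed

lemma condensate_mass_pos:
  assumes "N > 0" "E > 0" "temperature_ratio N E < 1"
  shows "condensate_mass N E > 0"
proof -
  have "0 \<le> temperature_ratio N E"
    unfolding temperature_ratio_def using assms zeta_real_nonneg[of "5/2"] by simp
  then have "temperature_ratio N E powr (3/5) < 1"
    using assms powr_less_mono2[of "3/5" "temperature_ratio N E" 1] by simp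
  then show ?thesis using assms by (simp add: condensate_mass_def)
qed

text \<open>The density part does not charge {0}, so the atom is the point mass alone. Positivity on
  [1, 2] supplies the particles whose collisions create the first mass near 0.\<close>

lemma
  assumes be: "bose_einstein_equilibrium N E G"
  shows bose_einstein_halfline: "halfline_measure G N E"
    and bose_einstein_atom: "0 \<le> condensate_mass N E \<Longrightarrow> measure G {0} = condensate_mass N E"
    and bose_einstein_bath: "measure G {1..2} > 0"
proof -
  show hm: "halfline_measure G N E" using be by (simp add: bose_einstein_equilibrium_def halfline_measure_def)
  interpret halfline_measure G N E by (rule hm)
  from be obtain A \<kappa> where A: "A \<ge> 1" "\<kappa> > 0"
    and G: "\<And>B. B \<in> sets halfline \<Longrightarrow> emeasure G B =
           (\<integral>\<^sup>+x\<in>B. ennreal (1 / (A * exp (x / \<kappa>) - 1) * sqrt x) \<partial>lborel) +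
           ennreal (condensate_mass N E) * indicator B 0"
    by (auto simp: bose_einstein_equilibrium_def)
  have s: "{0} \<in> sets halfline" "{1..2} \<in> sets halfline"
    by (auto intro!: sets_halfline)
  \<comment> \<open>At 0 the factor sqrt x is 0, also for A = 1, where the other factor is 1/0 =
    0.\<close>
  have "(\<integral>\<^sup>+x\<in>{0}. ennreal (1 / (A * exp (x / \<kappa>) - 1) * sqrt x) \<partial>lborel) = (\<integral>\<^sup>+x. 0 \<partial>(lborel :: real measure))"
    by (intro nn_integral_cong) (auto simp: indicator_def)
  then have "emeasure G {0} = ennreal (condensate_mass N E)"
    using G[OF s(1)] by simp
  then show "0 \<le> condensate_mass N E \<Longrightarrow> measure G {0} = condensate_mass N E"
    by (simp add: measure_def)
  \<comment> \<open>The first factor of the density decreases, so its value at 2 bounds it below on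
    [1, 2].\<close>
  define c where "c = 1 / (A * exp (2 / \<kappa>) - 1)"
  have pos: "A * exp (x / \<kappa>) - 1 > 0" if "x > 0" for x
  proof -
    have "1 < exp (x / \<kappa>)" using that A by simp
    also have "\<dots> \<le> A * exp (x / \<kappa>)" using A by simp
    finally show ?thesis by simp
  qed
  have "c > 0" unfolding c_def using pos[of 2] by simp
  have "0 < ennreal c" using \<open>c > 0\<close> by simp
  also have "ennreal c = (\<integral>\<^sup>+x. ennreal c * indicator {1..2} x \<partial>(lborel :: real measure))"
    by (simp add: nn_integral_cmult_indicator)
  also have "\<dots> \<le> (\<integral>\<^sup>+x\<in>{1..2}. ennreal (1 / (A * exp (x / \<kappa>) - 1) * sqrt x) \<partial>lborel)"
  proof (intro nn_integral_mono)
    fix x :: real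
    have "c \<le> 1 / (A * exp (x / \<kappa>) - 1) * sqrt x" if "x \<in> {1..2}"
    proof -
      have "A * exp (x / \<kappa>) \<le> A * exp (2 / \<kappa>)" using that A by (simp add: divide_right_mono)
      then have "c \<le> 1 / (A * exp (x / \<kappa>) - 1)"
        unfolding c_def using pos[of x] pos[of 2] that by (intro divide_left_mono) auto
      also have "\<dots> \<le> 1 / (A * exp (x / \<kappa>) - 1) * sqrt x"
        using pos[of x] that by (simp add: divide_right_mono)
      finally show ?thesis .
    qed
    then show "ennreal c * indicator {1..2} x \<le> ennreal (1 / (A * exp (x / \<kappa>) - 1) * sqrt x) * indicator {1..2} x"
      by (auto simp: indicator_def intro!: ennreal_leI)
  qed
  also have "\<dots> = emeasure G {1..2}" using G[OF s(2)] by simp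
  finally show "measure G {1..2} > 0" by (simp add: emeasure_eq_measure)
qed

section \<open>Evolution of the mass near zero\<close>

text \<open>
  If every time were bad for some \<open>i\<close>, then \<open>\<Sum>i. w i * ln (f i)\<close> would grow at least at rate \<open>1 / 2\<close>.
\<close>

lemma exists_good_time:
  fixes f f' :: "'i \<Rightarrow> real \<Rightarrow> real"
  assumes I: "finite I" and st: "s < t" and "C \<ge> 0"
    and deriv: "\<And>i x. i \<in> I \<Longrightarrow> x \<in> {s..t} \<Longrightarrow> (f i has_real_derivative f' i x) (at x within {s..t})"
    and f': "\<And>i x. i \<in> I \<Longrightarrow> x \<in> {s..t} \<Longrightarrow> f' i x \<ge> - C * f i x"
    and bad: "\<And>i x. i \<in> I \<Longrightarrow> x \<in> {s..t} \<Longrightarrow> bad i x \<Longrightarrow> f' i x \<ge> - C * f i x + f i x / w i"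
    and f: "\<And>i x. i \<in> I \<Longrightarrow> x \<in> {s..t} \<Longrightarrow> 0 < c i \<and> c i \<le> f i x \<and> f i x \<le> N"
    and w: "\<And>i. i \<in> I \<Longrightarrow> w i > 0" "C * (\<Sum>i\<in>I. w i) \<le> 1 / 2"
    and small: "(\<Sum>i\<in>I. w i * ln (N / c i)) < (t - s) / 2"
  shows "\<exists>x\<in>{s..t}. \<forall>i\<in>I. \<not> bad i x"
proof (rule ccontr)
  assume contr: "\<not> (\<exists>x\<in>{s..t}. \<forall>i\<in>I. \<not> bad i x)"
  let ?\<psi> = "\<lambda>x. \<Sum>i\<in>I. w i * ln (f i x)"
  have "(?\<psi> has_derivative (\<lambda>h. (\<Sum>i\<in>I. w i * (f' i x / f i x)) * h)) (at x within {s..t})" if "x \<in> {s..t}" for x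
  proof -
    have "(?\<psi> has_real_derivative (\<Sum>i\<in>I. w i * (f' i x / f i x))) (at x within {s..t})"
    proof (rule DERIV_sum)
      fix i assume i: "i \<in> I"
      have "0 < f i x" using f[OF i that] by linarith
      have "((\<lambda>x. ln (f i x)) has_real_derivative inverse (f i x) * f' i x) (at x within {s..t})"
        using DERIV_chain2[OF DERIV_ln[OF \<open>0 < f i x\<close>] deriv[OF i that]] .
      from DERIV_cmult[OF this, of "w i"]
      show "((\<lambda>x. w i * ln (f i x)) has_real_derivative w i * (f' i x / f i x)) (at x within {s..t})"
        by (simp add: divide_inverse mult_ac)
    qed
    then show ?thesis by (simp add: has_field_derivative_def)
  qed
  \<comment> \<open>The mean value theorem picks a single time, so one bad index at that time is
    enough and no measurability of the bad times enters.\<close>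
  from mvt_simple[OF st this] obtain x where x: "x \<in> {s<..<t}"
    and eq: "?\<psi> t - ?\<psi> s = (\<Sum>i\<in>I. w i * (f' i x / f i x)) * (t - s)" by auto
  then have xs: "x \<in> {s..t}" by auto
  with contr obtain j where j: "j \<in> I" "bad j x" by blast
  have pos: "0 < f i x" if "i \<in> I" for i using f[OF that xs] by linarith
  \<comment> \<open>The bad index contributes w j / w j = 1 on top of the loss; all indices together
    lose at most C times the sum of the weights, that is, at most 1/2.\<close>
  have ge: "w i * (f' i x / f i x) \<ge> - C * w i + (if i = j then 1 else 0)" if i: "i \<in> I" for i
  proof (cases "i = j")
    case True
    have "f' j x / f j x \<ge> (- C * f j x + f j x / w j) / f j x"
      using bad[OF j(1) xs j(2)] pos[OF j(1)] by (intro divide_right_mono) auto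
    also have "(- C * f j x + f j x / w j) / f j x = - C + 1 / w j"
      using pos[OF j(1)] by (simp add: field_simps)
    finally have "w j * (f' j x / f j x) \<ge> w j * (- C + 1 / w j)"
      using w(1)[OF j(1)] by (intro mult_left_mono) auto
    also have "w j * (- C + 1 / w j) = - C * w j + 1" using w(1)[OF j(1)] by (simp add: field_simps)
    finally show ?thesis using True by simp
  next
    case False
    have "f' i x / f i x \<ge> - C * f i x / f i x"
      using f'[OF i xs] pos[OF i] by (intro divide_right_mono) auto
    also have "- C * f i x / f i x = - C" using pos[OF i] by simp
    finally have "w i * (f' i x / f i x) \<ge> w i * - C"
      using w(1)[OF i] by (intro mult_left_mono) auto
    then show ?thesis using False by (simp add: mult_ac)
  qed
  have "(\<Sum>i\<in>I. w i * (f' i x / f i x)) \<ge> (\<Sum>i\<in>I. - C * w i + (if i = j then 1 else 0))"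
    by (intro sum_mono ge)
  also have "(\<Sum>i\<in>I. - C * w i + (if i = j then 1 else 0)) = 1 - C * (\<Sum>i\<in>I. w i)"
    using I j by (simp add: sum_subtractf sum_distrib_left)
  finally have "1 / 2 \<le> (\<Sum>i\<in>I. w i * (f' i x / f i x))" using w(2) by linarith
  then have "1 / 2 * (t - s) \<le> ?\<psi> t - ?\<psi> s" unfolding eq using st by (intro mult_right_mono) auto
  \<comment> \<open>Each ln (f i) stays between ln (c i) and ln N, which caps the growth of the
    weighted sum.\<close>
  moreover have "?\<psi> t - ?\<psi> s \<le> (\<Sum>i\<in>I. w i * ln (N / c i))"
  proof -
    have "w i * ln (f i t) - w i * ln (f i s) \<le> w i * ln (N / c i)" if i: "i \<in> I" for i
    proof -
      have "0 < c i" "c i \<le> f i s" "c i \<le> f i t" "f i t \<le> N" using f[OF i, of s] f[OF i, of t] st by auto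
      then have "ln (f i t) - ln (f i s) \<le> ln N - ln (c i)"
        by (intro diff_mono) auto
      also have "\<dots> = ln (N / c i)" using \<open>0 < c i\<close> \<open>c i \<le> f i t\<close> \<open>f i t \<le> N\<close> by (simp add: ln_div)
      finally show ?thesis using w(1)[OF i] by (simp add: right_diff_distrib[symmetric])
    qed
    then show ?thesis unfolding sum_subtractf[symmetric] by (intro sum_mono)
  qed
  ultimately show False using small by simp
qed

lemma sum_geometric_powr_le:
  fixes R p :: real
  assumes "R > 0" "p > 0"
  shows "(\<Sum>j<J. (R / 2 ^ j) powr p) \<le> R powr p / (1 - 2 powr - p)"
proof -
  define q :: real where "q = 2 powr - p"
  have q: "0 < q" "q < 1" using assms by (auto simp: q_def powr_less_one)
  have "(R / 2 ^ j) powr p = R powr p * q ^ j" for j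
    using assms by (simp add: q_def powr_divide powr_power powr_minus_divide powr_powr mult.commute
        flip: powr_realpow)
  then have "(\<Sum>j<J. (R / 2 ^ j) powr p) = R powr p * (\<Sum>j<J. q ^ j)"
    by (simp add: sum_distrib_left)
  also have "(\<Sum>j<J. q ^ j) \<le> 1 / (1 - q)"
    using q by (simp add: sum_gp_strict divide_right_mono)
  then have "R powr p * (\<Sum>j<J. q ^ j) \<le> R powr p * (1 / (1 - q))" by (rule mult_left_mono) simp
  finally show ?thesis by (simp add: q_def)
qed

lemma tendsto_powr_at_right_0:
  fixes X p :: real
  assumes "p > 0"
  shows "((\<lambda>R. X * R powr p) \<longlongrightarrow> 0) (at_right 0)"
proof -
  have "((\<lambda>R. R powr p) \<longlongrightarrow> 0) (at_right (0::real))"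
    using assms by (intro tendsto_zero_powrI[OF _ tendsto_const])
      (auto intro: tendsto_ident_at eventually_at_rightI[of 0 1])
  then show ?thesis by (rule tendsto_mult_right_zero)
qed

section \<open>Differential inequalities along a solution\<close>

locale bose_solution = scattering b0 \<eta> \<Phi> for b0 \<eta> :: real and \<Phi> :: "real \<Rightarrow> real \<Rightarrow> real" +
  fixes N E :: real and F :: "real \<Rightarrow> real measure"
  assumes N_pos: "N > 0" and E_pos: "E > 0" and solution: "conservative_solution \<Phi> N E F"
begin

definition C :: real where "C = sqrt (N * E)"

lemma C_pos: "C > 0" using N_pos E_pos by (simp add: C_def)

lemma halfline: "t \<ge> 0 \<Longrightarrow> halfline_measure (F t) N E"
  using solution by (simp add: conservative_solution_def halfline_measure_def)

lemma scattering_measure: "t \<ge> 0 \<Longrightarrow> scattering_measure b0 \<eta> \<Phi> (F t) N E"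
  using halfline N_pos E_pos scattering_axioms
  by (simp add: scattering_measure_def scattering_measure_axioms_def)

definition m :: "nat \<Rightarrow> real \<Rightarrow> real \<Rightarrow> real" where
  "m k \<epsilon> t = (LINT x|F t. tent k \<epsilon> x)"

lemma m_deriv:
  assumes "k \<ge> 3" "\<epsilon> > 0" "t \<ge> 0" "S \<subseteq> {0..}"
  shows "(m k \<epsilon> has_real_derivative collision_rhs \<Phi> (tent k \<epsilon>) (F t)) (at t within S)"
proof -
  have "(m k \<epsilon> has_real_derivative collision_rhs \<Phi> (tent k \<epsilon>) (F t)) (at t within {0..})"
    using solution tent_in_Cb2[OF assms(2,1)] assms(3)
    unfolding conservative_solution_def m_def[abs_def] by blast
  then show ?thesis using assms(4) by (rule DERIV_subset)
qed

lemma m_bounds: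
  assumes "t \<ge> 0" "\<epsilon> > 0"
  shows "0 \<le> m k \<epsilon> t" "m k \<epsilon> t \<le> N" "measure (F t) {0} \<le> m k \<epsilon> t"
    and "0 \<le> r \<Longrightarrow> r \<le> \<epsilon> \<Longrightarrow> (1 - r / \<epsilon>) ^ k * measure (F t) {0..r} \<le> m k \<epsilon> t"
    and "k > 0 \<Longrightarrow> m k \<epsilon> t \<le> measure (F t) {0..\<epsilon>}"
proof -
  interpret scattering_measure b0 \<eta> \<Phi> "F t" N E by (rule scattering_measure) fact
  have int: "integrable (F t) (tent k \<epsilon>)"
    using assms by (intro integral_tent_shift_ge(2)[of \<epsilon> 0]) auto
  show "0 \<le> m k \<epsilon> t" by (simp add: m_def)
  have "m k \<epsilon> t \<le> (LINT x|F t. 1)"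
    unfolding m_def using assms by (intro integral_mono int) (auto simp: tent_le_1)
  then show "m k \<epsilon> t \<le> N" using total_mass by simp
  have sets: "{0..r} \<in> sets (F t)" for r by (intro in_sets_M) auto
  have ge: "(1 - r / \<epsilon>) ^ k * measure (F t) {0..r} \<le> m k \<epsilon> t" if "0 \<le> r" "r \<le> \<epsilon>" for r
  proof -
    have [simp]: "{0..r} \<inter> {0..} = {0..r}" by auto
    have "(1 - r / \<epsilon>) ^ k * measure (F t) {0..r} = (LINT x|F t. (1 - r / \<epsilon>) ^ k * indicator {0..r} x)"
      using sets by simp
    also have "\<dots> \<le> m k \<epsilon> t"
      unfolding m_def
    proof (rule integral_mono[OF _ int])
      show "integrable (F t) (\<lambda>x. (1 - r / \<epsilon>) ^ k * indicator {0..r} x)"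
        using sets by (intro integrable_mult_right integrable_real_indicator) (auto simp: less_top[symmetric])
      show "(1 - r / \<epsilon>) ^ k * indicator {0..r} x \<le> tent k \<epsilon> x" for x
        using tent_ge[of \<epsilon> x r k] that assms by (auto simp: indicator_def)
    qed
    finally show ?thesis .
  qed
  show "0 \<le> r \<Longrightarrow> r \<le> \<epsilon> \<Longrightarrow> (1 - r / \<epsilon>) ^ k * measure (F t) {0..r} \<le> m k \<epsilon> t" by (rule ge)
  show "measure (F t) {0} \<le> m k \<epsilon> t" using ge[of 0] assms by simp
  assume "k > 0"
  have [simp]: "{0..\<epsilon>} \<inter> {0..} = {0..\<epsilon>}" by auto
  have "m k \<epsilon> t \<le> (LINT x|F t. indicator {0..\<epsilon>} x)"
    unfolding m_def
  proof (rule integral_mono[OF int])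
    show "integrable (F t) (indicator {0..\<epsilon>} :: real \<Rightarrow> real)"
      using sets by (intro integrable_real_indicator) (auto simp: less_top[symmetric])
    show "tent k \<epsilon> x \<le> indicator {0..\<epsilon>} x" if "x \<in> space (F t)" for x
      using that assms \<open>k > 0\<close> tent_eq_0[of \<epsilon> k x] by (auto simp: indicator_def tent_le_1)
  qed
  then show "m k \<epsilon> t \<le> measure (F t) {0..\<epsilon>}" using sets by simp
qed

text \<open>Gronwall's inequality with integrating factor exp (C * t): between s and t the
  derivative of the product is at least exp (C * s) * a, and the mean value theorem
  concludes.\<close>

lemma m_growth:
  assumes "k \<ge> 3" "0 < \<epsilon>" "0 \<le> s" "s < t" "a \<ge> 0"
    and rhs: "\<And>\<tau>. s < \<tau> \<Longrightarrow> \<tau> < t \<Longrightarrow> collision_rhs \<Phi> (tent k \<epsilon>) (F \<tau>) \<ge> - C * m k \<epsilon> \<tau> + a"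
  shows "m k \<epsilon> t \<ge> exp (- C * (t - s)) * (m k \<epsilon> s + (t - s) * a)"
proof -
  let ?g = "\<lambda>t. exp (C * t) * m k \<epsilon> t"
  let ?g' = "\<lambda>\<tau>. exp (C * \<tau>) * (C * m k \<epsilon> \<tau> + collision_rhs \<Phi> (tent k \<epsilon>) (F \<tau>))"
  have "(?g has_derivative (\<lambda>h. ?g' \<tau> * h)) (at \<tau> within {s..t})" if "s \<le> \<tau>" "\<tau> \<le> t" for \<tau>
  proof -
    have "((\<lambda>t. exp (C * t)) has_real_derivative exp (C * \<tau>) * C) (at \<tau> within {s..t})"
      by (auto intro!: derivative_eq_intros)
    from DERIV_mult[OF this m_deriv[of k \<epsilon> \<tau> "{s..t}"]] assms that
    have "(?g has_real_derivative ?g' \<tau>) (at \<tau> within {s..t})" by (auto simp: algebra_simps)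
    then show ?thesis by (simp add: has_field_derivative_def)
  qed
  from mvt_simple[OF \<open>s < t\<close> this] obtain \<tau> where \<tau>: "\<tau> \<in> {s<..<t}" "?g t - ?g s = ?g' \<tau> * (t - s)" by auto
  have "exp (C * s) * a \<le> ?g' \<tau>"
    using rhs[of \<tau>] \<tau> C_pos \<open>a \<ge> 0\<close> by (intro mult_mono) auto
  then have "exp (C * s) * a * (t - s) \<le> ?g t - ?g s"
    unfolding \<tau>(2) using \<open>s < t\<close> by (intro mult_right_mono) auto
  then have "exp (- C * t) * (exp (C * s) * (m k \<epsilon> s + (t - s) * a)) \<le> exp (- C * t) * ?g t"
    by (intro mult_left_mono) (auto simp: algebra_simps)
  also have "exp (- C * t) * ?g t = m k \<epsilon> t" by (simp add: exp_minus)
  also have "exp (- C * t) * (exp (C * s) * (m k \<epsilon> s + (t - s) * a)) = exp (- C * (t - s)) * (m k \<epsilon> s + (t - s) * a)"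
    by (simp add: algebra_simps exp_diff exp_minus divide_inverse)
  finally show ?thesis .
qed

lemma m_persists:
  assumes "k \<ge> 3" "0 < \<epsilon>" "\<epsilon> \<le> 1" "0 \<le> s" "s \<le> t"
  shows "m k \<epsilon> t \<ge> exp (- C * (t - s)) * m k \<epsilon> s"
proof (cases "s = t")
  case False
  have "m k \<epsilon> t \<ge> exp (- C * (t - s)) * (m k \<epsilon> s + (t - s) * 0)"
  proof (rule m_growth)
    fix \<tau> assume \<tau>: "s < \<tau>"
    then interpret scattering_measure b0 \<eta> \<Phi> "F \<tau>" N E using assms by (intro scattering_measure) auto
    show "collision_rhs \<Phi> (tent k \<epsilon>) (F \<tau>) \<ge> - C * m k \<epsilon> \<tau> + 0"
      using collision_rhs_ge(1)[of k \<epsilon>] assms by (simp add: m_def C_def)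
  qed (use assms False in auto)
  then show ?thesis by simp
qed simp

text \<open>m 3 \<epsilon> is at most the mass of [0, \<epsilon>], which decreases to the atom as
  \<epsilon> tends to 0. Exponent 3 already makes the tent an admissible test function.\<close>

lemma atom_ge:
  assumes "t \<ge> 0" and "\<And>\<epsilon>. 0 < \<epsilon> \<Longrightarrow> \<epsilon> \<le> 1 \<Longrightarrow> m 3 \<epsilon> t \<ge> L"
  shows "measure (F t) {0} \<ge> L"
proof -
  interpret halfline_measure "F t" N E using assms by (intro halfline)
  have "L \<le> measure (F t) {0..1 / real (Suc n)}" for n
    using assms(2)[of "1 / real (Suc n)"] m_bounds(5)[of t "1 / real (Suc n)" 3] assms(1) by simp
  then show ?thesis
    by (intro LIMSEQ_le_const[OF tendsto_measure_singleton]) auto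
qed

lemma atom_persists:
  assumes "0 \<le> s" "s \<le> t"
  shows "measure (F t) {0} \<ge> exp (- C * (t - s)) * measure (F s) {0}"
proof (rule atom_ge)
  fix \<epsilon> :: real assume \<epsilon>: "0 < \<epsilon>" "\<epsilon> \<le> 1"
  have "exp (- C * (t - s)) * measure (F s) {0} \<le> exp (- C * (t - s)) * m 3 \<epsilon> s"
    using m_bounds(3) assms \<epsilon> by (intro mult_left_mono) auto
  also have "\<dots> \<le> m 3 \<epsilon> t" using assms \<epsilon> by (intro m_persists) auto
  finally show "exp (- C * (t - s)) * measure (F s) {0} \<le> m 3 \<epsilon> t" .
qed (use assms in auto)

text \<open>The source of order \<epsilon>^(3/2) acts for one unit of time, which costs the factor
  exp (- C); this is why the bound starts at t0 + 1.\<close>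

lemma m_seed:
  assumes "k \<ge> 3" "c1 > 0" "t0 \<ge> 0" and bath: "\<And>t. t \<ge> t0 \<Longrightarrow> measure (F t) {1..2} \<ge> c1"
  obtains c where "c > 0" "\<And>t \<epsilon>. t \<ge> t0 + 1 \<Longrightarrow> 0 < \<epsilon> \<Longrightarrow> \<epsilon> \<le> 1 \<Longrightarrow> m k \<epsilon> t \<ge> c * (\<epsilon> * sqrt \<epsilon>)"
proof -
  define c where "c = exp (- C) * (b0 / 2 ^ k / 64 * c1\<^sup>2)"
  have "c > 0" using b0 assms by (simp add: c_def)
  moreover have "m k \<epsilon> t \<ge> c * (\<epsilon> * sqrt \<epsilon>)" if t: "t \<ge> t0 + 1" "0 < \<epsilon>" "\<epsilon> \<le> 1" for t \<epsilon>
  proof -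
    let ?a = "b0 / 2 ^ k / 64 * (\<epsilon> * sqrt \<epsilon>) * c1\<^sup>2"
    have "m k \<epsilon> t \<ge> exp (- C * (t - (t - 1))) * (m k \<epsilon> (t - 1) + (t - (t - 1)) * ?a)"
    proof (rule m_growth)
      fix \<tau> assume \<tau>: "t - 1 < \<tau>"
      then interpret scattering_measure b0 \<eta> \<Phi> "F \<tau>" N E using assms t by (intro scattering_measure) auto
      have "?a \<le> b0 / 2 ^ k / 64 * (\<epsilon> * sqrt \<epsilon>) * (measure (F \<tau>) {1..2})\<^sup>2"
        using bath[of \<tau>] \<tau> t b0 assms by (intro mult_left_mono power_mono) auto
      then show "collision_rhs \<Phi> (tent k \<epsilon>) (F \<tau>) \<ge> - C * m k \<epsilon> \<tau> + ?a"
        using collision_rhs_ge(2)[of k \<epsilon>] assms t by (simp add: m_def C_def)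
    qed (use assms t b0 in auto)
    moreover have "exp (- C) * ?a \<le> exp (- C) * (m k \<epsilon> (t - 1) + ?a)"
      using m_bounds(1)[of "t - 1" \<epsilon> k] assms t by (intro mult_left_mono) auto
    ultimately show ?thesis by (simp add: c_def mult_ac)
  qed
  ultimately show ?thesis by (rule that)
qed

text \<open>\<delta> = \<epsilon>^(2/k) serves both as relative cell width and as mass threshold.
  The shift error (2 \<delta>)^k N is of order \<epsilon>^2, at most half of m for small \<epsilon>.
  At most 3/\<delta> cells are used, so the heavy one carries a mass of order \<delta>^2, whose
  square is of order \<epsilon>^(8/k).\<close>

lemma condensation_rate:
  assumes k: "k \<ge> 3" and c: "c > 0" and t1: "t1 \<ge> 0"
    and seed: "\<And>t \<epsilon>. t \<ge> t1 \<Longrightarrow> 0 < \<epsilon> \<Longrightarrow> \<epsilon> \<le> 1 \<Longrightarrow> m k \<epsilon> t \<ge> c * (\<epsilon> * sqrt \<epsilon>)"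
  obtains A \<epsilon>0 where "A > 0" "\<epsilon>0 > 0" "\<epsilon>0 \<le> 1 / 8"
    "\<And>t \<epsilon>. t \<ge> t1 \<Longrightarrow> 0 < \<epsilon> \<Longrightarrow> \<epsilon> \<le> \<epsilon>0 \<Longrightarrow> measure (F t) {2 * \<epsilon><..4 * \<epsilon>} \<ge> \<epsilon> powr (2 / k) \<Longrightarrow>
       collision_rhs \<Phi> (tent k \<epsilon>) (F t) \<ge> - C * m k \<epsilon> t + m k \<epsilon> t / (A * \<epsilon> powr (1 - \<eta> - 8 / k))"
proof -
  \<comment> \<open>108 = 9 * 6 * 2: the square of the 3 in \<open>\<delta>\<^sup>2 / 3\<close>, the
    six permutations, and the half of m lost to the shift error; \<open>2 ^ k\<close> comes from
    \<open>tent_shift\<close>.\<close>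
  define \<kappa> where "\<kappa> = b0 * 4 powr (\<eta> - 1) / (108 * 2 ^ k)"
  have \<kappa>: "\<kappa> > 0" using b0 by (simp add: \<kappa>_def)
  \<comment> \<open>The second bound makes \<open>2 ^ k * N * \<epsilon>\<^sup>2\<close> at most
    half of \<open>c * (\<epsilon> * sqrt \<epsilon>)\<close>.\<close>
  define \<epsilon>0 where "\<epsilon>0 = min (1 / 8) ((c / (2 * 2 ^ k * N))\<^sup>2)"
  have \<epsilon>0: "\<epsilon>0 > 0" using c N_pos by (simp add: \<epsilon>0_def)
  have "collision_rhs \<Phi> (tent k \<epsilon>) (F t) \<ge> - C * m k \<epsilon> t + m k \<epsilon> t / (1 / \<kappa> * \<epsilon> powr (1 - \<eta> - 8 / k))"
    if t: "t \<ge> t1" and \<epsilon>: "0 < \<epsilon>" "\<epsilon> \<le> \<epsilon>0" and ring: "measure (F t) {2 * \<epsilon><..4 * \<epsilon>} \<ge> \<epsilon> powr (2 / k)" for t \<epsilon>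
  proof -
    interpret scattering_measure b0 \<eta> \<Phi> "F t" N E using t t1 by (intro scattering_measure) auto
    define \<delta> where "\<delta> = \<epsilon> powr (2 / k)"
    have \<epsilon>8: "8 * \<epsilon> \<le> 1" using \<epsilon> by (simp add: \<epsilon>0_def)
    have \<delta>: "0 < \<delta>" "\<delta> \<le> 1" using \<epsilon> \<epsilon>8 by (auto simp: \<delta>_def intro!: powr_le1)
    define n where "n = nat \<lceil>2 / \<delta>\<rceil>"
    have n_real: "real n = of_int \<lceil>2 / \<delta>\<rceil>" using \<delta> by (simp add: n_def)
    have n: "2 / \<delta> \<le> real n" "real n \<le> 2 / \<delta> + 1" unfolding n_real by linarith+
    have "real n \<le> 3 / \<delta>"
    proof -
      have "1 \<le> 1 / \<delta>" using \<delta> by simp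
      then show ?thesis using n by (simp add: add_divide_distrib[symmetric] field_simps)
    qed
    have "real n > 0" using n(1) \<delta> by (meson divide_pos_pos less_le_trans zero_less_numeral)
    have n\<delta>: "2 \<le> real n * \<delta>" using n(1) \<delta> by (simp add: pos_divide_le_eq)
    have \<mu>n: "\<delta>\<^sup>2 / 3 \<le> \<delta> / n"
    proof -
      have "\<delta>\<^sup>2 / 3 = \<delta> / (3 / \<delta>)" by (simp add: power2_eq_square)
      also have "\<dots> \<le> \<delta> / n" using \<open>real n \<le> 3 / \<delta>\<close> \<open>real n > 0\<close> \<delta> by (intro divide_left_mono) auto
      finally show ?thesis .
    qed
    have \<delta>k: "\<delta> ^ k = \<epsilon>\<^sup>2"
      using \<epsilon> k unfolding \<delta>_def by (simp add: powr_power)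
    have \<delta>4: "\<delta> ^ 4 = \<epsilon> powr (8 / k)"
      using \<epsilon> unfolding \<delta>_def by (simp add: powr_power)
    have mseed: "m k \<epsilon> t \<ge> c * (\<epsilon> * sqrt \<epsilon>)" using seed[OF t] \<epsilon> \<epsilon>8 by simp
    have small: "(2 * \<delta>) ^ k * N \<le> m k \<epsilon> t / 2"
    proof -
      have "sqrt \<epsilon> \<le> c / (2 * 2 ^ k * N)"
        using \<epsilon> c N_pos by (intro real_le_lsqrt) (auto simp: \<epsilon>0_def)
      then have "2 * 2 ^ k * N * sqrt \<epsilon> \<le> c" using N_pos by (simp add: pos_le_divide_eq mult_ac)
      then have "2 * 2 ^ k * N * sqrt \<epsilon> * (\<epsilon> * sqrt \<epsilon>) \<le> c * (\<epsilon> * sqrt \<epsilon>)"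
        using \<epsilon> by (intro mult_right_mono) auto
      also have "2 * 2 ^ k * N * sqrt \<epsilon> * (\<epsilon> * sqrt \<epsilon>) = 2 * (2 ^ k * N * (\<epsilon> * (sqrt \<epsilon> * sqrt \<epsilon>)))"
        by (simp add: mult_ac)
      also have "sqrt \<epsilon> * sqrt \<epsilon> = \<epsilon>" using \<epsilon> by simp
      finally show ?thesis using mseed by (simp add: power_mult_distrib \<delta>k power2_eq_square mult_ac)
    qed
    have "m k \<epsilon> t \<ge> 0" using m_bounds(1)[of t \<epsilon> k] t t1 \<epsilon> by simp
    have "m k \<epsilon> t / (1 / \<kappa> * \<epsilon> powr (1 - \<eta> - 8 / k)) = \<kappa> * m k \<epsilon> t * (\<epsilon> powr (\<eta> - 1) * \<delta> ^ 4)"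
      unfolding \<delta>4 powr_add[symmetric] using \<epsilon> \<kappa> powr_minus_divide[of \<epsilon> "1 - \<eta> - 8 / k"]
      by (simp add: algebra_simps)
    also have "\<dots> = b0 * (4 * \<epsilon>) powr (\<eta> - 1) * (\<delta>\<^sup>2 / 3)\<^sup>2 / 6 * ((m k \<epsilon> t / 2) / 2 ^ k)"
      using \<epsilon> by (simp add: \<kappa>_def powr_mult power_divide)
    also have "\<dots> \<le> b0 * (4 * \<epsilon>) powr (\<eta> - 1) * (\<delta> / n)\<^sup>2 / 6 * ((m k \<epsilon> t - (2 * \<delta>) ^ k * N) / 2 ^ k)"
    proof (intro mult_mono divide_right_mono mult_left_mono power_mono)
      show "m k \<epsilon> t / 2 \<le> m k \<epsilon> t - (2 * \<delta>) ^ k * N" using small by linarith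
    qed (use b0 \<mu>n \<delta> \<open>m k \<epsilon> t \<ge> 0\<close> in auto)
    finally show ?thesis
      using collision_rhs_ge(3)[of k \<epsilon> \<delta> n \<delta>] k \<epsilon> \<epsilon>8 \<delta> \<open>real n > 0\<close> n\<delta> ring
      by (simp add: m_def C_def \<delta>_def)
  qed
  with that[of "1 / \<kappa>" \<epsilon>0] \<kappa> \<epsilon>0 show ?thesis by (auto simp: \<epsilon>0_def)
qed

text \<open>
  If the shell \<open>(2\<epsilon>, 4\<epsilon>]\<close> carried a mass of at least \<open>\<epsilon>\<^sup>2\<^sup>/\<^sup>k\<close> during more than a small fraction of
  the window \<open>[t - s, t]\<close>, then \<^term>\<open>m k \<epsilon>\<close>, which is at least \<open>c \<epsilon>\<^sup>3\<^sup>/\<^sup>2\<close>, would grow beyond \<open>N\<close>. These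
  fractions are summable over the dyadic scales, so some time is good for all shells at once.
\<close>

lemma condensation:
  assumes bath: "c1 > 0" "t0 \<ge> 0" "\<And>t. t \<ge> t0 \<Longrightarrow> measure (F t) {1..2} \<ge> c1"
    and s: "s > 0" and e: "e > 0"
  shows "\<forall>\<^sub>F R in at_right 0. \<forall>t\<ge>t0 + 1 + s. \<forall>L.
    (\<forall>\<tau>\<in>{t - s..t}. measure (F \<tau>) {0..4 * R} \<ge> L) \<longrightarrow> measure (F t) {0} \<ge> exp (- C * s) * (L - e)"
proof -
  \<comment> \<open>k \<ge> 16 / (1 - \<eta>) gives 8/k \<le> (1 - \<eta>)/2, hence \<beta> > 0; k
    \<ge> 3 is for \<open>Cb2\<close>.\<close>
  define k where "k = max 3 (nat \<lceil>16 / (1 - \<eta>)\<rceil>)"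
  have k: "k \<ge> 3" "16 / (1 - \<eta>) \<le> real k"
    unfolding k_def by (simp, linarith)
  obtain c where c: "c > 0" and seed: "\<And>t \<epsilon>. t \<ge> t0 + 1 \<Longrightarrow> 0 < \<epsilon> \<Longrightarrow> \<epsilon> \<le> 1 \<Longrightarrow> m k \<epsilon> t \<ge> c * (\<epsilon> * sqrt \<epsilon>)"
    using m_seed[OF k(1) bath] by metis
  define a where "a = 2 / real k"
  define \<beta> where "\<beta> = 1 - \<eta> - 8 / real k"
  have a: "a > 0" using k by (simp add: a_def)
  have "16 \<le> real k * (1 - \<eta>)" using k \<eta> by (simp add: pos_divide_le_eq)
  then have "8 / real k < 1 - \<eta>" using k by (simp add: pos_divide_less_eq mult_ac)
  then have \<beta>: "\<beta> > 0" by (simp add: \<beta>_def)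
  have "t0 + 1 \<ge> 0" using bath by simp
  obtain A \<epsilon>0 where A: "A > 0" and \<epsilon>0: "\<epsilon>0 > 0" "\<epsilon>0 \<le> 1 / 8"
    and rate: "\<And>t \<epsilon>. t \<ge> t0 + 1 \<Longrightarrow> 0 < \<epsilon> \<Longrightarrow> \<epsilon> \<le> \<epsilon>0 \<Longrightarrow> measure (F t) {2 * \<epsilon><..4 * \<epsilon>} \<ge> \<epsilon> powr a \<Longrightarrow>
       collision_rhs \<Phi> (tent k \<epsilon>) (F t) \<ge> - C * m k \<epsilon> t + m k \<epsilon> t / (A * \<epsilon> powr \<beta>)"
    apply (rule condensation_rate[OF k(1) c \<open>t0 + 1 \<ge> 0\<close>, folded a_def \<beta>_def])
     apply (erule (2) seed)
    by (rule that)
  \<comment> \<open>From ln y \<le> y^(\<beta>/3) / (\<beta>/3): for y = N / (c \<epsilon>^(3/2))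
    the exponent \<beta>/3 costs a factor \<epsilon>^(-\<beta>/2), half of the available power
    \<epsilon>^\<beta>.\<close>
  define B where "B = A * ((N / c) powr (\<beta> / 3) / (\<beta> / 3))"
  \<comment> \<open>How small R must be: all scales admissible, the two sum conditions of
    \<open>exists_good_time\<close>, and a total mass below e in the good shells.\<close>
  have "\<forall>\<^sub>F R in at_right 0. R \<in> {0<..<\<epsilon>0}"
    using \<epsilon>0 by (intro eventually_at_rightI[of 0 \<epsilon>0]) auto
  moreover have "\<forall>\<^sub>F R in at_right 0. C * A / (1 - 2 powr - \<beta>) * R powr \<beta> < 1 / 2"
    using \<beta> by (intro order_tendstoD(2)[OF tendsto_powr_at_right_0]) auto
  moreover have "\<forall>\<^sub>F R in at_right 0. B / (1 - 2 powr - (\<beta> / 2)) * R powr (\<beta> / 2) < s / 2"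
    using \<beta> s by (intro order_tendstoD(2)[OF tendsto_powr_at_right_0]) auto
  moreover have "\<forall>\<^sub>F R in at_right 0. 1 / (1 - 2 powr - a) * R powr a < e"
    using a e by (intro order_tendstoD(2)[OF tendsto_powr_at_right_0]) auto
  ultimately show ?thesis
  proof eventually_elim
    case (elim R)
    then have R: "0 < R" "R < \<epsilon>0" by auto
    show ?case
    proof (intro allI impI)
      fix t L assume t: "t0 + 1 + s \<le> t" and L: "\<forall>\<tau>\<in>{t - s..t}. measure (F \<tau>) {0..4 * R} \<ge> L"
      let ?\<epsilon> = "\<lambda>j :: nat. R / 2 ^ j"
      have \<epsilon>: "0 < ?\<epsilon> j" "?\<epsilon> j \<le> \<epsilon>0" "?\<epsilon> j \<le> 1" for j
      proof -
        have "?\<epsilon> j \<le> R" using R by (simp add: divide_le_eq mult_le_cancel_left1)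
        then show "?\<epsilon> j \<le> \<epsilon>0" "?\<epsilon> j \<le> 1" using R \<epsilon>0 by linarith+
        show "0 < ?\<epsilon> j" using R by simp
      qed
      let ?bad = "\<lambda>j \<tau>. measure (F \<tau>) {2 * ?\<epsilon> j<..4 * ?\<epsilon> j} \<ge> ?\<epsilon> j powr a"
      \<comment> \<open>The good time depends on the number J of shells. No limit of these times is
        taken: each is carried forward to the same t by \<open>m_persists\<close>.\<close>
      have good: "\<exists>\<tau>\<in>{t - s..t}. \<forall>j\<in>{..<J}. \<not> ?bad j \<tau>" for J
      proof (rule exists_good_time[where f = "\<lambda>j. m k (?\<epsilon> j)" and C = C and N = N
            and f' = "\<lambda>j \<tau>. collision_rhs \<Phi> (tent k (?\<epsilon> j)) (F \<tau>)" and w = "\<lambda>j. A * ?\<epsilon> j powr \<beta>"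
            and c = "\<lambda>j. c * (?\<epsilon> j * sqrt (?\<epsilon> j))"])
        fix j \<tau> assume \<tau>: "\<tau> \<in> {t - s..t}"
        then have \<tau>1: "\<tau> \<ge> t0 + 1" "\<tau> \<ge> 0" using t bath by auto
        interpret scattering_measure b0 \<eta> \<Phi> "F \<tau>" N E by (rule scattering_measure) fact
        show "(m k (?\<epsilon> j) has_real_derivative collision_rhs \<Phi> (tent k (?\<epsilon> j)) (F \<tau>)) (at \<tau> within {t - s..t})"
          using k \<epsilon> \<tau>1 t bath by (intro m_deriv) auto
        show "- C * m k (?\<epsilon> j) \<tau> \<le> collision_rhs \<Phi> (tent k (?\<epsilon> j)) (F \<tau>)"
          using collision_rhs_ge(1)[of k "?\<epsilon> j"] k \<epsilon>[of j] by (simp add: m_def C_def)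
        show "- C * m k (?\<epsilon> j) \<tau> + m k (?\<epsilon> j) \<tau> / (A * ?\<epsilon> j powr \<beta>) \<le> collision_rhs \<Phi> (tent k (?\<epsilon> j)) (F \<tau>)"
          if "?bad j \<tau>" using rate[OF \<tau>1(1) \<epsilon>(1,2) that] .
        show "0 < c * (?\<epsilon> j * sqrt (?\<epsilon> j)) \<and> c * (?\<epsilon> j * sqrt (?\<epsilon> j)) \<le> m k (?\<epsilon> j) \<tau> \<and> m k (?\<epsilon> j) \<tau> \<le> N"
          using seed[OF \<tau>1(1) \<epsilon>(1,3), of j] m_bounds(2)[OF \<tau>1(2) \<epsilon>(1), of k j] c R by auto
      next
        have "C * (\<Sum>j<J. A * ?\<epsilon> j powr \<beta>) = C * A * (\<Sum>j<J. ?\<epsilon> j powr \<beta>)"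
          by (simp add: sum_distrib_left mult_ac)
        also have "\<dots> \<le> C * A * (R powr \<beta> / (1 - 2 powr - \<beta>))"
          using sum_geometric_powr_le[OF R(1) \<beta>] C_pos A by (intro mult_left_mono) auto
        also have "\<dots> = C * A / (1 - 2 powr - \<beta>) * R powr \<beta>" by simp
        also have "\<dots> \<le> 1 / 2" using elim(2) by (rule less_imp_le)
        finally show "C * (\<Sum>j<J. A * ?\<epsilon> j powr \<beta>) \<le> 1 / 2" .
      next
        have "A * ?\<epsilon> j powr \<beta> * ln (N / (c * (?\<epsilon> j * sqrt (?\<epsilon> j)))) \<le> B * ?\<epsilon> j powr (\<beta> / 2)" for j
        proof -
          define \<epsilon>j where "\<epsilon>j = ?\<epsilon> j"
          have \<epsilon>j: "0 < \<epsilon>j" "\<epsilon>j \<le> 1" using \<epsilon> by (auto simp: \<epsilon>j_def)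
          have pw: "\<epsilon>j * sqrt \<epsilon>j = \<epsilon>j powr (3 / 2)"
            using \<epsilon>j powr_add[of \<epsilon>j 1 "1 / 2"] by (simp add: powr_half_sqrt)
          have "c * (\<epsilon>j * sqrt \<epsilon>j) \<le> N"
            using seed[of t \<epsilon>j] m_bounds(2)[of t \<epsilon>j k] \<epsilon>j t s bath by linarith
          then have "1 \<le> N / (c * (\<epsilon>j * sqrt \<epsilon>j))" using c \<epsilon>j by (simp add: pos_le_divide_eq)
          then have "ln (N / (c * (\<epsilon>j * sqrt \<epsilon>j))) \<le> (N / (c * (\<epsilon>j * sqrt \<epsilon>j))) powr (\<beta> / 3) / (\<beta> / 3)"
            using \<beta> by (intro ln_powr_bound) auto
          also have "(N / (c * (\<epsilon>j * sqrt \<epsilon>j))) powr (\<beta> / 3) = (N / c) powr (\<beta> / 3) / \<epsilon>j powr (\<beta> / 2)"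
            using c \<epsilon>j N_pos unfolding pw by (simp add: powr_divide powr_mult powr_powr)
          finally have "A * \<epsilon>j powr \<beta> * ln (N / (c * (\<epsilon>j * sqrt \<epsilon>j))) \<le>
              A * \<epsilon>j powr \<beta> * ((N / c) powr (\<beta> / 3) / \<epsilon>j powr (\<beta> / 2) / (\<beta> / 3))"
            using A by (intro mult_left_mono) auto
          also have "\<dots> = B * (\<epsilon>j powr \<beta> / \<epsilon>j powr (\<beta> / 2))" by (simp add: B_def mult_ac)
          also have "\<epsilon>j powr \<beta> / \<epsilon>j powr (\<beta> / 2) = \<epsilon>j powr (\<beta> / 2)"
            by (simp add: powr_diff[symmetric])
          finally show ?thesis by (simp add: \<epsilon>j_def)
        qed
        then have "(\<Sum>j<J. A * ?\<epsilon> j powr \<beta> * ln (N / (c * (?\<epsilon> j * sqrt (?\<epsilon> j))))) \<le> (\<Sum>j<J. B * ?\<epsilon> j powr (\<beta> / 2))"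
          by (intro sum_mono)
        also have "\<dots> = B * (\<Sum>j<J. ?\<epsilon> j powr (\<beta> / 2))" by (simp add: sum_distrib_left)
        also have "\<dots> \<le> B * (R powr (\<beta> / 2) / (1 - 2 powr - (\<beta> / 2)))"
          using sum_geometric_powr_le[OF R(1), of "\<beta> / 2"] \<beta> A c N_pos
          by (intro mult_left_mono) (auto simp: B_def)
        also have "\<dots> = B / (1 - 2 powr - (\<beta> / 2)) * R powr (\<beta> / 2)" by simp
        also have "\<dots> < s / 2" by (rule elim(3))
        finally show "(\<Sum>j<J. A * ?\<epsilon> j powr \<beta> * ln (N / (c * (?\<epsilon> j * sqrt (?\<epsilon> j))))) < (t - (t - s)) / 2"
          by simp
      qed (use s C_pos A R in auto)
      \<comment> \<open>For fixed \<rho> the interval [0, 4R/2^J] shrinks to {0} as J grows, so the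
        tent at scale \<rho> is nearly 1 on it and nothing more is lost in the limit.\<close>
      have low: "m 3 \<rho> t \<ge> exp (- C * s) * (L - e)" if \<rho>: "0 < \<rho>" "\<rho> \<le> 1" for \<rho>
      proof (rule LIMSEQ_le_const2)
        have "(\<lambda>J. 4 * R / 2 ^ J) \<longlonglongrightarrow> 0"
          using LIMSEQ_divide_realpow_zero[of 2 "4 * R"] by simp
        then have "(\<lambda>J. exp (- C * s) * ((1 - (4 * R / 2 ^ J) / \<rho>) ^ 3 * (L - e))) \<longlonglongrightarrow>
            exp (- C * s) * ((1 - 0 / \<rho>) ^ 3 * (L - e))"
          using \<rho> by (intro tendsto_intros) auto
        then show "(\<lambda>J. exp (- C * s) * ((1 - (4 * R / 2 ^ J) / \<rho>) ^ 3 * (L - e))) \<longlonglongrightarrow> exp (- C * s) * (L - e)"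
          by simp
        have "\<forall>\<^sub>F J in sequentially. 4 * R / 2 ^ J < \<rho>"
          using order_tendstoD(2)[OF \<open>(\<lambda>J. 4 * R / 2 ^ J) \<longlonglongrightarrow> 0\<close> \<rho>(1)] .
        then have "\<forall>\<^sub>F J in sequentially. exp (- C * s) * ((1 - (4 * R / 2 ^ J) / \<rho>) ^ 3 * (L - e)) \<le> m 3 \<rho> t"
        proof eventually_elim
          case (elim J)
          define r where "r = 4 * R / 2 ^ J"
          have r: "0 < r" "r < \<rho>" using R elim by (auto simp: r_def)
          obtain \<tau> where \<tau>: "\<tau> \<in> {t - s..t}" and nb: "\<forall>j\<in>{..<J}. \<not> ?bad j \<tau>" using good by blast
          then have \<tau>0: "\<tau> \<ge> 0" using t bath by auto
          interpret scattering_measure b0 \<eta> \<Phi> "F \<tau>" N E by (rule scattering_measure) fact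
          \<comment> \<open>The lower end of shell j is the upper end of shell j + 1, so removing
            the first J shells costs at most the sum of their thresholds.\<close>
          have shells: "measure (F \<tau>) {0..4 * R} \<le> measure (F \<tau>) {0..4 * ?\<epsilon> J} + (\<Sum>j<J. ?\<epsilon> j powr a)"
            using nb
          proof (induction J)
            case (Suc J)
            have "{0..4 * ?\<epsilon> J} = {0..4 * ?\<epsilon> (Suc J)} \<union> {2 * ?\<epsilon> J<..4 * ?\<epsilon> J}"
              using R by auto
            then have "measure (F \<tau>) {0..4 * ?\<epsilon> J} = measure (F \<tau>) ({0..4 * ?\<epsilon> (Suc J)} \<union> {2 * ?\<epsilon> J<..4 * ?\<epsilon> J})"
              by (rule arg_cong)
            also have "\<dots> \<le> measure (F \<tau>) {0..4 * ?\<epsilon> (Suc J)} + measure (F \<tau>) {2 * ?\<epsilon> J<..4 * ?\<epsilon> J}"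
              using R by (intro measure_Un_le in_sets_M)
                (auto intro: order_trans[of 0 "2 * R / 2 ^ J"])
            also have "measure (F \<tau>) {2 * ?\<epsilon> J<..4 * ?\<epsilon> J} \<le> ?\<epsilon> J powr a"
              using Suc.prems by (simp add: not_le less_imp_le)
            finally show ?case using Suc by (simp add: add.assoc)
          qed simp
          have "(\<Sum>j<J. ?\<epsilon> j powr a) < e"
            using sum_geometric_powr_le[OF R(1) a, of J] \<open>1 / (1 - 2 powr - a) * R powr a < e\<close> by simp
          moreover have "L \<le> measure (F \<tau>) {0..4 * R}" using L \<tau> by blast
          ultimately have Le: "L - e \<le> measure (F \<tau>) {0..r}" using shells by (simp add: r_def)
          have "exp (- C * s) * ((1 - r / \<rho>) ^ 3 * (L - e)) \<le> exp (- C * s) * ((1 - r / \<rho>) ^ 3 * measure (F \<tau>) {0..r})"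
            using Le r by (intro mult_left_mono) auto
          also have "\<dots> \<le> exp (- C * s) * m 3 \<rho> \<tau>"
            using m_bounds(4)[OF \<tau>0 \<rho>(1), of r 3] r by (intro mult_left_mono) auto
          also have "\<dots> \<le> exp (- C * (t - \<tau>)) * m 3 \<rho> \<tau>"
            using m_bounds(1)[OF \<tau>0 \<rho>(1), of 3] \<tau> C_pos by (intro mult_right_mono) auto
          also have "\<dots> \<le> m 3 \<rho> t" using \<tau> \<tau>0 \<rho> by (intro m_persists) auto
          finally show ?case by (simp add: r_def)
        qed
        then show "\<exists>n. \<forall>J\<ge>n. exp (- C * s) * ((1 - (4 * R / 2 ^ J) / \<rho>) ^ 3 * (L - e)) \<le> m 3 \<rho> t"
          by (simp add: eventually_sequentially)
      qed
      show "exp (- C * s) * (L - e) \<le> measure (F t) {0}"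
        using t s bath by (intro atom_ge low) auto
    qed
  qed
qed

end

section \<open>Convergence of the atom\<close>

lemma (in halfline_measure) eventually_measure_Icc_less:
  assumes "measure M {0} < b"
  shows "\<forall>\<^sub>F R in at_right 0. measure M {0..R} < b"
proof -
  have "\<forall>\<^sub>F n in sequentially. measure M {0..1 / real (Suc n)} < b"
    by (rule order_tendstoD(2)[OF tendsto_measure_singleton assms])
  then obtain n where n: "measure M {0..1 / real (Suc n)} < b"
    by (auto simp: eventually_sequentially)
  show ?thesis
  proof (rule eventually_at_rightI[of 0 "1 / real (Suc n)"])
    fix R assume R: "R \<in> {0<..<1 / real (Suc n)}"
    have "measure M {0..R} \<le> measure M {0..1 / real (Suc n)}"
      using R by (intro finite_measure_mono) (auto intro!: in_sets_M)
    then show "measure M {0..R} < b" using n by simp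
  qed simp
qed

text \<open>The upper bound is soft: the atom is at most the mass of [0, R], which converges to a
  value close to the equilibrium atom. The lower bound is \<open>condensation\<close>, with window
  length and error both equal to a small s.\<close>

lemma (in bose_solution) atom_tendsto:
  assumes G: "halfline_measure G N E" and bath: "measure G {1..2} > 0"
    and lim: "((\<lambda>t. norm1_circ (signed_diff (F t) G)) \<longlongrightarrow> 0) at_top"
  shows "((\<lambda>t. measure (F t) {0}) \<longlongrightarrow> measure G {0}) at_top"
proof (rule order_tendstoI)
  interpret G: halfline_measure G N E by (rule G)
  have lim_Icc: "((\<lambda>t. measure (F t) {0..R}) \<longlongrightarrow> measure G {0..R}) at_top" if "R > 0" for R
    by (rule norm1_circ_tendsto_measure_Icc[OF _ G lim that]) (rule halfline)
  show "\<forall>\<^sub>F t in at_top. measure (F t) {0} < b" if b: "measure G {0} < b" for b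
  proof -
    from G.eventually_measure_Icc_less[OF b] have "\<forall>\<^sub>F R in at_right 0. 0 < R \<and> measure G {0..R} < b"
      by (auto intro: eventually_conj eventually_at_right_less)
    then obtain R where R: "R > 0" "measure G {0..R} < b"
      by (auto dest: eventually_happens)
    have "\<forall>\<^sub>F t in at_top. measure (F t) {0..R} < b" by (rule order_tendstoD(2)[OF lim_Icc]) fact+
    then show ?thesis using eventually_ge_at_top[of 0]
    proof eventually_elim
      case (elim t)
      interpret halfline_measure "F t" N E by (rule halfline) fact
      have "measure (F t) {0} \<le> measure (F t) {0..R}"
        using R by (intro finite_measure_mono) (auto intro!: in_sets_M)
      with elim show ?case by simp
    qed
  qed
  fix b assume b: "b < measure G {0}"
  define c1 where "c1 = measure G {1..2} / 2"
  have "((\<lambda>t. measure (F t) {1..2}) \<longlongrightarrow> measure G {1..2}) at_top"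
    by (rule norm1_circ_tendsto_measure[OF halfline G lim, where r = 1]) auto
  then have "\<forall>\<^sub>F t in at_top. c1 < measure (F t) {1..2}"
    using bath by (intro order_tendstoD(1)) (auto simp: c1_def)
  then obtain t0' where t0': "\<And>t. t \<ge> t0' \<Longrightarrow> c1 < measure (F t) {1..2}"
    by (auto simp: eventually_at_top_linorder)
  define t0 where "t0 = max t0' 0"
  have t0: "c1 > 0" "t0 \<ge> 0" "\<And>t. t \<ge> t0 \<Longrightarrow> measure (F t) {1..2} \<ge> c1"
    using bath t0' by (auto simp: t0_def c1_def intro: less_imp_le)
  \<comment> \<open>Two losses of size s: the error in \<open>condensation\<close>, and the gap
    between the solution and G on [0, 4R].\<close>
  have "((\<lambda>s. exp (- C * s) * (measure G {0} - s - s)) \<longlongrightarrow> exp (- C * 0) * (measure G {0} - 0 - 0)) (at_right 0)"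
    by (intro tendsto_intros)
  then have "\<forall>\<^sub>F s in at_right 0. b < exp (- C * s) * (measure G {0} - s - s)"
    using b by (intro order_tendstoD(1)) auto
  then have "\<forall>\<^sub>F s in at_right 0. 0 < s \<and> b < exp (- C * s) * (measure G {0} - s - s)"
    by (auto intro: eventually_conj eventually_at_right_less)
  then obtain s where s: "s > 0" "b < exp (- C * s) * (measure G {0} - s - s)"
    by (auto dest: eventually_happens)
  have "\<forall>\<^sub>F R in at_right 0. 0 < R \<and> (\<forall>t\<ge>t0 + 1 + s. \<forall>L.
    (\<forall>\<tau>\<in>{t - s..t}. measure (F \<tau>) {0..4 * R} \<ge> L) \<longrightarrow> measure (F t) {0} \<ge> exp (- C * s) * (L - s))"
    using condensation[OF t0 s(1) s(1)] by (auto intro: eventually_conj eventually_at_right_less)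
  then obtain R where R: "R > 0" and atom: "\<And>t L. t \<ge> t0 + 1 + s \<Longrightarrow>
    (\<forall>\<tau>\<in>{t - s..t}. measure (F \<tau>) {0..4 * R} \<ge> L) \<Longrightarrow> measure (F t) {0} \<ge> exp (- C * s) * (L - s)"
    by (auto dest: eventually_happens)
  have "measure G {0} \<le> measure G {0..4 * R}"
    using R by (intro G.finite_measure_mono) (auto intro!: G.in_sets_M)
  then have "\<forall>\<^sub>F t in at_top. measure G {0} - s < measure (F t) {0..4 * R}"
    using s R by (intro order_tendstoD(1)[OF lim_Icc]) auto
  then obtain t2 where t2: "\<And>t. t \<ge> t2 \<Longrightarrow> measure G {0} - s < measure (F t) {0..4 * R}"
    by (auto simp: eventually_at_top_linorder)
  \<comment> \<open>t \<ge> t2 + s puts the whole window [t - s, t] beyond t2.\<close>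
  show "\<forall>\<^sub>F t in at_top. b < measure (F t) {0}"
    using eventually_ge_at_top[of "max (t0 + 1 + s) (t2 + s)"]
  proof eventually_elim
    case (elim t)
    have "measure (F t) {0} \<ge> exp (- C * s) * (measure G {0} - s - s)"
      using elim t2 by (intro atom) (auto intro: less_imp_le)
    with s show ?case by simp
  qed
qed

theorem theorem1p2:
  fixes \<Phi> :: "real \<Rightarrow> real \<Rightarrow> real"
    and b0 \<eta> N E :: real
    and F :: "real \<Rightarrow> real measure"
    and Fbe :: "real measure"
  assumes "scattering_factor b0 \<eta> \<Phi>"
    and "N > 0" and "E > 0"
    and "conservative_solution \<Phi> N E F"
    and "bose_einstein_equilibrium N E Fbe"
    and "temperature_ratio N E < 1"
    and "((\<lambda>t. norm1_circ (signed_diff (F t) Fbe)) \<longlongrightarrow> 0) at_top"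
  shows "\<exists>T\<ge>0. measure (F T) {0} > 0 \<and>
           (\<forall>t\<ge>T. measure (F t) {0} \<ge> exp (- sqrt (N * E) * (t - T)) * measure (F T) {0} \<and>
                   exp (- sqrt (N * E) * (t - T)) * measure (F T) {0} > 0) \<and>
           ((\<lambda>t. measure (F t) {0}) \<longlongrightarrow> measure Fbe {0}) at_top \<and>
           ((\<lambda>t. norm1 (signed_diff (F t) Fbe)) \<longlongrightarrow> 0) at_top"
proof -
  interpret bose_solution b0 \<eta> \<Phi> N E F
    using assms by (simp add: bose_solution_def scattering_def bose_solution_axioms_def)
  have G: "halfline_measure Fbe N E" by (rule bose_einstein_halfline) fact
  have lim: "((\<lambda>t. measure (F t) {0}) \<longlongrightarrow> measure Fbe {0}) at_top"
    by (rule atom_tendsto[OF G bose_einstein_bath]) fact+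
  have "measure Fbe {0} > 0"
    using bose_einstein_atom[OF assms(5)] condensate_mass_pos[OF assms(2,3,6)] by simp
  \<comment> \<open>Any sufficiently late time serves as T, since the limit of the atoms is
    positive.\<close>
  then have "\<forall>\<^sub>F t in at_top. 0 < measure (F t) {0} \<and> 0 \<le> t"
    using order_tendstoD(1)[OF lim] by (auto intro: eventually_conj eventually_ge_at_top)
  then obtain T where T: "T \<ge> 0" "measure (F T) {0} > 0"
    by (auto dest: eventually_happens)
  show ?thesis
    using T lim atom_persists[OF T(1)] norm1_tendsto_0[OF halfline G assms(7) lim]
    by (intro exI[of _ T]) (simp add: C_def)
qed

end
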